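(* (1) $\mathsf{CohFrm_{Sup}}$ is equivalent to $\mathsf{DL_M}$ and dually equivalent to $\mathsf{PS_R}$. (2) $\mathsf{CohFrm_{FInf}}$ is equivalent to $\mathsf{DL_L}$ and dually equivalent to $\mathsf{PS_{PS}}$.
   Context: Frames. $\mathsf K(L)$ is the set of compact elements of a complete lattice $L$. A coherent frame is a frame in which every element is a join of compact elements and finite meets of compact elements (including the empty meet $1$) are compact. $\mathsf{CohFrm_{Sup}}$: coherent frames and maps preserving arbitrary joins and compact elements. $\mathsf{CohFrm_{FInf}}$: coherent frames and those $\mathsf{CohFrm_{Sup}}$-morphisms $\alpha\colon L_1\to L_2$ such that whenever $\varnothing\ne S\subseteq\mathsf K(L_1)$ is finite and $\bigwedge S\in\mathsf K(L_1)$, then $\alpha(\bigwedge S)=\bigwedge\alpha[S]$. Lattices. $\mathsf{DL_M}$: bounded distributive lattices and maps preserving all finite meets (including $1$, but not necessarily $0$). $\mathsf{DL_L}$: bounded distributive lattices and maps preserving all finite meets (including $1$) and nonempty finite joins (not necessarily $0$). Spaces. A Priestley space is a compact space with a partial order such that $x\not\le y$ implies there is a clopen upset containing $x$ and missing $y$; $\mathsf{ClopUp}(X)$ is the set of clopen upsets of $X$. For $R\subseteq X\times Y$ write $R[x]=\{y\mid x\mathrel Ry\}$, $\Box_RU=\{x\mid R[x]\subseteq U\}$. $\mathsf{PS_R}$: Priestley spaces and generalized Priestley morphisms, i.e. relations $R\subseteq X\times Y$ such that (i) if $x\not\mathrel Ry$ there is $U\in\mathsf{ClopUp}(Y)$ with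 $R[x]\subseteq U$, $y\notin U$; (ii) $U\in\mathsf{ClopUp}(Y)$ implies $\Box_RU\in\mathsf{ClopUp}(X)$; identities are $\le$ and the composite is $x\mathrel{(S*R)}z$ iff for all $U\in\mathsf{ClopUp}(Z)$, $x\in\Box_R\Box_SU$ implies $z\in U$. $\mathsf{PS_{PS}}$: Priestley spaces and partial strong Priestley morphisms, i.e. partial functions $f\colon X\dashrightarrow Y$ (functions from a subset of $X$ to $Y$) whose domain is a clopen downset of $X$ and such that $U\in\mathsf{ClopUp}(Y)$ implies $X\setminus f^{-1}(Y\setminus U)\in\mathsf{ClopUp}(X)$, with composition of partial functions. *)

theory Defs
  imports "HOL-Analysis.Abstract_Topology" "HOL-Library.Equipollence" "HOL-Library.FuncSet"
    "HOL-Algebra.Complete_Lattice"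
begin

section \<open>Categories\<close>

text \<open>Homsets of different pairs of objects may overlap, so everything that acts on an arrow
  also takes its domain and codomain: \<open>Comp C X Y Z g f\<close> is the composite \<open>g \<circ> f\<close> of
  \<open>f : X \<rightarrow> Y\<close> and \<open>g : Y \<rightarrow> Z\<close>.\<close>

record ('o, 'm) cat =
  Ob :: "'o set"
  Hom :: "'o \<Rightarrow> 'o \<Rightarrow> 'm set"
  Idn :: "'o \<Rightarrow> 'm"
  Comp :: "'o \<Rightarrow> 'o \<Rightarrow> 'o \<Rightarrow> 'm \<Rightarrow> 'm \<Rightarrow> 'm"

locale category =
  fixes C :: "('o, 'm) cat"
  assumes Idn_in_Hom: "X \<in> Ob C \<Longrightarrow> Idn C X \<in> Hom C X X"
    and Comp_in_Hom: "\<lbrakk>X \<in> Ob C; Y \<in> Ob C; Z \<in> Ob C; f \<in> Hom C X Y; g \<in> Hom C Y Z\<rbrakk>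
      \<Longrightarrow> Comp C X Y Z g f \<in> Hom C X Z"
    and Comp_Idn_left: "\<lbrakk>X \<in> Ob C; Y \<in> Ob C; f \<in> Hom C X Y\<rbrakk> \<Longrightarrow> Comp C X Y Y (Idn C Y) f = f"
    and Comp_Idn_right: "\<lbrakk>X \<in> Ob C; Y \<in> Ob C; f \<in> Hom C X Y\<rbrakk> \<Longrightarrow> Comp C X X Y f (Idn C X) = f"
    and Comp_assoc: "\<lbrakk>W \<in> Ob C; X \<in> Ob C; Y \<in> Ob C; Z \<in> Ob C;
        f \<in> Hom C W X; g \<in> Hom C X Y; h \<in> Hom C Y Z\<rbrakk>
      \<Longrightarrow> Comp C W X Z (Comp C X Y Z h g) f = Comp C W Y Z h (Comp C W X Y g f)"

definition dual_cat :: "('o, 'm) cat \<Rightarrow> ('o, 'm) cat" where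
  "dual_cat C = \<lparr>Ob = Ob C, Hom = (\<lambda>X Y. Hom C Y X), Idn = Idn C,
     Comp = (\<lambda>X Y Z g f. Comp C Z Y X f g)\<rparr>"

record ('o, 'm, 'p, 'n) func =
  on_Ob :: "'o \<Rightarrow> 'p"
  on_Hom :: "'o \<Rightarrow> 'o \<Rightarrow> 'm \<Rightarrow> 'n"

definition is_functor ::
    "('o, 'm) cat \<Rightarrow> ('p, 'n) cat \<Rightarrow> ('o, 'm, 'p, 'n) func \<Rightarrow> bool" where
  "is_functor C D F \<longleftrightarrow>
     (\<forall>X\<in>Ob C. on_Ob F X \<in> Ob D) \<and>
     (\<forall>X\<in>Ob C. \<forall>Y\<in>Ob C. \<forall>f\<in>Hom C X Y. on_Hom F X Y f \<in> Hom D (on_Ob F X) (on_Ob F Y)) \<and>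
     (\<forall>X\<in>Ob C. on_Hom F X X (Idn C X) = Idn D (on_Ob F X)) \<and>
     (\<forall>X\<in>Ob C. \<forall>Y\<in>Ob C. \<forall>Z\<in>Ob C. \<forall>f\<in>Hom C X Y. \<forall>g\<in>Hom C Y Z.
        on_Hom F X Z (Comp C X Y Z g f) =
        Comp D (on_Ob F X) (on_Ob F Y) (on_Ob F Z) (on_Hom F Y Z g) (on_Hom F X Y f))"

definition id_func :: "('o, 'm, 'o, 'm) func" where
  "id_func = \<lparr>on_Ob = (\<lambda>X. X), on_Hom = (\<lambda>X Y f. f)\<rparr>"

definition comp_func ::
    "('p, 'n, 'q, 'k) func \<Rightarrow> ('o, 'm, 'p, 'n) func \<Rightarrow> ('o, 'm, 'q, 'k) func" where
  "comp_func G F = \<lparr>on_Ob = (\<lambda>X. on_Ob G (on_Ob F X)),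
     on_Hom = (\<lambda>X Y f. on_Hom G (on_Ob F X) (on_Ob F Y) (on_Hom F X Y f))\<rparr>"

definition is_iso :: "('o, 'm) cat \<Rightarrow> 'o \<Rightarrow> 'o \<Rightarrow> 'm \<Rightarrow> bool" where
  "is_iso C X Y f \<longleftrightarrow> f \<in> Hom C X Y \<and>
     (\<exists>g\<in>Hom C Y X. Comp C X Y X g f = Idn C X \<and> Comp C Y X Y f g = Idn C Y)"

definition natural_iso ::
    "('o, 'm) cat \<Rightarrow> ('p, 'n) cat \<Rightarrow> ('o, 'm, 'p, 'n) func \<Rightarrow> ('o, 'm, 'p, 'n) func
      \<Rightarrow> ('o \<Rightarrow> 'n) \<Rightarrow> bool" where
  "natural_iso C D F G \<eta> \<longleftrightarrow>
     (\<forall>X\<in>Ob C. is_iso D (on_Ob F X) (on_Ob G X) (\<eta> X)) \<and>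
     (\<forall>X\<in>Ob C. \<forall>Y\<in>Ob C. \<forall>f\<in>Hom C X Y.
        Comp D (on_Ob F X) (on_Ob F Y) (on_Ob G Y) (\<eta> Y) (on_Hom F X Y f) =
        Comp D (on_Ob F X) (on_Ob G X) (on_Ob G Y) (on_Hom G X Y f) (\<eta> X))"

definition equivalent_cats :: "('o, 'm) cat \<Rightarrow> ('p, 'n) cat \<Rightarrow> bool" where
  "equivalent_cats C D \<longleftrightarrow> category C \<and> category D \<and>
     (\<exists>F G \<eta> \<epsilon>. is_functor C D F \<and> is_functor D C G \<and>
        natural_iso C C id_func (comp_func G F) \<eta> \<and>
        natural_iso D D (comp_func F G) id_func \<epsilon>)"

definition dually_equivalent_cats :: "('o, 'm) cat \<Rightarrow> ('p, 'n) cat \<Rightarrow> bool" where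
  "dually_equivalent_cats C D \<longleftrightarrow> equivalent_cats (dual_cat C) D"


section \<open>Size\<close>

text \<open>There is no type of all lattices, so the categories below consist of structures carried by
  subsets of a type \<open>'v\<close>, bounded in size by a class \<open>\<K>\<close> of cardinals (represented by subsets of
  \<open>'v\<close>).  Passing from a bounded distributive lattice \<open>D\<close> to its coherent frame or to its Priestley
  space raises the cardinality up to \<open>2\<^sup>|\<^sup>D\<^sup>|\<close>; therefore coherent frames and Priestley spaces are
  measured by their compact elements and clopen upsets (which correspond to the elements of \<open>D\<close>),
  and \<open>'v\<close> is required to have room for the power sets of the members of \<open>\<K>\<close>.  By
  \<open>size_class_for_type\<close>, for every type some \<open>\<K>\<close> bounds nothing away: a structure over
  any type has an isomorphic copy among the objects.  By \<open>small_carrier_iff\<close> and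
  \<open>small_points_iff\<close>, for \<open>\<K>\<close> closed under power sets (the small sets of a universe) an object is
  small exactly if its carrier is.\<close>

definition small :: "'v set set \<Rightarrow> 'a set \<Rightarrow> bool" where
  "small \<K> A \<longleftrightarrow> (\<exists>B\<in>\<K>. A \<lesssim> B)"

definition size_class :: "'v set set \<Rightarrow> bool" where
  "size_class \<K> \<longleftrightarrow> (\<forall>B\<in>\<K>. Pow B \<lesssim> (UNIV :: 'v set))"

lemma size_class_for_type:
  "\<exists>\<K> :: 'u set set set. size_class \<K> \<and> (\<forall>A :: 'u set. small \<K> A)"
proof (intro exI conjI allI)
  let ?S = "range (\<lambda>x :: 'u. {x})"
  have "inj_on (\<lambda>P. \<Union>P) (Pow ?S)"
  proof (rule inj_onI)
    fix P Q assume "P \<in> Pow ?S" "Q \<in> Pow ?S" and eq: "\<Union>P = \<Union>Q"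
    then have "P = {{x} | x. x \<in> \<Union>P}" "Q = {{x} | x. x \<in> \<Union>Q}" by blast+
    with eq show "P = Q" by simp
  qed
  then show "size_class {?S}" unfolding size_class_def lepoll_def by blast
  show "small {?S} A" for A :: "'u set"
    unfolding small_def lepoll_def by (auto intro!: exI[of _ "\<lambda>x. {x}"] inj_onI)
qed


section \<open>Coherent frames\<close>

definition compact_elements :: "('a, 'b) gorder_scheme \<Rightarrow> 'a set" where
  "compact_elements L = {c \<in> carrier L. \<forall>S\<subseteq>carrier L. c \<sqsubseteq>\<^bsub>L\<^esub> \<Squnion>\<^bsub>L\<^esub>S \<longrightarrow>
     (\<exists>F\<subseteq>S. finite F \<and> c \<sqsubseteq>\<^bsub>L\<^esub> \<Squnion>\<^bsub>L\<^esub>F)}"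

locale frame = complete_lattice L for L (structure) +
  assumes meet_sup_distrib:
    "\<lbrakk>a \<in> carrier L; S \<subseteq> carrier L\<rbrakk> \<Longrightarrow> a \<sqinter> \<Squnion>S = \<Squnion>((\<lambda>s. a \<sqinter> s) ` S)"

locale coherent_frame = frame +
  assumes sup_of_compact: "x \<in> carrier L \<Longrightarrow> \<exists>S\<subseteq>compact_elements L. x = \<Squnion>S"
    and inf_compact: "\<lbrakk>finite F; F \<subseteq> compact_elements L\<rbrakk> \<Longrightarrow> \<Sqinter>F \<in> compact_elements L"

text \<open>Morphisms between algebraic structures are extensional functions (\<open>\<rightarrow>\<^sub>E\<close>), so that they are
  equal as soon as they agree on the carrier.\<close>

definition Hom_Sup :: "'a gorder \<Rightarrow> 'a gorder \<Rightarrow> ('a \<Rightarrow> 'a) set" where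
  "Hom_Sup L M = {\<alpha> \<in> carrier L \<rightarrow>\<^sub>E carrier M.
     sup_pres L M \<alpha> \<and> \<alpha> ` compact_elements L \<subseteq> compact_elements M}"

definition Hom_FInf :: "'a gorder \<Rightarrow> 'a gorder \<Rightarrow> ('a \<Rightarrow> 'a) set" where
  "Hom_FInf L M = {\<alpha> \<in> Hom_Sup L M. \<forall>S\<subseteq>compact_elements L.
     finite S \<and> S \<noteq> {} \<and> \<Sqinter>\<^bsub>L\<^esub>S \<in> compact_elements L \<longrightarrow> \<alpha> (\<Sqinter>\<^bsub>L\<^esub>S) = \<Sqinter>\<^bsub>M\<^esub>(\<alpha> ` S)}"

definition CohFrm_Sup :: "'v set set \<Rightarrow> ('v gorder, 'v \<Rightarrow> 'v) cat" where
  "CohFrm_Sup \<K> = \<lparr>Ob = {L. coherent_frame L \<and> small \<K> (compact_elements L)},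
     Hom = Hom_Sup,
     Idn = (\<lambda>L. \<lambda>x\<in>carrier L. x),
     Comp = (\<lambda>L M N \<beta> \<alpha>. compose (carrier L) \<beta> \<alpha>)\<rparr>"

definition CohFrm_FInf :: "'v set set \<Rightarrow> ('v gorder, 'v \<Rightarrow> 'v) cat" where
  "CohFrm_FInf \<K> = \<lparr>Ob = {L. coherent_frame L \<and> small \<K> (compact_elements L)},
     Hom = Hom_FInf,
     Idn = (\<lambda>L. \<lambda>x\<in>carrier L. x),
     Comp = (\<lambda>L M N \<beta> \<alpha>. compose (carrier L) \<beta> \<alpha>)\<rparr>"


section \<open>Bounded distributive lattices\<close>

locale bounded_distrib_lattice = bounded_lattice L for L (structure) +
  assumes meet_join_distrib: "\<lbrakk>x \<in> carrier L; y \<in> carrier L; z \<in> carrier L\<rbrakk>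
    \<Longrightarrow> x \<sqinter> (y \<squnion> z) = (x \<sqinter> y) \<squnion> (x \<sqinter> z)"

definition Hom_M :: "'a gorder \<Rightarrow> 'a gorder \<Rightarrow> ('a \<Rightarrow> 'a) set" where
  "Hom_M D E = {h \<in> carrier D \<rightarrow>\<^sub>E carrier E. meet_pres D E h \<and> h \<top>\<^bsub>D\<^esub> = \<top>\<^bsub>E\<^esub>}"

definition Hom_L :: "'a gorder \<Rightarrow> 'a gorder \<Rightarrow> ('a \<Rightarrow> 'a) set" where
  "Hom_L D E = {h \<in> Hom_M D E. join_pres D E h}"

definition DL_M :: "'v set set \<Rightarrow> ('v gorder, 'v \<Rightarrow> 'v) cat" where
  "DL_M \<K> = \<lparr>Ob = {D. bounded_distrib_lattice D \<and> small \<K> (carrier D)},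
     Hom = Hom_M,
     Idn = (\<lambda>D. \<lambda>x\<in>carrier D. x),
     Comp = (\<lambda>D E F k h. compose (carrier D) k h)\<rparr>"

definition DL_L :: "'v set set \<Rightarrow> ('v gorder, 'v \<Rightarrow> 'v) cat" where
  "DL_L \<K> = \<lparr>Ob = {D. bounded_distrib_lattice D \<and> small \<K> (carrier D)},
     Hom = Hom_L,
     Idn = (\<lambda>D. \<lambda>x\<in>carrier D. x),
     Comp = (\<lambda>D E F k h. compose (carrier D) k h)\<rparr>"


section \<open>Priestley spaces\<close>

record 'a ordered_space =
  topol :: "'a topology"
  leq :: "('a \<times> 'a) set"

definition points :: "'a ordered_space \<Rightarrow> 'a set" where
  "points X = topspace (topol X)"

definition clopen_in :: "'a ordered_space \<Rightarrow> 'a set \<Rightarrow> bool" where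
  "clopen_in X U \<longleftrightarrow> openin (topol X) U \<and> closedin (topol X) U"

definition ClopUp :: "'a ordered_space \<Rightarrow> 'a set set" where
  "ClopUp X = {U. clopen_in X U \<and> (\<forall>x\<in>U. \<forall>y. (x, y) \<in> leq X \<longrightarrow> y \<in> U)}"

definition ClopDown :: "'a ordered_space \<Rightarrow> 'a set set" where
  "ClopDown X = {U. clopen_in X U \<and> (\<forall>x\<in>U. \<forall>y. (y, x) \<in> leq X \<longrightarrow> y \<in> U)}"

definition priestley_space :: "'a ordered_space \<Rightarrow> bool" where
  "priestley_space X \<longleftrightarrow> compact_space (topol X) \<and> partial_order_on (points X) (leq X) \<and>
     (\<forall>x\<in>points X. \<forall>y\<in>points X. (x, y) \<notin> leq X \<longrightarrow> (\<exists>U\<in>ClopUp X. x \<in> U \<and> y \<notin> U))"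

definition box :: "'a ordered_space \<Rightarrow> ('a \<times> 'b) set \<Rightarrow> 'b set \<Rightarrow> 'a set" where
  "box X R U = {x \<in> points X. R `` {x} \<subseteq> U}"

definition Hom_R :: "'a ordered_space \<Rightarrow> 'a ordered_space \<Rightarrow> ('a \<times> 'a) set set" where
  "Hom_R X Y = {R. R \<subseteq> points X \<times> points Y \<and>
     (\<forall>x\<in>points X. \<forall>y\<in>points Y. (x, y) \<notin> R \<longrightarrow> (\<exists>U\<in>ClopUp Y. R `` {x} \<subseteq> U \<and> y \<notin> U)) \<and>
     (\<forall>U\<in>ClopUp Y. box X R U \<in> ClopUp X)}"

definition star_comp ::
    "'a ordered_space \<Rightarrow> 'a ordered_space \<Rightarrow> 'a ordered_space
      \<Rightarrow> ('a \<times> 'a) set \<Rightarrow> ('a \<times> 'a) set \<Rightarrow> ('a \<times> 'a) set" where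
  "star_comp X Y Z S R = {(x, z) \<in> points X \<times> points Z.
     \<forall>U\<in>ClopUp Z. x \<in> box X R (box Y S U) \<longrightarrow> z \<in> U}"

definition PS_R :: "'v set set \<Rightarrow> ('v ordered_space, ('v \<times> 'v) set) cat" where
  "PS_R \<K> = \<lparr>Ob = {X. priestley_space X \<and> small \<K> (ClopUp X)},
     Hom = Hom_R,
     Idn = leq,
     Comp = star_comp\<rparr>"

definition Hom_PS :: "'a ordered_space \<Rightarrow> 'a ordered_space \<Rightarrow> ('a \<rightharpoonup> 'a) set" where
  "Hom_PS X Y = {f. dom f \<in> ClopDown X \<and> ran f \<subseteq> points Y \<and>
     (\<forall>U\<in>ClopUp Y. points X - {x. \<exists>y\<in>points Y - U. f x = Some y} \<in> ClopUp X)}"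

definition PS_PS :: "'v set set \<Rightarrow> ('v ordered_space, 'v \<rightharpoonup> 'v) cat" where
  "PS_PS \<K> = \<lparr>Ob = {X. priestley_space X \<and> small \<K> (ClopUp X)},
     Hom = Hom_PS,
     Idn = (\<lambda>X. Some |` points X),
     Comp = (\<lambda>X Y Z g f. g \<circ>\<^sub>m f)\<rparr>"


section \<open>Size revisited\<close>

lemma small_mono: "A \<lesssim> B \<Longrightarrow> small \<K> B \<Longrightarrow> small \<K> A"
  unfolding small_def using lepoll_trans by blast

lemma small_Pow:
  assumes "\<forall>B\<in>\<K>. small \<K> (Pow B)" and "small \<K> A"
  shows "small \<K> (Pow A)"
proof -
  obtain B g where "B \<in> \<K>" and g: "inj_on g A" "g ` A \<subseteq> B"
    using assms(2) unfolding small_def lepoll_def by blast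
  have "inj_on ((`) g) (Pow A)" using g(1) by (rule inj_on_image_Pow)
  moreover have "(`) g ` Pow A \<subseteq> Pow B" using g(2) by blast
  ultimately have "Pow A \<lesssim> Pow B" unfolding lepoll_def by blast
  with assms(1) \<open>B \<in> \<K>\<close> show ?thesis using small_mono by blast
qed

lemma (in coherent_frame) carrier_lepoll_Pow: "carrier L \<lesssim> Pow (compact_elements L)"
proof -
  have K: "compact_elements L \<subseteq> carrier L" unfolding compact_elements_def by blast
  let ?f = "\<lambda>x. {c \<in> compact_elements L. c \<sqsubseteq> x}"
  have *: "x \<sqsubseteq> y" if x: "x \<in> carrier L" and y: "y \<in> carrier L" and "?f x = ?f y" for x y
  proof -
    obtain S where S: "S \<subseteq> compact_elements L" "x = \<Squnion>S" using sup_of_compact[OF x] by blast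
    have "s \<sqsubseteq> y" if "s \<in> S" for s
      using that S sup_upper[of S s] K \<open>?f x = ?f y\<close> by blast
    then show ?thesis using S K y sup_least[of S y] by blast
  qed
  have "inj_on ?f (carrier L)" by (rule inj_onI, rule le_antisym) (auto intro: *)
  then show ?thesis unfolding lepoll_def by blast
qed

lemma (in coherent_frame) small_carrier_iff:
  assumes "\<forall>B\<in>\<K>. small \<K> (Pow B)"
  shows "small \<K> (compact_elements L) \<longleftrightarrow> small \<K> (carrier L)"
proof
  assume "small \<K> (compact_elements L)"
  then show "small \<K> (carrier L)" using carrier_lepoll_Pow small_Pow[OF assms] small_mono by blast
next
  have "compact_elements L \<subseteq> carrier L" unfolding compact_elements_def by blast
  then show "small \<K> (carrier L) \<Longrightarrow> small \<K> (compact_elements L)"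
    using small_mono subset_imp_lepoll by blast
qed

lemma points_lepoll_Pow:
  assumes "priestley_space X"
  shows "points X \<lesssim> Pow (ClopUp X)"
proof -
  let ?f = "\<lambda>x. {U \<in> ClopUp X. x \<in> U}"
  have "inj_on ?f (points X)"
  proof (rule inj_onI)
    fix x y assume "x \<in> points X" "y \<in> points X" and eq: "?f x = ?f y"
    then have "(x, y) \<in> leq X" "(y, x) \<in> leq X"
      using assms unfolding priestley_space_def by blast+
    then show "x = y"
      using assms unfolding priestley_space_def partial_order_on_def antisym_def by blast
  qed
  then show ?thesis unfolding lepoll_def by blast
qed

lemma small_points_iff:
  assumes "\<forall>B\<in>\<K>. small \<K> (Pow B)" and "priestley_space X"
  shows "small \<K> (ClopUp X) \<longleftrightarrow> small \<K> (points X)"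
proof
  assume "small \<K> (ClopUp X)"
  then show "small \<K> (points X)"
    using points_lepoll_Pow[OF assms(2)] small_Pow[OF assms(1)] small_mono by blast
next
  have "ClopUp X \<subseteq> Pow (points X)"
    unfolding ClopUp_def clopen_in_def points_def using openin_subset by blast
  then show "small \<K> (points X) \<Longrightarrow> small \<K> (ClopUp X)"
    using small_Pow[OF assms(1)] small_mono subset_imp_lepoll by blast
qed

end

theory Submission
  imports Defs "HOL-Analysis.Function_Topology"
begin

text \<open>Both statements reduce to lattices.  A coherent frame \<open>L\<close> is determined by the join-semilattice of
  its compact elements, which is a sublattice, and a join-preserving map that preserves compact
  elements amounts to a map between the compact elements that preserves finite joins
  (\<open>bij_betw_restrict_compact\<close>).  Passing to the opposite order turns finite joins into finite meets,
  so \<open>L \<mapsto> K(L)\<^sup>o\<^sup>p\<close> is a fully faithful functor to \<open>DL_M\<close>; the additional condition on arrows of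
  \<open>CohFrm_FInf\<close> says that the restriction also preserves binary joins of \<open>K(L)\<^sup>o\<^sup>p\<close>
  (\<open>Hom_FInf_iff\<close>).

  On the other side, \<open>X \<mapsto> ClopUp X\<close> is a contravariant functor from Priestley spaces to lattices.
  A generalized Priestley morphism \<open>R\<close> acts by its box operator, and compactness shows that box
  operators are exactly the maps preserving finite meets (\<open>box_rel_of\<close>).  A partial strong Priestley
  morphism acts by \<open>U \<mapsto> X - f\<^sup>-\<^sup>1(Y - U)\<close>; given a map \<open>T\<close> that also preserves binary joins, the sets
  \<open>V\<close> with \<open>x \<in> T V\<close> form a prime filter for \<open>x \<notin> T {}\<close>, and by compactness every prime filter of
  clopen upsets is the neighbourhood filter of a unique point, the value at \<open>x\<close>
  (\<open>pfun_of_Hom_PS\<close>).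

  It remains to see that every bounded distributive lattice arises on both sides.  Its prime filters
  form a Priestley space \<open>X\<close> whose clopen upsets are the given lattice
  (\<open>priestley_representation\<close>), and the open downsets of \<open>X\<close> form a coherent frame whose compact
  elements are the clopen downsets, that is, the opposite of the lattice
  (\<open>coherent_frame_representation\<close>).  Both constructions use subsets of the lattice or of its dual
  space that are coded by subsets of the lattice, which is where the bound on the size enters.

  Fully faithful, essentially surjective functors are invertible up to natural isomorphism and closed
  under composition and duals, so the duality of frames and spaces follows by composing the functors
  through the lattices (\<open>equivalent_cats_if_cospan\<close>).\<close>

section \<open>Fully faithful, essentially surjective functors\<close>

definition weak_equivalence ::
    "('o, 'm) cat \<Rightarrow> ('p, 'n) cat \<Rightarrow> ('o, 'm, 'p, 'n) func \<Rightarrow> bool" where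
  "weak_equivalence C D F \<longleftrightarrow> category C \<and> category D \<and> is_functor C D F \<and>
     (\<forall>X\<in>Ob C. \<forall>Y\<in>Ob C.
        bij_betw (on_Hom F X Y) (Hom C X Y) (Hom D (on_Ob F X) (on_Ob F Y))) \<and>
     (\<forall>Z\<in>Ob D. \<exists>X\<in>Ob C. \<exists>f. is_iso D (on_Ob F X) Z f)"

text \<open>The laws of a category are equations between arrows, and a functor that is injective on arrows
  reflects them.  In this way the associativity of a composition such as \<open>star_comp\<close> is inherited
  from the composition of maps.\<close>

lemma weak_equivalenceI:
  assumes D: "category D"
    and Idn: "\<And>X. X \<in> Ob C \<Longrightarrow> Idn C X \<in> Hom C X X"
    and Comp: "\<And>X Y Z f g. \<lbrakk>X \<in> Ob C; Y \<in> Ob C; Z \<in> Ob C; f \<in> Hom C X Y; g \<in> Hom C Y Z\<rbrakk>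
      \<Longrightarrow> Comp C X Y Z g f \<in> Hom C X Z"
    and F: "is_functor C D F"
    and bij: "\<And>X Y. \<lbrakk>X \<in> Ob C; Y \<in> Ob C\<rbrakk>
      \<Longrightarrow> bij_betw (on_Hom F X Y) (Hom C X Y) (Hom D (on_Ob F X) (on_Ob F Y))"
    and surj: "\<And>Z. Z \<in> Ob D \<Longrightarrow> \<exists>X\<in>Ob C. \<exists>f. is_iso D (on_Ob F X) Z f"
  shows "weak_equivalence C D F"
proof -
  interpret D: category D by fact
  have ob: "on_Ob F X \<in> Ob D" if "X \<in> Ob C" for X
    using F that unfolding is_functor_def by blast
  have hom: "on_Hom F X Y f \<in> Hom D (on_Ob F X) (on_Ob F Y)"
    if "X \<in> Ob C" "Y \<in> Ob C" "f \<in> Hom C X Y" for X Y f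
    using F that unfolding is_functor_def by blast
  have idn: "on_Hom F X X (Idn C X) = Idn D (on_Ob F X)" if "X \<in> Ob C" for X
    using F that unfolding is_functor_def by blast
  have cmp: "on_Hom F X Z (Comp C X Y Z g f) =
      Comp D (on_Ob F X) (on_Ob F Y) (on_Ob F Z) (on_Hom F Y Z g) (on_Hom F X Y f)"
    if "X \<in> Ob C" "Y \<in> Ob C" "Z \<in> Ob C" "f \<in> Hom C X Y" "g \<in> Hom C Y Z" for X Y Z f g
    using F that unfolding is_functor_def by blast
  have eqI: "f = g" if "X \<in> Ob C" "Y \<in> Ob C" "f \<in> Hom C X Y" "g \<in> Hom C X Y"
    "on_Hom F X Y f = on_Hom F X Y g" for X Y f g
    using bij_betw_imp_inj_on[OF bij[OF that(1,2)]] that(3-) by (auto dest: inj_onD)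
  have "category C"
  proof
    fix X assume "X \<in> Ob C"
    then show "Idn C X \<in> Hom C X X" by (rule Idn)
  next
    fix X Y Z f g
    assume "X \<in> Ob C" "Y \<in> Ob C" "Z \<in> Ob C" "f \<in> Hom C X Y" "g \<in> Hom C Y Z"
    then show "Comp C X Y Z g f \<in> Hom C X Z" by (rule Comp)
  next
    fix X Y f assume "X \<in> Ob C" "Y \<in> Ob C" "f \<in> Hom C X Y"
    then show "Comp C X Y Y (Idn C Y) f = f"
      by (intro eqI[of X Y]) (simp_all add: cmp idn hom ob Idn Comp D.Comp_Idn_left)
  next
    fix X Y f assume "X \<in> Ob C" "Y \<in> Ob C" "f \<in> Hom C X Y"
    then show "Comp C X X Y f (Idn C X) = f"
      by (intro eqI[of X Y]) (simp_all add: cmp idn hom ob Idn Comp D.Comp_Idn_right)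
  next
    fix W X Y Z f g h
    assume "W \<in> Ob C" "X \<in> Ob C" "Y \<in> Ob C" "Z \<in> Ob C"
      "f \<in> Hom C W X" "g \<in> Hom C X Y" "h \<in> Hom C Y Z"
    then show "Comp C W X Z (Comp C X Y Z h g) f = Comp C W Y Z h (Comp C W X Y g f)"
      by (intro eqI[of W Z]) (simp_all add: cmp hom ob Comp D.Comp_assoc)
  qed
  with assms show ?thesis unfolding weak_equivalence_def by blast
qed

text \<open>The inverse \<open>G\<close> sends \<open>Z\<close> to a chosen \<open>G Z\<close> with an isomorphism \<open>e\<^sub>Z : F (G Z) \<rightarrow> Z\<close>, and an
  arrow \<open>g\<close> to the unique preimage under \<open>F\<close> of its conjugate by these isomorphisms; this makes
  \<open>e\<close> natural by construction.\<close>

lemma weak_equivalence_inverse: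
  fixes C :: "('o, 'm) cat" and D :: "('p, 'n) cat"
  assumes "weak_equivalence C D F"
  obtains G \<eta> \<epsilon> where "weak_equivalence D C G"
    "natural_iso C C id_func (comp_func G F) \<eta>" "natural_iso D D (comp_func F G) id_func \<epsilon>"
proof -
  interpret C: category C using assms unfolding weak_equivalence_def by blast
  interpret D: category D using assms unfolding weak_equivalence_def by blast
  have F: "is_functor C D F"
    and bij: "\<And>X Y. \<lbrakk>X \<in> Ob C; Y \<in> Ob C\<rbrakk>
      \<Longrightarrow> bij_betw (on_Hom F X Y) (Hom C X Y) (Hom D (on_Ob F X) (on_Ob F Y))"
    and surj: "\<And>Z. Z \<in> Ob D \<Longrightarrow> \<exists>X\<in>Ob C. \<exists>f. is_iso D (on_Ob F X) Z f"
    using assms unfolding weak_equivalence_def by blast+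
  define F0 where "F0 = on_Ob F"
  have F0 [simp]: "F0 X \<in> Ob D" if "X \<in> Ob C" for X
    using F that unfolding is_functor_def F0_def by blast
  have hom [simp]: "on_Hom F X Y f \<in> Hom D (F0 X) (F0 Y)"
    if "X \<in> Ob C" "Y \<in> Ob C" "f \<in> Hom C X Y" for X Y f
    using F that unfolding is_functor_def F0_def by blast
  have idn [simp]: "on_Hom F X X (Idn C X) = Idn D (F0 X)" if "X \<in> Ob C" for X
    using F that unfolding is_functor_def F0_def by blast
  have cmp [simp]: "on_Hom F X Z (Comp C X Y Z g f) =
      Comp D (F0 X) (F0 Y) (F0 Z) (on_Hom F Y Z g) (on_Hom F X Y f)"
    if "X \<in> Ob C" "Y \<in> Ob C" "Z \<in> Ob C" "f \<in> Hom C X Y" "g \<in> Hom C Y Z" for X Y Z f g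
    using F that unfolding is_functor_def F0_def by blast
  have eqI: "f = g" if "X \<in> Ob C" "Y \<in> Ob C" "f \<in> Hom C X Y" "g \<in> Hom C X Y"
    "on_Hom F X Y f = on_Hom F X Y g" for X Y f g
    using bij_betw_imp_inj_on[OF bij[OF that(1,2)]] that(3-) by (auto dest: inj_onD)
  define lift where
    "lift X Y = inv_into (Hom C X Y) (on_Hom F X Y)" for X Y
  have lift [simp]: "lift X Y g \<in> Hom C X Y" "on_Hom F X Y (lift X Y g) = g"
    if "X \<in> Ob C" "Y \<in> Ob C" "g \<in> Hom D (F0 X) (F0 Y)" for X Y g
    using bij_betw_imp_surj_on[OF bij[OF that(1,2)]] that(3)
    unfolding lift_def F0_def by (auto intro: inv_into_into f_inv_into_f)
  have "\<exists>X. X \<in> Ob C \<and> (\<exists>f g. f \<in> Hom D (F0 X) Z \<and> g \<in> Hom D Z (F0 X) \<and>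
      Comp D (F0 X) Z (F0 X) g f = Idn D (F0 X) \<and> Comp D Z (F0 X) Z f g = Idn D Z)"
    if "Z \<in> Ob D" for Z
    using surj[OF that] unfolding is_iso_def F0_def by blast
  then obtain G0 e e' where
    G0 [simp]: "\<And>Z. Z \<in> Ob D \<Longrightarrow> G0 Z \<in> Ob C"
    and e [simp]: "\<And>Z. Z \<in> Ob D \<Longrightarrow> e Z \<in> Hom D (F0 (G0 Z)) Z"
    and e' [simp]: "\<And>Z. Z \<in> Ob D \<Longrightarrow> e' Z \<in> Hom D Z (F0 (G0 Z))"
    and e'e: "\<And>Z. Z \<in> Ob D \<Longrightarrow>
      Comp D (F0 (G0 Z)) Z (F0 (G0 Z)) (e' Z) (e Z) = Idn D (F0 (G0 Z))"
    and ee': "\<And>Z. Z \<in> Ob D \<Longrightarrow> Comp D Z (F0 (G0 Z)) Z (e Z) (e' Z) = Idn D Z"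
    by metis
  have e'e_cancel: "Comp D W Z (F0 (G0 Z)) (e' Z) (Comp D W (F0 (G0 Z)) Z (e Z) f) = f"
    if "W \<in> Ob D" "Z \<in> Ob D" "f \<in> Hom D W (F0 (G0 Z))" for W Z f
    using that by (simp add: D.Comp_assoc[symmetric] e'e D.Comp_Idn_left)
  have ee'_cancel: "Comp D W (F0 (G0 Z)) Z (e Z) (Comp D W Z (F0 (G0 Z)) (e' Z) f) = f"
    if "W \<in> Ob D" "Z \<in> Ob D" "f \<in> Hom D W Z" for W Z f
    using that by (simp add: D.Comp_assoc[symmetric] ee' D.Comp_Idn_left)
  define conj where "conj Y Z g = Comp D (F0 (G0 Y)) Z (F0 (G0 Z)) (e' Z)
      (Comp D (F0 (G0 Y)) Y Z g (e Y))" for Y Z g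
  have conj [simp]: "conj Y Z g \<in> Hom D (F0 (G0 Y)) (F0 (G0 Z))"
    if "Y \<in> Ob D" "Z \<in> Ob D" "g \<in> Hom D Y Z" for Y Z g
    using that unfolding conj_def by (intro D.Comp_in_Hom[where Y = Z] D.Comp_in_Hom[where Y = Y]) auto
  define G where "G = \<lparr>on_Ob = G0, on_Hom = (\<lambda>Y Z g. lift (G0 Y) (G0 Z) (conj Y Z g))\<rparr>"
  have G_simps: "on_Ob G = G0" "on_Hom G Y Z g = lift (G0 Y) (G0 Z) (conj Y Z g)" for Y Z g
    unfolding G_def by simp_all
  note simps = G_simps D.Comp_in_Hom C.Comp_in_Hom D.Idn_in_Hom C.Idn_in_Hom
    D.Comp_Idn_left D.Comp_Idn_right e'e ee'
  have conj_nat: "Comp D (F0 (G0 Y)) (F0 (G0 Z)) Z (e Z) (conj Y Z g) = Comp D (F0 (G0 Y)) Y Z g (e Y)"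
    if "Y \<in> Ob D" "Z \<in> Ob D" "g \<in> Hom D Y Z" for Y Z g
    using that unfolding conj_def by (simp add: ee'_cancel simps)
  have conj_comp: "conj X Z (Comp D X Y Z g f) =
      Comp D (F0 (G0 X)) (F0 (G0 Y)) (F0 (G0 Z)) (conj Y Z g) (conj X Y f)"
    if "X \<in> Ob D" "Y \<in> Ob D" "Z \<in> Ob D" "f \<in> Hom D X Y" "g \<in> Hom D Y Z" for X Y Z f g
    using that by (simp add: conj_def[of Y Z] conj_def[of X Z] D.Comp_assoc conj_nat simps)
  have G: "is_functor D C G"
    unfolding is_functor_def
  proof (intro conjI ballI)
    fix X assume "X \<in> Ob D"
    then show "on_Ob G X \<in> Ob C" by (simp add: simps)
    show "on_Hom G X X (Idn D X) = Idn C (on_Ob G X)"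
      using \<open>X \<in> Ob D\<close> by (intro eqI[of "G0 X" "G0 X"]) (simp_all add: simps, simp add: conj_def simps)
  next
    fix X Y f assume "X \<in> Ob D" "Y \<in> Ob D" "f \<in> Hom D X Y"
    then show "on_Hom G X Y f \<in> Hom C (on_Ob G X) (on_Ob G Y)" by (simp add: simps)
  next
    fix X Y Z f g
    assume "X \<in> Ob D" "Y \<in> Ob D" "Z \<in> Ob D" "f \<in> Hom D X Y" "g \<in> Hom D Y Z"
    then show "on_Hom G X Z (Comp D X Y Z g f) = Comp C (on_Ob G X) (on_Ob G Y) (on_Ob G Z)
        (on_Hom G Y Z g) (on_Hom G X Y f)"
      by (intro eqI[of "G0 X" "G0 Z"]) (simp_all add: simps conj_comp)
  qed
  have G_bij: "bij_betw (on_Hom G Y Z) (Hom D Y Z) (Hom C (G0 Y) (G0 Z))"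
    if Y: "Y \<in> Ob D" and Z: "Z \<in> Ob D" for Y Z
  proof (rule bij_betw_byWitness[where f' = "\<lambda>f. Comp D Y (F0 (G0 Z)) Z (e Z)
      (Comp D Y (F0 (G0 Y)) (F0 (G0 Z)) (on_Hom F (G0 Y) (G0 Z) f) (e' Y))"])
    show "\<forall>g\<in>Hom D Y Z. Comp D Y (F0 (G0 Z)) Z (e Z) (Comp D Y (F0 (G0 Y)) (F0 (G0 Z))
        (on_Hom F (G0 Y) (G0 Z) (on_Hom G Y Z g)) (e' Y)) = g"
    proof
      fix g assume g: "g \<in> Hom D Y Z"
      have "Comp D Y (F0 (G0 Z)) Z (e Z) (Comp D Y (F0 (G0 Y)) (F0 (G0 Z)) (conj Y Z g) (e' Y))
          = Comp D Y (F0 (G0 Y)) Z (Comp D (F0 (G0 Y)) Y Z g (e Y)) (e' Y)"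
        using Y Z g by (simp add: D.Comp_assoc[symmetric] conj_nat)
      also have "\<dots> = g" using Y Z g by (simp add: D.Comp_assoc simps)
      finally show "Comp D Y (F0 (G0 Z)) Z (e Z) (Comp D Y (F0 (G0 Y)) (F0 (G0 Z))
        (on_Hom F (G0 Y) (G0 Z) (on_Hom G Y Z g)) (e' Y)) = g"
        using Y Z g by (simp add: simps)
    qed
    show "\<forall>f\<in>Hom C (G0 Y) (G0 Z). on_Hom G Y Z (Comp D Y (F0 (G0 Z)) Z (e Z)
        (Comp D Y (F0 (G0 Y)) (F0 (G0 Z)) (on_Hom F (G0 Y) (G0 Z) f) (e' Y))) = f"
      using Y Z by (intro ballI eqI[of "G0 Y" "G0 Z"])
        (simp_all add: simps, simp add: conj_def D.Comp_assoc simps e'e_cancel)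
    show "on_Hom G Y Z ` Hom D Y Z \<subseteq> Hom C (G0 Y) (G0 Z)" using Y Z by (auto simp: simps)
    show "(\<lambda>f. Comp D Y (F0 (G0 Z)) Z (e Z) (Comp D Y (F0 (G0 Y)) (F0 (G0 Z))
        (on_Hom F (G0 Y) (G0 Z) f) (e' Y))) ` Hom C (G0 Y) (G0 Z) \<subseteq> Hom D Y Z"
      using Y Z by (auto simp: simps)
  qed
  \<comment> \<open>\<open>F\<close> reflects identities, so the preimage of the inverse of \<open>e\<close> at \<open>F X\<close> is an isomorphism.\<close>
  define \<eta> where "\<eta> X = lift X (G0 (F0 X)) (e' (F0 X))" for X
  define \<eta>' where "\<eta>' X = lift (G0 (F0 X)) X (e (F0 X))" for X
  have \<eta>_inv: "\<eta> X \<in> Hom C X (G0 (F0 X))" "\<eta>' X \<in> Hom C (G0 (F0 X)) X"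
    "Comp C X (G0 (F0 X)) X (\<eta>' X) (\<eta> X) = Idn C X"
    "Comp C (G0 (F0 X)) X (G0 (F0 X)) (\<eta> X) (\<eta>' X) = Idn C (G0 (F0 X))" if "X \<in> Ob C" for X
    using that
    by (simp_all add: \<eta>_def \<eta>'_def eqI[of X X] eqI[of "G0 (F0 X)" "G0 (F0 X)"] simps)
  have \<eta>: "natural_iso C C id_func (comp_func G F) \<eta>"
    unfolding natural_iso_def id_func_def comp_func_def
  proof (intro conjI ballI; simp add: simps F0_def[symmetric])
    fix X assume "X \<in> Ob C"
    then show "is_iso C X (G0 (F0 X)) (\<eta> X)" unfolding is_iso_def using \<eta>_inv by blast
  next
    fix X Y f assume "X \<in> Ob C" "Y \<in> Ob C" "f \<in> Hom C X Y"
    then show "Comp C X Y (G0 (F0 Y)) (\<eta> Y) f = Comp C X (G0 (F0 X)) (G0 (F0 Y))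
        (lift (G0 (F0 X)) (G0 (F0 Y)) (conj (F0 X) (F0 Y) (on_Hom F X Y f))) (\<eta> X)"
      by (intro eqI[of X "G0 (F0 Y)"])
        (simp_all add: simps \<eta>_inv, simp add: \<eta>_def conj_def D.Comp_assoc simps)
  qed
  have \<epsilon>: "natural_iso D D (comp_func F G) id_func e"
    unfolding natural_iso_def id_func_def comp_func_def
  proof (intro conjI ballI; simp add: simps F0_def[symmetric])
    fix Z assume "Z \<in> Ob D"
    then show "is_iso D (F0 (G0 Z)) Z (e Z)" unfolding is_iso_def using e'e ee' e e' by blast
  next
    fix Y Z g assume "Y \<in> Ob D" "Z \<in> Ob D" "g \<in> Hom D Y Z"
    then show "Comp D (F0 (G0 Y)) (F0 (G0 Z)) Z (e Z) (conj Y Z g) = Comp D (F0 (G0 Y)) Y Z g (e Y)"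
      by (rule conj_nat)
  qed
  have "\<exists>Z\<in>Ob D. \<exists>f. is_iso C (on_Ob G Z) X f" if "X \<in> Ob C" for X
    unfolding is_iso_def using \<eta>_inv[OF that] F0[OF that] by (auto simp: G_simps)
  then have "weak_equivalence D C G"
    unfolding weak_equivalence_def using G G_bij C.category_axioms D.category_axioms
    by (simp add: G_simps)
  with \<eta> \<epsilon> show ?thesis using that by blast
qed

lemma equivalent_cats_if_weak_equivalence:
  assumes F: "weak_equivalence C D F"
  shows "equivalent_cats C D"
proof -
  obtain G \<eta> \<epsilon> where "weak_equivalence D C G"
    "natural_iso C C id_func (comp_func G F) \<eta>" "natural_iso D D (comp_func F G) id_func \<epsilon>"
    using weak_equivalence_inverse[OF F] .
  with F show ?thesis unfolding equivalent_cats_def weak_equivalence_def by blast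
qed

lemma category_dual: "category C \<Longrightarrow> category (dual_cat C)"
  unfolding category_def dual_cat_def by simp

lemma is_iso_dual: "is_iso (dual_cat C) X Y f \<longleftrightarrow> is_iso C Y X f"
  unfolding is_iso_def dual_cat_def by auto

lemma is_iso_inverse: "is_iso C X Y f \<Longrightarrow> \<exists>g. is_iso C Y X g"
  unfolding is_iso_def by blast

lemma weak_equivalence_dual:
  assumes "weak_equivalence C D F"
  shows "weak_equivalence (dual_cat C) (dual_cat D)
    \<lparr>on_Ob = on_Ob F, on_Hom = (\<lambda>X Y. on_Hom F Y X)\<rparr>"
proof -
  have "\<exists>X\<in>Ob C. \<exists>f. is_iso D Z (on_Ob F X) f" if "Z \<in> Ob D" for Z
    using assms that is_iso_inverse unfolding weak_equivalence_def by metis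
  then have "\<exists>X\<in>Ob C. \<exists>f. is_iso (dual_cat D) (on_Ob F X) Z f" if "Z \<in> Ob D" for Z
    using that by (simp add: is_iso_dual)
  moreover have "Ob (dual_cat C) = Ob C" "Ob (dual_cat D) = Ob D" by (simp_all add: dual_cat_def)
  moreover have "is_functor (dual_cat C) (dual_cat D)
      \<lparr>on_Ob = on_Ob F, on_Hom = (\<lambda>X Y. on_Hom F Y X)\<rparr>"
    using assms unfolding weak_equivalence_def is_functor_def dual_cat_def by simp
  ultimately show ?thesis
    using assms unfolding weak_equivalence_def by (simp add: category_dual) (simp add: dual_cat_def)
qed

lemma is_iso_functor:
  assumes "is_functor C D F" "X \<in> Ob C" "Y \<in> Ob C" "is_iso C X Y f"
  shows "is_iso D (on_Ob F X) (on_Ob F Y) (on_Hom F X Y f)"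
proof -
  obtain g where "f \<in> Hom C X Y" "g \<in> Hom C Y X"
    and "Comp C X Y X g f = Idn C X" "Comp C Y X Y f g = Idn C Y"
    using assms(4) unfolding is_iso_def by blast
  with assms(1-3) show ?thesis
    unfolding is_iso_def is_functor_def by (intro conjI bexI[of _ "on_Hom F Y X g"]) metis+
qed

lemma is_iso_comp:
  assumes "category C" "X \<in> Ob C" "Y \<in> Ob C" "Z \<in> Ob C" "is_iso C X Y f" "is_iso C Y Z g"
  shows "is_iso C X Z (Comp C X Y Z g f)"
proof -
  interpret category C by fact
  obtain f' where f: "f \<in> Hom C X Y" "f' \<in> Hom C Y X"
    and f'f: "Comp C X Y X f' f = Idn C X" and ff': "Comp C Y X Y f f' = Idn C Y"
    using assms(5) unfolding is_iso_def by blast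
  obtain g' where g: "g \<in> Hom C Y Z" "g' \<in> Hom C Z Y"
    and g'g: "Comp C Y Z Y g' g = Idn C Y" and gg': "Comp C Z Y Z g g' = Idn C Z"
    using assms(6) unfolding is_iso_def by blast
  note ob = assms(2-4)
  have 1: "Comp C X Z Y g' (Comp C X Y Z g f) = f"
    using ob f g by (simp add: Comp_assoc[symmetric] g'g Comp_Idn_left)
  have 2: "Comp C Z X Y f (Comp C Z Y X f' g') = g'"
    using ob f g by (simp add: Comp_assoc[symmetric] ff' Comp_Idn_left)
  have "Comp C X Z X (Comp C Z Y X f' g') (Comp C X Y Z g f) = Idn C X"
    using ob f g by (simp add: Comp_assoc Comp_in_Hom 1 f'f)
  moreover have "Comp C Z X Z (Comp C X Y Z g f) (Comp C Z Y X f' g') = Idn C Z"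
    using ob f g by (simp add: Comp_assoc Comp_in_Hom 2 gg')
  moreover have "Comp C X Y Z g f \<in> Hom C X Z" "Comp C Z Y X f' g' \<in> Hom C Z X"
    using ob f g by (auto intro: Comp_in_Hom)
  ultimately show ?thesis unfolding is_iso_def by blast
qed

lemma weak_equivalence_comp:
  assumes F: "weak_equivalence C D F" and G: "weak_equivalence D E G"
  shows "weak_equivalence C E (comp_func G F)"
proof -
  have "\<exists>X\<in>Ob C. \<exists>f. is_iso E (on_Ob G (on_Ob F X)) Z f" if Z: "Z \<in> Ob E" for Z
  proof -
    obtain Y g where Y: "Y \<in> Ob D" and g: "is_iso E (on_Ob G Y) Z g"
      using G Z unfolding weak_equivalence_def by metis
    obtain X f where X: "X \<in> Ob C" and f: "is_iso D (on_Ob F X) Y f"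
      using F Y unfolding weak_equivalence_def by metis
    have FX: "on_Ob F X \<in> Ob D" using F X unfolding weak_equivalence_def is_functor_def by blast
    have "is_iso E (on_Ob G (on_Ob F X)) (on_Ob G Y) (on_Hom G (on_Ob F X) Y f)"
      using G FX Y f by (intro is_iso_functor) (auto simp: weak_equivalence_def)
    with g show ?thesis
      using is_iso_comp[of E "on_Ob G (on_Ob F X)" "on_Ob G Y" Z] G X Y Z FX
      unfolding weak_equivalence_def is_functor_def by metis
  qed
  moreover have "bij_betw (\<lambda>f. on_Hom G (on_Ob F X) (on_Ob F Y) (on_Hom F X Y f)) (Hom C X Y)
      (Hom E (on_Ob G (on_Ob F X)) (on_Ob G (on_Ob F Y)))" if "X \<in> Ob C" "Y \<in> Ob C" for X Y
  proof -
    have "on_Ob F X \<in> Ob D" "on_Ob F Y \<in> Ob D"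
      using F that unfolding weak_equivalence_def is_functor_def by blast+
    then show ?thesis
      using F G that bij_betw_trans unfolding weak_equivalence_def comp_def[symmetric] by blast
  qed
  moreover have "is_functor C E (comp_func G F)"
    using F G unfolding weak_equivalence_def is_functor_def comp_func_def by simp
  ultimately show ?thesis using F G unfolding weak_equivalence_def by (simp add: comp_func_def)
qed

text \<open>Equivalences meet in the dual of a category of lattices, so that no direct functor between
  frames and spaces is needed.\<close>

lemma equivalent_cats_if_cospan:
  assumes "weak_equivalence C E F" "weak_equivalence D E G"
  shows "equivalent_cats C D"
proof -
  obtain H where "weak_equivalence E D H" using weak_equivalence_inverse[OF assms(2)] by metis
  with assms(1) show ?thesis
    using weak_equivalence_comp equivalent_cats_if_weak_equivalence by blast
qed

section \<open>Bounded distributive lattices\<close>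

lemma partial_order_record:
  assumes "\<And>x. x \<in> A \<Longrightarrow> r x x"
    and "\<And>x y. \<lbrakk>x \<in> A; y \<in> A; r x y; r y x\<rbrakk> \<Longrightarrow> x = y"
    and "\<And>x y z. \<lbrakk>x \<in> A; y \<in> A; z \<in> A; r x y; r y z\<rbrakk> \<Longrightarrow> r x z"
  shows "partial_order \<lparr>carrier = A, eq = (=), le = r\<rparr>"
  by unfold_locales (simp_all, (use assms in blast)+)

context partial_order
begin

lemma sup_eqI:
  assumes "A \<subseteq> carrier L" "z \<in> carrier L" "\<And>x. x \<in> A \<Longrightarrow> x \<sqsubseteq> z"
    and "\<And>w. \<lbrakk>w \<in> carrier L; \<And>x. x \<in> A \<Longrightarrow> x \<sqsubseteq> w\<rbrakk> \<Longrightarrow> z \<sqsubseteq> w"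
  shows "\<Squnion>A = z"
proof -
  have "least L z (Upper L A)"
  proof (rule least_UpperI)
    fix y assume "y \<in> Upper L A"
    with assms(1) show "z \<sqsubseteq> y" by (intro assms(4)) (simp_all add: Upper_def subset_iff)
  qed (use assms in simp_all)
  then show ?thesis unfolding sup_def by (metis least_unique someI)
qed

lemma inf_eqI:
  assumes "A \<subseteq> carrier L" "z \<in> carrier L" "\<And>x. x \<in> A \<Longrightarrow> z \<sqsubseteq> x"
    and "\<And>w. \<lbrakk>w \<in> carrier L; \<And>x. x \<in> A \<Longrightarrow> w \<sqsubseteq> x\<rbrakk> \<Longrightarrow> w \<sqsubseteq> z"
  shows "\<Sqinter>A = z"
proof -
  have "greatest L z (Lower L A)"
  proof (rule greatest_LowerI)
    fix y assume "y \<in> Lower L A"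
    with assms(1) show "y \<sqsubseteq> z" by (intro assms(4)) (simp_all add: Lower_def subset_iff)
  qed (use assms in simp_all)
  then show ?thesis unfolding inf_def by (metis greatest_unique someI)
qed

lemma join_eqI:
  assumes "x \<in> carrier L" "y \<in> carrier L" "z \<in> carrier L" "x \<sqsubseteq> z" "y \<sqsubseteq> z"
    and "\<And>w. \<lbrakk>w \<in> carrier L; x \<sqsubseteq> w; y \<sqsubseteq> w\<rbrakk> \<Longrightarrow> z \<sqsubseteq> w"
  shows "x \<squnion> y = z"
  unfolding join_def by (rule sup_eqI) (use assms(1-5) in simp, use assms(1-5) in simp, use assms(1-5) in blast,
    rule assms(6), simp_all)

lemma meet_eqI:
  assumes "x \<in> carrier L" "y \<in> carrier L" "z \<in> carrier L" "z \<sqsubseteq> x" "z \<sqsubseteq> y"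
    and "\<And>w. \<lbrakk>w \<in> carrier L; w \<sqsubseteq> x; w \<sqsubseteq> y\<rbrakk> \<Longrightarrow> w \<sqsubseteq> z"
  shows "x \<sqinter> y = z"
  unfolding meet_def by (rule inf_eqI) (use assms(1-5) in simp, use assms(1-5) in simp, use assms(1-5) in blast,
    rule assms(6), simp_all)

lemma top_eqI:
  assumes "t \<in> carrier L" "\<And>x. x \<in> carrier L \<Longrightarrow> x \<sqsubseteq> t"
  shows "\<top> = t"
proof -
  have "greatest L t (carrier L)" using assms unfolding greatest_def by simp
  then show ?thesis unfolding top_def by (metis greatest_unique someI)
qed

lemma bounded_distrib_latticeI:
  assumes m: "\<And>x y. \<lbrakk>x \<in> carrier L; y \<in> carrier L\<rbrakk> \<Longrightarrow> m x y \<in> carrier L \<and> m x y \<sqsubseteq> x \<and> m x y \<sqsubseteq> y \<and>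
      (\<forall>w\<in>carrier L. w \<sqsubseteq> x \<longrightarrow> w \<sqsubseteq> y \<longrightarrow> w \<sqsubseteq> m x y)"
    and j: "\<And>x y. \<lbrakk>x \<in> carrier L; y \<in> carrier L\<rbrakk> \<Longrightarrow> j x y \<in> carrier L \<and> x \<sqsubseteq> j x y \<and> y \<sqsubseteq> j x y \<and>
      (\<forall>w\<in>carrier L. x \<sqsubseteq> w \<longrightarrow> y \<sqsubseteq> w \<longrightarrow> j x y \<sqsubseteq> w)"
    and t: "t \<in> carrier L" "\<And>x. x \<in> carrier L \<Longrightarrow> x \<sqsubseteq> t"
    and b: "b \<in> carrier L" "\<And>x. x \<in> carrier L \<Longrightarrow> b \<sqsubseteq> x"
    and distrib: "\<And>x y z. \<lbrakk>x \<in> carrier L; y \<in> carrier L; z \<in> carrier L\<rbrakk> \<Longrightarrow>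
      m x (j y z) = j (m x y) (m x z)"
  shows "bounded_distrib_lattice L"
proof -
  have meet: "x \<sqinter> y = m x y" if "x \<in> carrier L" "y \<in> carrier L" for x y
    using m[OF that] that by (intro meet_eqI) simp_all
  have join: "x \<squnion> y = j x y" if "x \<in> carrier L" "y \<in> carrier L" for x y
    using j[OF that] that by (intro join_eqI) simp_all
  show ?thesis
  proof
    fix x y assume xy: "x \<in> carrier L" "y \<in> carrier L"
    have "least L (j x y) (Upper L {x, y})"
      using j[OF xy] xy by (simp add: least_def Upper_def)
    then show "\<exists>s. least L s (Upper L {x, y})" ..
    have "greatest L (m x y) (Lower L {x, y})"
      using m[OF xy] xy by (simp add: greatest_def Lower_def)
    then show "\<exists>s. greatest L s (Lower L {x, y})" ..
  next
    have "least L b (carrier L)" using b by (simp add: least_def)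
    then show "\<exists>x. least L x (carrier L)" ..
    have "greatest L t (carrier L)" using t by (simp add: greatest_def)
    then show "\<exists>x. greatest L x (carrier L)" ..
  next
    fix x y z assume "x \<in> carrier L" "y \<in> carrier L" "z \<in> carrier L"
    then show "x \<sqinter> (y \<squnion> z) = (x \<sqinter> y) \<squnion> (x \<sqinter> z)"
      using m j distrib by (simp add: meet join)
  qed
qed

end

lemma Hom_M_iff:
  assumes "bounded_distrib_lattice D" "bounded_distrib_lattice E"
  shows "h \<in> Hom_M D E \<longleftrightarrow> h \<in> carrier D \<rightarrow>\<^sub>E carrier E \<and> h \<top>\<^bsub>D\<^esub> = \<top>\<^bsub>E\<^esub> \<and>
    (\<forall>x\<in>carrier D. \<forall>y\<in>carrier D. h (x \<sqinter>\<^bsub>D\<^esub> y) = h x \<sqinter>\<^bsub>E\<^esub> h y)"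
proof -
  interpret D: bounded_distrib_lattice D by fact
  interpret E: bounded_distrib_lattice E by fact
  show ?thesis unfolding Hom_M_def meet_pres_def using D.lattice_axioms E.lattice_axioms by blast
qed

lemma Hom_L_iff:
  assumes "bounded_distrib_lattice D" "bounded_distrib_lattice E"
  shows "h \<in> Hom_L D E \<longleftrightarrow> h \<in> Hom_M D E \<and>
    (\<forall>x\<in>carrier D. \<forall>y\<in>carrier D. h (x \<squnion>\<^bsub>D\<^esub> y) = h x \<squnion>\<^bsub>E\<^esub> h y)"
proof -
  interpret D: bounded_distrib_lattice D by fact
  interpret E: bounded_distrib_lattice E by fact
  show ?thesis unfolding Hom_L_def join_pres_def using D.lattice_axioms E.lattice_axioms by blast
qed

lemma Hom_M_mono:
  assumes "h \<in> Hom_M D E" "x \<in> carrier D" "y \<in> carrier D" "x \<sqsubseteq>\<^bsub>D\<^esub> y"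
  shows "h x \<sqsubseteq>\<^bsub>E\<^esub> h y"
proof -
  have "isotone D E h"
    using assms(1) unfolding Hom_M_def by (intro meet_pres_isotone) auto
  with assms(2-) show ?thesis using use_iso2 by metis
qed

lemma category_DL_M: "category (DL_M \<K>)"
  unfolding DL_M_def
proof (standard; simp)
  fix D :: "'v gorder" assume "bounded_distrib_lattice D \<and> small \<K> (carrier D)"
  then interpret bounded_distrib_lattice D by blast
  show "(\<lambda>x\<in>carrier D. x) \<in> Hom_M D D"
    using bounded_distrib_lattice_axioms by (simp add: Hom_M_iff)
next
  fix D E F :: "'v gorder" and h k
  assume "bounded_distrib_lattice D \<and> small \<K> (carrier D)"
    "bounded_distrib_lattice E \<and> small \<K> (carrier E)"
    "bounded_distrib_lattice F \<and> small \<K> (carrier F)" and hk: "h \<in> Hom_M D E" "k \<in> Hom_M E F"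
  then interpret D: bounded_distrib_lattice D + E: bounded_distrib_lattice E
    + F: bounded_distrib_lattice F by blast+
  note ax = D.bounded_distrib_lattice_axioms E.bounded_distrib_lattice_axioms
    F.bounded_distrib_lattice_axioms
  show "compose (carrier D) k h \<in> Hom_M D F"
    using hk by (simp add: Hom_M_iff[OF ax(1,2)] Hom_M_iff[OF ax(2,3)] Hom_M_iff[OF ax(1,3)]
        compose_eq PiE_mem PiE_iff)
next
  fix D E :: "'v gorder" and h assume "h \<in> Hom_M D E"
  then show "compose (carrier D) (\<lambda>x\<in>carrier E. x) h = h" "compose (carrier D) h (\<lambda>x\<in>carrier D. x) = h"
    unfolding Hom_M_def PiE_def by (simp_all add: Id_compose compose_Id[where B = "carrier E"])
next
  fix C D E F :: "'v gorder" and f g h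
  assume "f \<in> Hom_M C D"
  then show "compose (carrier C) (compose (carrier D) h g) f
      = compose (carrier C) h (compose (carrier C) g f)"
    unfolding Hom_M_def PiE_def by (simp add: compose_assoc[where B = "carrier D"])
qed

lemma compose_Hom_L:
  assumes "bounded_distrib_lattice D" "bounded_distrib_lattice E" "bounded_distrib_lattice F"
    and "h \<in> Hom_L D E" "k \<in> Hom_L E F" and M: "compose (carrier D) k h \<in> Hom_M D F"
  shows "compose (carrier D) k h \<in> Hom_L D F"
proof -
  interpret D: bounded_distrib_lattice D by fact
  have "h x \<in> carrier E" if "x \<in> carrier D" for x
    using assms(4) that unfolding Hom_L_def Hom_M_def by blast
  then show ?thesis
    using assms by (simp add: Hom_L_iff compose_eq)
qed

text \<open>The two categories of lattices share objects, identities and composition, so the laws carry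
  over; only closure of the arrows has to be shown.\<close>

lemma category_DL_L: "category (DL_L \<K>)"
proof -
  have M: "Ob (DL_M \<K>) = Ob (DL_L \<K>)" "Idn (DL_M \<K>) = Idn (DL_L \<K>)"
    "Comp (DL_M \<K>) = Comp (DL_L \<K>)" "Hom (DL_M \<K>) = Hom_M" "Hom (DL_L \<K>) = Hom_L"
    unfolding DL_M_def DL_L_def by simp_all
  interpret M: category "DL_M \<K>" by (rule category_DL_M)
  note M_rules = M.Idn_in_Hom M.Comp_in_Hom M.Comp_Idn_left M.Comp_Idn_right M.Comp_assoc
  have sub: "h \<in> Hom_L D E \<Longrightarrow> h \<in> Hom_M D E" for D E :: "'v gorder" and h
    unfolding Hom_L_def by blast
  have "Idn (DL_L \<K>) D \<in> Hom_L D D" if "D \<in> Ob (DL_L \<K>)" for D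
  proof -
    interpret bounded_distrib_lattice D using that unfolding DL_L_def by simp
    have "Idn (DL_L \<K>) D \<in> Hom_M D D" using that M.Idn_in_Hom[unfolded M] by blast
    then show ?thesis
      using bounded_distrib_lattice_axioms by (simp add: Hom_L_iff) (simp add: DL_L_def)
  qed
  moreover have "Comp (DL_L \<K>) D E F k h \<in> Hom_L D F"
    if ob: "D \<in> Ob (DL_L \<K>)" "E \<in> Ob (DL_L \<K>)" "F \<in> Ob (DL_L \<K>)"
      and hom: "h \<in> Hom_L D E" "k \<in> Hom_L E F" for D E F h k
    using M.Comp_in_Hom[unfolded M, OF ob sub[OF hom(1)] sub[OF hom(2)]] that
    unfolding DL_L_def by (auto intro: compose_Hom_L)
  ultimately show ?thesis
    unfolding category_def M by (simp add: M_rules[unfolded M] sub)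
qed

definition order_iso :: "('a, 'c) gorder_scheme \<Rightarrow> ('b, 'd) gorder_scheme \<Rightarrow> ('a \<Rightarrow> 'b) \<Rightarrow> bool" where
  "order_iso D E f \<longleftrightarrow> bij_betw f (carrier D) (carrier E) \<and>
     (\<forall>x\<in>carrier D. \<forall>y\<in>carrier D. f x \<sqsubseteq>\<^bsub>E\<^esub> f y \<longleftrightarrow> x \<sqsubseteq>\<^bsub>D\<^esub> y)"

lemma order_iso_inverse:
  assumes "order_iso D E f"
  shows "order_iso E D (inv_into (carrier D) f)"
proof -
  let ?g = "inv_into (carrier D) f"
  have bij: "bij_betw f (carrier D) (carrier E)"
    and le: "\<And>x y. \<lbrakk>x \<in> carrier D; y \<in> carrier D\<rbrakk> \<Longrightarrow> f x \<sqsubseteq>\<^bsub>E\<^esub> f y \<longleftrightarrow> x \<sqsubseteq>\<^bsub>D\<^esub> y"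
    using assms unfolding order_iso_def by simp_all
  have "?g x \<in> carrier D" "f (?g x) = x" if "x \<in> carrier E" for x
    using bij that by (simp_all add: bij_betw_apply[OF bij_betw_inv_into] bij_betw_inv_into_right)
  then have "?g x \<sqsubseteq>\<^bsub>D\<^esub> ?g y \<longleftrightarrow> x \<sqsubseteq>\<^bsub>E\<^esub> y" if "x \<in> carrier E" "y \<in> carrier E" for x y
    using le[of "?g x" "?g y"] that by simp
  with bij_betw_inv_into[OF bij] show ?thesis unfolding order_iso_def by simp
qed

lemma order_iso_Hom_L:
  assumes "bounded_distrib_lattice D" "bounded_distrib_lattice E" "order_iso D E f"
  shows "restrict f (carrier D) \<in> Hom_L D E"
proof -
  interpret D: bounded_distrib_lattice D by fact
  interpret E: bounded_distrib_lattice E by fact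
  have surj: "f ` carrier D = carrier E" and le: "\<And>x y. \<lbrakk>x \<in> carrier D; y \<in> carrier D\<rbrakk> \<Longrightarrow>
      f x \<sqsubseteq>\<^bsub>E\<^esub> f y \<longleftrightarrow> x \<sqsubseteq>\<^bsub>D\<^esub> y"
    using assms(3) unfolding order_iso_def bij_betw_def by simp_all
  have f: "f x \<in> carrier E" if "x \<in> carrier D" for x using surj that by blast
  have ex: "\<exists>v\<in>carrier D. w = f v" if "w \<in> carrier E" for w using surj that by blast
  have "\<top>\<^bsub>E\<^esub> = f \<top>\<^bsub>D\<^esub>"
  proof (rule E.top_eqI)
    fix w assume "w \<in> carrier E"
    then obtain v where "v \<in> carrier D" "w = f v" using ex by blast
    then show "w \<sqsubseteq>\<^bsub>E\<^esub> f \<top>\<^bsub>D\<^esub>" by (simp add: le)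
  qed (simp add: f)
  moreover have "f x \<sqinter>\<^bsub>E\<^esub> f y = f (x \<sqinter>\<^bsub>D\<^esub> y)" if "x \<in> carrier D" "y \<in> carrier D" for x y
  proof (rule E.meet_eqI)
    fix w assume "w \<in> carrier E" and w: "w \<sqsubseteq>\<^bsub>E\<^esub> f x" "w \<sqsubseteq>\<^bsub>E\<^esub> f y"
    then obtain v where "v \<in> carrier D" "w = f v" using ex by blast
    with w that show "w \<sqsubseteq>\<^bsub>E\<^esub> f (x \<sqinter>\<^bsub>D\<^esub> y)" by (simp add: le D.meet_le)
  qed (use that in \<open>simp_all add: f le D.meet_left D.meet_right\<close>)
  moreover have "f x \<squnion>\<^bsub>E\<^esub> f y = f (x \<squnion>\<^bsub>D\<^esub> y)" if "x \<in> carrier D" "y \<in> carrier D" for x y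
  proof (rule E.join_eqI)
    fix w assume "w \<in> carrier E" and w: "f x \<sqsubseteq>\<^bsub>E\<^esub> w" "f y \<sqsubseteq>\<^bsub>E\<^esub> w"
    then obtain v where "v \<in> carrier D" "w = f v" using ex by blast
    with w that show "f (x \<squnion>\<^bsub>D\<^esub> y) \<sqsubseteq>\<^bsub>E\<^esub> w" by (simp add: le D.join_le)
  qed (use that in \<open>simp_all add: f le D.join_left D.join_right\<close>)
  ultimately show ?thesis
    using assms(1,2) f by (simp add: Hom_L_iff Hom_M_iff)
qed

text \<open>Being defined from the order, the operations are preserved by order isomorphisms, so these
  are isomorphisms in both categories of lattices.\<close>

lemma is_iso_order_iso:
  assumes "bounded_distrib_lattice D" "bounded_distrib_lattice E" "order_iso D E f"
  shows "is_iso (DL_L \<K>) D E (restrict f (carrier D))"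
    and "is_iso (DL_M \<K>) D E (restrict f (carrier D))"
proof -
  let ?g = "inv_into (carrier D) f"
  have f: "restrict f (carrier D) \<in> Hom_L D E" using assms by (rule order_iso_Hom_L)
  have g: "restrict ?g (carrier E) \<in> Hom_L E D"
    using assms(2,1) order_iso_inverse[OF assms(3)] by (rule order_iso_Hom_L)
  have bij: "bij_betw f (carrier D) (carrier E)" using assms(3) unfolding order_iso_def by blast
  have "compose (carrier D) (restrict ?g (carrier E)) (restrict f (carrier D)) = (\<lambda>x\<in>carrier D. x)"
    using bij by (auto simp: compose_def fun_eq_iff bij_betw_inv_into_left bij_betw_apply)
  moreover have "compose (carrier E) (restrict f (carrier D)) (restrict ?g (carrier E))
      = (\<lambda>x\<in>carrier E. x)"
    using bij bij_betw_apply[OF bij_betw_inv_into[OF bij]]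
    by (auto simp: compose_def fun_eq_iff bij_betw_inv_into_right)
  moreover have "h \<in> Hom_L A B \<Longrightarrow> h \<in> Hom_M A B" for A B :: "'b gorder" and h
    unfolding Hom_L_def by blast
  ultimately show "is_iso (DL_L \<K>) D E (restrict f (carrier D))"
    "is_iso (DL_M \<K>) D E (restrict f (carrier D))"
    using f g unfolding is_iso_def DL_L_def DL_M_def by auto
qed

section \<open>Coherent frames and their compact elements\<close>

lemma (in frame) meet_join_distrib:
  assumes "a \<in> carrier L" "b \<in> carrier L" "c \<in> carrier L"
  shows "a \<sqinter> (b \<squnion> c) = (a \<sqinter> b) \<squnion> (a \<sqinter> c)"
  using meet_sup_distrib[of a "{b, c}"] assms unfolding join_def by simp

lemma (in frame) join_meet_distrib:
  assumes "a \<in> carrier L" "b \<in> carrier L" "c \<in> carrier L"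
  shows "a \<squnion> (b \<sqinter> c) = (a \<squnion> b) \<sqinter> (a \<squnion> c)"
proof -
  have ac: "(a \<squnion> b) \<sqinter> a = a"
    using assms by (intro meet_eqI) (simp_all add: join_left)
  have "(a \<squnion> b) \<sqinter> (a \<squnion> c) = ((a \<squnion> b) \<sqinter> a) \<squnion> ((a \<squnion> b) \<sqinter> c)"
    using assms by (intro meet_join_distrib) simp_all
  also have "\<dots> = a \<squnion> ((a \<sqinter> c) \<squnion> (b \<sqinter> c))"
    using assms by (simp add: ac meet_comm[of L _ c] meet_join_distrib)
  also have "\<dots> = (a \<squnion> (a \<sqinter> c)) \<squnion> (b \<sqinter> c)" using assms by (simp add: join_assoc)
  also have "a \<squnion> (a \<sqinter> c) = a"
    using assms by (intro join_eqI) (simp_all add: meet_left)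
  finally show ?thesis ..
qed

lemma (in complete_lattice) sup_mono_subset:
  assumes "B \<subseteq> carrier L" "A \<subseteq> B"
  shows "\<Squnion>A \<sqsubseteq> \<Squnion>B"
proof (rule sup_least)
  show "A \<subseteq> carrier L" using assms by blast
  then show "\<Squnion>B \<in> carrier L" using assms by simp
  show "x \<sqsubseteq> \<Squnion>B" if "x \<in> A" for x using assms that by (intro sup_upper) blast+
qed

context coherent_frame
begin

lemma compact_closed: "c \<in> compact_elements L \<Longrightarrow> c \<in> carrier L"
  unfolding compact_elements_def by blast

lemma compactD:
  assumes "c \<in> compact_elements L" "S \<subseteq> carrier L" "c \<sqsubseteq> \<Squnion>S"
  obtains F where "F \<subseteq> S" "finite F" "c \<sqsubseteq> \<Squnion>F"
  using assms unfolding compact_elements_def by blast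

lemma finite_sup_compact:
  assumes "finite F" "F \<subseteq> compact_elements L"
  shows "\<Squnion>F \<in> compact_elements L"
  unfolding compact_elements_def
proof (rule CollectI, intro conjI allI impI)
  have F: "F \<subseteq> carrier L" using assms(2) compact_closed by blast
  then show sup: "\<Squnion>F \<in> carrier L" by simp
  fix S assume S: "S \<subseteq> carrier L" and le: "\<Squnion>F \<sqsubseteq> \<Squnion>S"
  have "\<exists>G\<subseteq>S. finite G \<and> c \<sqsubseteq> \<Squnion>G" if c: "c \<in> F" for c
  proof -
    have "c \<sqsubseteq> \<Squnion>S"
      using le_trans[OF sup_upper[OF F c] le] F S sup c by auto
    moreover have "c \<in> compact_elements L" using c assms(2) by blast
    ultimately show ?thesis using S by (meson compactD)
  qed
  then obtain G where G: "\<And>c. c \<in> F \<Longrightarrow> G c \<subseteq> S \<and> finite (G c) \<and> c \<sqsubseteq> \<Squnion>(G c)" by metis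
  let ?G = "\<Union>(G ` F)"
  have sub: "?G \<subseteq> S" using G by blast
  then have subL: "?G \<subseteq> carrier L" using S by blast
  have "\<Squnion>F \<sqsubseteq> \<Squnion>?G"
  proof (rule sup_least[OF F])
    fix c assume c: "c \<in> F"
    have Gc: "G c \<subseteq> ?G" using c by blast
    have "c \<in> carrier L" "\<Squnion>(G c) \<in> carrier L" "\<Squnion>?G \<in> carrier L"
      using c F Gc subL sup_closed[of "G c"] sup_closed[of ?G] by blast+
    then show "c \<sqsubseteq> \<Squnion>?G" using le_trans sup_mono_subset[OF subL Gc] G[OF c] by blast
  qed (use subL in simp)
  moreover have "finite ?G" using assms(1) G by blast
  ultimately show "\<exists>G\<subseteq>S. finite G \<and> \<Squnion>F \<sqsubseteq> \<Squnion>G" using sub by blast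
qed

lemma join_compact:
  "\<lbrakk>a \<in> compact_elements L; b \<in> compact_elements L\<rbrakk> \<Longrightarrow> a \<squnion> b \<in> compact_elements L"
  unfolding join_def by (rule finite_sup_compact) simp_all

lemma meet_compact:
  "\<lbrakk>a \<in> compact_elements L; b \<in> compact_elements L\<rbrakk> \<Longrightarrow> a \<sqinter> b \<in> compact_elements L"
  unfolding meet_def by (rule inf_compact) simp_all

lemma sup_empty: "\<Squnion>{} = \<bottom>"
  using weak_sup_empty unfolding eq_is_equal .

lemma inf_empty: "\<Sqinter>{} = \<top>"
  using weak_inf_empty unfolding eq_is_equal .

lemma sup_insert: "\<lbrakk>a \<in> carrier L; A \<subseteq> carrier L\<rbrakk> \<Longrightarrow> \<Squnion>(insert a A) = a \<squnion> \<Squnion>A"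
  using weak_sup_insert unfolding eq_is_equal .

lemma inf_insert: "\<lbrakk>a \<in> carrier L; A \<subseteq> carrier L\<rbrakk> \<Longrightarrow> \<Sqinter>(insert a A) = a \<sqinter> \<Sqinter>A"
  using weak_inf_insert unfolding eq_is_equal .

lemma bottom_compact: "\<bottom> \<in> compact_elements L"
  using finite_sup_compact[of "{}"] sup_empty by simp

lemma top_compact: "\<top> \<in> compact_elements L"
  using inf_compact[of "{}"] inf_empty by simp

lemma sup_compact_below:
  assumes "x \<in> carrier L"
  shows "\<Squnion>{c \<in> compact_elements L. c \<sqsubseteq> x} = x"
proof (rule sup_eqI)
  show "{c \<in> compact_elements L. c \<sqsubseteq> x} \<subseteq> carrier L" using compact_closed by blast
  fix w assume w: "w \<in> carrier L" "\<And>c. c \<in> {c \<in> compact_elements L. c \<sqsubseteq> x} \<Longrightarrow> c \<sqsubseteq> w"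
  obtain S where S: "S \<subseteq> compact_elements L" "x = \<Squnion>S" using sup_of_compact assms by blast
  then have SL: "S \<subseteq> carrier L" using compact_closed by blast
  show "x \<sqsubseteq> w" unfolding S(2)
  proof (rule sup_least[OF SL w(1)])
    fix c assume "c \<in> S"
    with S SL show "c \<sqsubseteq> w" by (intro w(2)) (simp add: sup_upper subset_iff)
  qed
qed (use assms in simp_all)

end

text \<open>The order is reversed because morphisms of coherent frames preserve joins of compact
  elements, whereas those of lattices preserve meets.\<close>

definition compact_dual :: "('a, 'b) gorder_scheme \<Rightarrow> 'a gorder" where
  "compact_dual L = \<lparr>carrier = compact_elements L, eq = (=), le = (\<lambda>x y. y \<sqsubseteq>\<^bsub>L\<^esub> x)\<rparr>"

lemma compact_dual_simps [simp]:
  "carrier (compact_dual L) = compact_elements L" "x \<sqsubseteq>\<^bsub>compact_dual L\<^esub> y \<longleftrightarrow> y \<sqsubseteq>\<^bsub>L\<^esub> x"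
  unfolding compact_dual_def by simp_all

context coherent_frame
begin

lemma partial_order_compact_dual: "partial_order (compact_dual L)"
  unfolding compact_dual_def
proof (rule partial_order_record)
  fix x y z assume "x \<in> compact_elements L" "y \<in> compact_elements L"
  then have "x \<in> carrier L" "y \<in> carrier L" by (simp_all add: compact_closed)
  then show "x \<sqsubseteq> x" by simp
  show "y \<sqsubseteq> x \<Longrightarrow> x \<sqsubseteq> y \<Longrightarrow> x = y"
    using le_antisym \<open>x \<in> carrier L\<close> \<open>y \<in> carrier L\<close> by blast
  assume "z \<in> compact_elements L" "y \<sqsubseteq> x" "z \<sqsubseteq> y"
  then show "z \<sqsubseteq> x" 
    using le_trans[of z y x] \<open>x \<in> carrier L\<close> \<open>y \<in> carrier L\<close> by (simp add: compact_closed)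
qed

lemma bounded_distrib_lattice_compact_dual: "bounded_distrib_lattice (compact_dual L)"
  by (rule partial_order.bounded_distrib_latticeI[OF partial_order_compact_dual,
        where m = "(\<squnion>)" and j = "(\<sqinter>)" and t = \<bottom> and b = \<top>])
    (simp_all add: compact_closed join_compact meet_compact bottom_compact top_compact
      join_left join_right join_le meet_left meet_right meet_le join_meet_distrib)

lemma meet_compact_dual:
  "\<lbrakk>a \<in> compact_elements L; b \<in> compact_elements L\<rbrakk> \<Longrightarrow> a \<sqinter>\<^bsub>compact_dual L\<^esub> b = a \<squnion> b"
  by (rule partial_order.meet_eqI[OF partial_order_compact_dual])
    (simp_all add: compact_closed join_compact join_left join_right join_le)

lemma join_compact_dual:
  "\<lbrakk>a \<in> compact_elements L; b \<in> compact_elements L\<rbrakk> \<Longrightarrow> a \<squnion>\<^bsub>compact_dual L\<^esub> b = a \<sqinter> b"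
  by (rule partial_order.join_eqI[OF partial_order_compact_dual])
    (simp_all add: compact_closed meet_compact meet_left meet_right meet_le)

lemma top_compact_dual: "\<top>\<^bsub>compact_dual L\<^esub> = \<bottom>"
  by (rule partial_order.top_eqI[OF partial_order_compact_dual])
    (simp_all add: compact_closed bottom_compact)

end

locale coherent_frame_pair = L: coherent_frame L + M: coherent_frame M
  for L :: "'a gorder" and M :: "'a gorder"
begin

lemma Hom_M_compact_dual_iff:
  "h \<in> Hom_M (compact_dual L) (compact_dual M) \<longleftrightarrow>
     h \<in> compact_elements L \<rightarrow>\<^sub>E compact_elements M \<and> h \<bottom>\<^bsub>L\<^esub> = \<bottom>\<^bsub>M\<^esub> \<and>
     (\<forall>a\<in>compact_elements L. \<forall>b\<in>compact_elements L. h (a \<squnion>\<^bsub>L\<^esub> b) = h a \<squnion>\<^bsub>M\<^esub> h b)"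
  unfolding Hom_M_iff[OF L.bounded_distrib_lattice_compact_dual M.bounded_distrib_lattice_compact_dual]
  by (simp add: L.meet_compact_dual M.meet_compact_dual L.top_compact_dual M.top_compact_dual
      PiE_mem[where T = "\<lambda>_. compact_elements M"] cong: conj_cong)

lemma Hom_Sup_closed: "\<alpha> \<in> Hom_Sup L M \<Longrightarrow> x \<in> carrier L \<Longrightarrow> \<alpha> x \<in> carrier M"
  unfolding Hom_Sup_def by blast

lemma Hom_Sup_sup: "\<alpha> \<in> Hom_Sup L M \<Longrightarrow> S \<subseteq> carrier L \<Longrightarrow> \<alpha> (\<Squnion>\<^bsub>L\<^esub>S) = \<Squnion>\<^bsub>M\<^esub>(\<alpha> ` S)"
  unfolding Hom_Sup_def sup_pres_def by blast

lemma Hom_Sup_compact: "\<alpha> \<in> Hom_Sup L M \<Longrightarrow> c \<in> compact_elements L \<Longrightarrow> \<alpha> c \<in> compact_elements M"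
  unfolding Hom_Sup_def by blast

lemma restrict_Hom_Sup:
  assumes \<alpha>: "\<alpha> \<in> Hom_Sup L M"
  shows "restrict \<alpha> (compact_elements L) \<in> Hom_M (compact_dual L) (compact_dual M)"
proof -
  have "\<alpha> \<bottom>\<^bsub>L\<^esub> = \<bottom>\<^bsub>M\<^esub>" using Hom_Sup_sup[OF \<alpha>, of "{}"] by (simp add: L.sup_empty M.sup_empty)
  moreover have "\<alpha> (a \<squnion>\<^bsub>L\<^esub> b) = \<alpha> a \<squnion>\<^bsub>M\<^esub> \<alpha> b"
    if "a \<in> compact_elements L" "b \<in> compact_elements L" for a b
    using Hom_Sup_sup[OF \<alpha>, of "{a, b}"] that unfolding join_def by (simp add: L.compact_closed)
  ultimately show ?thesis
    unfolding Hom_M_compact_dual_iff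
    by (simp add: Hom_Sup_compact[OF \<alpha>] L.bottom_compact L.join_compact)
qed

lemma Hom_Sup_eqI:
  assumes \<alpha>: "\<alpha> \<in> Hom_Sup L M" and \<beta>: "\<beta> \<in> Hom_Sup L M"
    and eq: "restrict \<alpha> (compact_elements L) = restrict \<beta> (compact_elements L)"
  shows "\<alpha> = \<beta>"
proof (rule extensionalityI)
  show "\<alpha> \<in> extensional (carrier L)" "\<beta> \<in> extensional (carrier L)"
    using \<alpha> \<beta> unfolding Hom_Sup_def PiE_def by simp_all
  fix x assume "x \<in> carrier L"
  then obtain S where S: "S \<subseteq> compact_elements L" "x = \<Squnion>\<^bsub>L\<^esub>S" using L.sup_of_compact by blast
  then have SL: "S \<subseteq> carrier L" using L.compact_closed by blast
  have "\<alpha> c = \<beta> c" if "c \<in> S" for c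
    using fun_cong[OF eq, of c] S(1) that by (simp add: subset_iff)
  then have "\<alpha> ` S = \<beta> ` S" by simp
  then show "\<alpha> x = \<beta> x" unfolding S(2) by (simp add: Hom_Sup_sup[OF \<alpha> SL] Hom_Sup_sup[OF \<beta> SL])
qed

text \<open>A compact element below a join of elements \<open>s\<close> lies below a finite join of compact elements
  below some \<open>s\<close>.  Hence the monotone extension of a map preserving finite joins of compact
  elements preserves all joins.\<close>

lemma extend_Hom_M:
  assumes h: "h \<in> Hom_M (compact_dual L) (compact_dual M)"
  obtains \<alpha> where "\<alpha> \<in> Hom_Sup L M" "restrict \<alpha> (compact_elements L) = h"
proof -
  have h_compact: "h c \<in> compact_elements M" if "c \<in> compact_elements L" for c
    using h that unfolding Hom_M_compact_dual_iff by blast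
  have h_closed: "h c \<in> carrier M" if "c \<in> compact_elements L" for c
    using h_compact that M.compact_closed by blast
  have h_ext: "h \<in> extensional (compact_elements L)"
    using h unfolding Hom_M_compact_dual_iff PiE_def by simp
  have h_join: "h (a \<squnion>\<^bsub>L\<^esub> b) = h a \<squnion>\<^bsub>M\<^esub> h b"
    if "a \<in> compact_elements L" "b \<in> compact_elements L" for a b
    using h that unfolding Hom_M_compact_dual_iff by blast
  have h_mono: "h a \<sqsubseteq>\<^bsub>M\<^esub> h b"
    if "a \<in> compact_elements L" "b \<in> compact_elements L" "a \<sqsubseteq>\<^bsub>L\<^esub> b" for a b
    using Hom_M_mono[OF h, of b a] that by simp
  have h_sup: "h (\<Squnion>\<^bsub>L\<^esub>F) = \<Squnion>\<^bsub>M\<^esub>(h ` F)" if "finite F" "F \<subseteq> compact_elements L" for F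
    using that
  proof (induction F rule: finite_induct)
    case empty
    show ?case using h unfolding Hom_M_compact_dual_iff by (simp add: L.sup_empty M.sup_empty)
  next
    case (insert c F)
    then have "h (\<Squnion>\<^bsub>L\<^esub>(insert c F)) = h c \<squnion>\<^bsub>M\<^esub> h (\<Squnion>\<^bsub>L\<^esub>F)"
      by (simp add: L.sup_insert L.compact_closed subset_iff h_join L.finite_sup_compact)
    also have "\<dots> = \<Squnion>\<^bsub>M\<^esub>(h ` insert c F)"
    proof -
      have "h c \<in> carrier M" "h ` F \<subseteq> carrier M" using insert.prems h_closed by blast+
      with insert show ?thesis by (simp add: M.sup_insert)
    qed
    finally show ?case .
  qed
  let ?K = "\<lambda>x. {c \<in> compact_elements L. c \<sqsubseteq>\<^bsub>L\<^esub> x}"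
  define \<alpha> where "\<alpha> = (\<lambda>x\<in>carrier L. \<Squnion>\<^bsub>M\<^esub>(h ` ?K x))"
  have hK: "h ` ?K x \<subseteq> carrier M" for x using h_closed by blast
  have \<alpha>_closed: "\<alpha> x \<in> carrier M" if "x \<in> carrier L" for x
    using that hK by (simp add: \<alpha>_def)
  have h_le: "h c \<sqsubseteq>\<^bsub>M\<^esub> \<alpha> x" if "x \<in> carrier L" "c \<in> compact_elements L" "c \<sqsubseteq>\<^bsub>L\<^esub> x" for c x
    using M.sup_upper[OF hK, of "h c" x] that by (simp add: \<alpha>_def)
  have \<alpha>_least: "\<alpha> x \<sqsubseteq>\<^bsub>M\<^esub> z" if "x \<in> carrier L" "z \<in> carrier M" "\<And>c. c \<in> ?K x \<Longrightarrow> h c \<sqsubseteq>\<^bsub>M\<^esub> z" for x z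
  proof -
    have "\<Squnion>\<^bsub>M\<^esub>(h ` ?K x) \<sqsubseteq>\<^bsub>M\<^esub> z"
      by (rule M.sup_least[OF hK that(2)]) (use that(3) in blast)
    then show ?thesis using that(1) by (simp add: \<alpha>_def)
  qed
  have \<alpha>_mono: "\<alpha> x \<sqsubseteq>\<^bsub>M\<^esub> \<alpha> y" if "x \<in> carrier L" "y \<in> carrier L" "x \<sqsubseteq>\<^bsub>L\<^esub> y" for x y
  proof (rule \<alpha>_least[OF that(1) \<alpha>_closed[OF that(2)]])
    fix c assume "c \<in> ?K x"
    then have "c \<in> compact_elements L" "c \<sqsubseteq>\<^bsub>L\<^esub> y"
      using L.le_trans[of c x y] that by (simp_all add: L.compact_closed)
    then show "h c \<sqsubseteq>\<^bsub>M\<^esub> \<alpha> y" using that h_le by blast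
  qed
  have \<alpha>_compact: "\<alpha> c = h c" if "c \<in> compact_elements L" for c
  proof (rule M.le_antisym)
    show "\<alpha> c \<sqsubseteq>\<^bsub>M\<^esub> h c"
      using that by (intro \<alpha>_least) (simp_all add: L.compact_closed h_closed h_mono)
    show "h c \<sqsubseteq>\<^bsub>M\<^esub> \<alpha> c" using that by (intro h_le) (simp_all add: L.compact_closed)
  qed (use that in \<open>simp_all add: L.compact_closed h_closed \<alpha>_closed\<close>)
  have "\<alpha> (\<Squnion>\<^bsub>L\<^esub>S) = \<Squnion>\<^bsub>M\<^esub>(\<alpha> ` S)" if S: "S \<subseteq> carrier L" for S
  proof (rule M.le_antisym)
    have \<alpha>S: "\<alpha> ` S \<subseteq> carrier M" using S \<alpha>_closed by blast
    show closed: "\<alpha> (\<Squnion>\<^bsub>L\<^esub>S) \<in> carrier M" "\<Squnion>\<^bsub>M\<^esub>(\<alpha> ` S) \<in> carrier M"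
      using S \<alpha>S \<alpha>_closed by simp_all
    show "\<Squnion>\<^bsub>M\<^esub>(\<alpha> ` S) \<sqsubseteq>\<^bsub>M\<^esub> \<alpha> (\<Squnion>\<^bsub>L\<^esub>S)"
    proof (rule M.sup_least[OF \<alpha>S closed(1)])
      fix z assume "z \<in> \<alpha> ` S"
      then obtain s where "s \<in> S" "z = \<alpha> s" by blast
      with S show "z \<sqsubseteq>\<^bsub>M\<^esub> \<alpha> (\<Squnion>\<^bsub>L\<^esub>S)"
        using \<alpha>_mono[of s "\<Squnion>\<^bsub>L\<^esub>S"] L.sup_upper[OF S, of s] by (simp add: subset_iff)
    qed
    let ?T = "{c \<in> compact_elements L. \<exists>s\<in>S. c \<sqsubseteq>\<^bsub>L\<^esub> s}"
    have T: "?T \<subseteq> carrier L" using L.compact_closed by blast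
    have sup_T: "\<Squnion>\<^bsub>L\<^esub>S \<sqsubseteq>\<^bsub>L\<^esub> \<Squnion>\<^bsub>L\<^esub>?T"
    proof (rule L.sup_least[OF S])
      fix s assume s: "s \<in> S"
      then have "?K s \<subseteq> ?T" by blast
      then have "\<Squnion>\<^bsub>L\<^esub>(?K s) \<sqsubseteq>\<^bsub>L\<^esub> \<Squnion>\<^bsub>L\<^esub>?T" by (rule L.sup_mono_subset[OF T])
      moreover have "\<Squnion>\<^bsub>L\<^esub>(?K s) = s" using s S by (intro L.sup_compact_below) blast
      ultimately show "s \<sqsubseteq>\<^bsub>L\<^esub> \<Squnion>\<^bsub>L\<^esub>?T" by simp
    qed (use T in simp)
    show "\<alpha> (\<Squnion>\<^bsub>L\<^esub>S) \<sqsubseteq>\<^bsub>M\<^esub> \<Squnion>\<^bsub>M\<^esub>(\<alpha> ` S)"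
    proof (rule \<alpha>_least)
      fix c assume "c \<in> ?K (\<Squnion>\<^bsub>L\<^esub>S)"
      then have c: "c \<in> compact_elements L" "c \<sqsubseteq>\<^bsub>L\<^esub> \<Squnion>\<^bsub>L\<^esub>S" by simp_all
      have "c \<sqsubseteq>\<^bsub>L\<^esub> \<Squnion>\<^bsub>L\<^esub>?T"
        using L.le_trans[OF c(2) sup_T] c(1) S T by (simp add: L.compact_closed)
      then obtain F where F: "F \<subseteq> ?T" "finite F" "c \<sqsubseteq>\<^bsub>L\<^esub> \<Squnion>\<^bsub>L\<^esub>F" using c(1) T by (meson L.compactD)
      then have FK: "F \<subseteq> compact_elements L" by blast
      have hF: "h ` F \<subseteq> carrier M" using FK h_closed by blast
      have "h c \<sqsubseteq>\<^bsub>M\<^esub> h (\<Squnion>\<^bsub>L\<^esub>F)" using c F FK by (intro h_mono) (simp_all add: L.finite_sup_compact)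
      also have "h (\<Squnion>\<^bsub>L\<^esub>F) = \<Squnion>\<^bsub>M\<^esub>(h ` F)" using F(2) FK by (rule h_sup)
      also have "\<Squnion>\<^bsub>M\<^esub>(h ` F) \<sqsubseteq>\<^bsub>M\<^esub> \<Squnion>\<^bsub>M\<^esub>(\<alpha> ` S)"
      proof (rule M.sup_least[OF hF])
        fix z assume "z \<in> h ` F"
        then obtain d s where d: "z = h d" "d \<in> compact_elements L" "s \<in> S" "d \<sqsubseteq>\<^bsub>L\<^esub> s"
          using F(1) by blast
        then have s: "s \<in> carrier L" using S by (simp add: subset_iff)
        then have "h d \<sqsubseteq>\<^bsub>M\<^esub> \<alpha> s" "\<alpha> s \<sqsubseteq>\<^bsub>M\<^esub> \<Squnion>\<^bsub>M\<^esub>(\<alpha> ` S)"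
          using h_le[of s d] d M.sup_upper[OF \<alpha>S, of "\<alpha> s"] by simp_all
        then show "z \<sqsubseteq>\<^bsub>M\<^esub> \<Squnion>\<^bsub>M\<^esub>(\<alpha> ` S)"
          using M.le_trans[of "h d" "\<alpha> s"] d s closed by (simp add: \<alpha>_closed h_closed)
      qed (rule closed)
      finally show "h c \<sqsubseteq>\<^bsub>M\<^esub> \<Squnion>\<^bsub>M\<^esub>(\<alpha> ` S)"
        using c closed h_closed M.sup_closed[OF hF] by simp
    qed (use S closed in simp_all)
  qed
  then have "sup_pres L M \<alpha>"
    unfolding sup_pres_def using L.complete_lattice_axioms M.complete_lattice_axioms by simp
  moreover have "\<alpha> \<in> carrier L \<rightarrow>\<^sub>E carrier M"
    by (rule PiE_I) (rule \<alpha>_closed, assumption, simp add: \<alpha>_def)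
  ultimately have "\<alpha> \<in> Hom_Sup L M"
    unfolding Hom_Sup_def using \<alpha>_compact h_compact by (simp add: image_subset_iff)
  moreover have "restrict \<alpha> (compact_elements L) = h"
    using \<alpha>_compact h_ext by (intro extensionalityI[of _ "compact_elements L"]) simp_all
  ultimately show ?thesis using that by blast
qed

lemma bij_betw_restrict_compact:
  "bij_betw (\<lambda>\<alpha>. restrict \<alpha> (compact_elements L)) (Hom_Sup L M)
     (Hom_M (compact_dual L) (compact_dual M))"
proof (rule bij_betw_imageI)
  show "inj_on (\<lambda>\<alpha>. restrict \<alpha> (compact_elements L)) (Hom_Sup L M)"
    using Hom_Sup_eqI by (rule inj_onI)
  show "(\<lambda>\<alpha>. restrict \<alpha> (compact_elements L)) ` Hom_Sup L M = Hom_M (compact_dual L) (compact_dual M)"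
    using restrict_Hom_Sup extend_Hom_M by blast
qed

text \<open>Meets of finitely many compact elements are compact, so the condition on \<open>Hom_FInf\<close> reduces
  to binary meets, which are the joins of \<open>compact_dual\<close>.\<close>

lemma Hom_FInf_iff:
  assumes \<alpha>: "\<alpha> \<in> Hom_Sup L M"
  shows "\<alpha> \<in> Hom_FInf L M \<longleftrightarrow>
    restrict \<alpha> (compact_elements L) \<in> Hom_L (compact_dual L) (compact_dual M)"
proof -
  have "restrict \<alpha> (compact_elements L) \<in> Hom_L (compact_dual L) (compact_dual M) \<longleftrightarrow>
      (\<forall>a\<in>compact_elements L. \<forall>b\<in>compact_elements L. \<alpha> (a \<sqinter>\<^bsub>L\<^esub> b) = \<alpha> a \<sqinter>\<^bsub>M\<^esub> \<alpha> b)"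
    unfolding Hom_L_iff[OF L.bounded_distrib_lattice_compact_dual M.bounded_distrib_lattice_compact_dual]
    using restrict_Hom_Sup[OF \<alpha>]
    by (simp add: L.join_compact_dual M.join_compact_dual L.meet_compact Hom_Sup_compact[OF \<alpha>])
  also have "\<dots> \<longleftrightarrow> \<alpha> \<in> Hom_FInf L M"
  proof
    assume "\<alpha> \<in> Hom_FInf L M"
    then have "\<alpha> (\<Sqinter>\<^bsub>L\<^esub>S) = \<Sqinter>\<^bsub>M\<^esub>(\<alpha> ` S)" if "S \<subseteq> compact_elements L" "finite S" "S \<noteq> {}" for S
      using that L.inf_compact unfolding Hom_FInf_def by blast
    from this[of "{_, _}"]
    show "\<forall>a\<in>compact_elements L. \<forall>b\<in>compact_elements L. \<alpha> (a \<sqinter>\<^bsub>L\<^esub> b) = \<alpha> a \<sqinter>\<^bsub>M\<^esub> \<alpha> b"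
      unfolding meet_def by simp
  next
    assume meet: "\<forall>a\<in>compact_elements L. \<forall>b\<in>compact_elements L. \<alpha> (a \<sqinter>\<^bsub>L\<^esub> b) = \<alpha> a \<sqinter>\<^bsub>M\<^esub> \<alpha> b"
    have "\<alpha> (\<Sqinter>\<^bsub>L\<^esub>S) = \<Sqinter>\<^bsub>M\<^esub>(\<alpha> ` S)" if "finite S" "S \<noteq> {}" "S \<subseteq> compact_elements L" for S
      using that
    proof (induction S rule: finite_ne_induct)
      case (singleton c)
      then show ?case by (simp add: L.compact_closed Hom_Sup_closed[OF \<alpha>])
    next
      case (insert c S)
      then have "\<alpha> (\<Sqinter>\<^bsub>L\<^esub>(insert c S)) = \<alpha> c \<sqinter>\<^bsub>M\<^esub> \<alpha> (\<Sqinter>\<^bsub>L\<^esub>S)"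
        by (simp add: L.inf_insert L.compact_closed subset_iff meet L.inf_compact)
      also have "\<dots> = \<Sqinter>\<^bsub>M\<^esub>(\<alpha> ` insert c S)"
      proof -
        have "\<alpha> c \<in> carrier M" "\<alpha> ` S \<subseteq> carrier M"
          using insert.prems L.compact_closed Hom_Sup_closed[OF \<alpha>] by blast+
        with insert show ?thesis by (simp add: M.inf_insert)
      qed
      finally show ?case .
    qed
    then show "\<alpha> \<in> Hom_FInf L M" using \<alpha> unfolding Hom_FInf_def by blast
  qed
  finally show ?thesis ..
qed

end

section \<open>Prime filters\<close>

definition lattice_filter :: "('a, 'b) gorder_scheme \<Rightarrow> 'a set \<Rightarrow> bool" where
  "lattice_filter L F \<longleftrightarrow> F \<subseteq> carrier L \<and> \<top>\<^bsub>L\<^esub> \<in> F \<and>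
     (\<forall>x\<in>F. \<forall>y\<in>carrier L. x \<sqsubseteq>\<^bsub>L\<^esub> y \<longrightarrow> y \<in> F) \<and> (\<forall>x\<in>F. \<forall>y\<in>F. x \<sqinter>\<^bsub>L\<^esub> y \<in> F)"

definition lattice_ideal :: "('a, 'b) gorder_scheme \<Rightarrow> 'a set \<Rightarrow> bool" where
  "lattice_ideal L I \<longleftrightarrow> I \<subseteq> carrier L \<and> \<bottom>\<^bsub>L\<^esub> \<in> I \<and>
     (\<forall>x\<in>I. \<forall>y\<in>carrier L. y \<sqsubseteq>\<^bsub>L\<^esub> x \<longrightarrow> y \<in> I) \<and> (\<forall>x\<in>I. \<forall>y\<in>I. x \<squnion>\<^bsub>L\<^esub> y \<in> I)"

definition prime_filter :: "('a, 'b) gorder_scheme \<Rightarrow> 'a set \<Rightarrow> bool" where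
  "prime_filter L P \<longleftrightarrow> lattice_filter L P \<and> \<bottom>\<^bsub>L\<^esub> \<notin> P \<and>
     (\<forall>x\<in>carrier L. \<forall>y\<in>carrier L. x \<squnion>\<^bsub>L\<^esub> y \<in> P \<longrightarrow> x \<in> P \<or> y \<in> P)"

lemma lattice_filter_Union_chain:
  assumes "C \<noteq> {}" "\<And>F. F \<in> C \<Longrightarrow> lattice_filter L F" "\<And>F G. F \<in> C \<Longrightarrow> G \<in> C \<Longrightarrow> F \<subseteq> G \<or> G \<subseteq> F"
  shows "lattice_filter L (\<Union>C)"
  unfolding lattice_filter_def
proof (intro conjI ballI impI)
  show "\<Union>C \<subseteq> carrier L" "\<top>\<^bsub>L\<^esub> \<in> \<Union>C"
    using assms(1,2) unfolding lattice_filter_def by blast+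
next
  fix x y assume "x \<in> \<Union>C" "y \<in> carrier L" "x \<sqsubseteq>\<^bsub>L\<^esub> y"
  then show "y \<in> \<Union>C" using assms(2) unfolding lattice_filter_def by (meson UnionE UnionI)
next
  fix x y assume "x \<in> \<Union>C" "y \<in> \<Union>C"
  then obtain F where "F \<in> C" "x \<in> F" "y \<in> F" using assms(3) by blast
  then show "x \<sqinter>\<^bsub>L\<^esub> y \<in> \<Union>C" using assms(2) unfolding lattice_filter_def by blast
qed

context bounded_distrib_lattice
begin

lemma meet_mono:
  assumes "x \<sqsubseteq> x'" "y \<sqsubseteq> y'"
    and "x \<in> carrier L" "x' \<in> carrier L" "y \<in> carrier L" "y' \<in> carrier L"
  shows "x \<sqinter> y \<sqsubseteq> x' \<sqinter> y'"
  using assms le_trans[of "x \<sqinter> y" x x'] le_trans[of "x \<sqinter> y" y y']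
  by (intro meet_le) (simp_all add: meet_left meet_right)

lemma lattice_filter_extend:
  assumes F: "lattice_filter L F" and x: "x \<in> carrier L"
  shows "lattice_filter L {z \<in> carrier L. \<exists>p\<in>F. p \<sqinter> x \<sqsubseteq> z}" (is "lattice_filter L ?G")
    and "F \<subseteq> {z \<in> carrier L. \<exists>p\<in>F. p \<sqinter> x \<sqsubseteq> z}" "x \<in> {z \<in> carrier L. \<exists>p\<in>F. p \<sqinter> x \<sqsubseteq> z}"
proof -
  have sub: "p \<in> carrier L" if "p \<in> F" for p using F that unfolding lattice_filter_def by blast
  have top: "\<top> \<in> F" and meet: "\<And>p q. p \<in> F \<Longrightarrow> q \<in> F \<Longrightarrow> p \<sqinter> q \<in> F"
    using F unfolding lattice_filter_def by simp_all
  show "F \<subseteq> ?G"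
  proof
    fix p assume "p \<in> F"
    then show "p \<in> ?G" using sub x meet_left by (intro CollectI conjI bexI[of _ p]) simp_all
  qed
  show "x \<in> ?G" using top x meet_right by (intro CollectI conjI bexI[of _ \<top>]) simp_all
  show "lattice_filter L ?G"
    unfolding lattice_filter_def
  proof (intro conjI ballI impI)
    show "?G \<subseteq> carrier L" by blast
    show "\<top> \<in> ?G" using top x by (intro CollectI conjI bexI[of _ \<top>]) simp_all
  next
    fix y z assume "y \<in> ?G" and z: "z \<in> carrier L" "y \<sqsubseteq> z"
    then obtain p where p: "p \<in> F" "p \<sqinter> x \<sqsubseteq> y" "y \<in> carrier L" by blast
    have "p \<sqinter> x \<sqsubseteq> z" using le_trans[OF p(2) z(2)] p z sub x by simp
    then show "z \<in> ?G" using p(1) z(1) by blast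
  next
    fix y z assume "y \<in> ?G" "z \<in> ?G"
    then obtain p q where p: "p \<in> F" "p \<sqinter> x \<sqsubseteq> y" "y \<in> carrier L"
      and q: "q \<in> F" "q \<sqinter> x \<sqsubseteq> z" "z \<in> carrier L" by blast
    have pq: "p \<in> carrier L" "q \<in> carrier L" using p(1) q(1) sub by simp_all
    have "(p \<sqinter> q) \<sqinter> x \<sqsubseteq> p \<sqinter> x" "(p \<sqinter> q) \<sqinter> x \<sqsubseteq> q \<sqinter> x"
      using pq x by (simp_all add: meet_mono meet_left meet_right)
    then have "(p \<sqinter> q) \<sqinter> x \<sqsubseteq> y \<sqinter> z"
      using le_trans[of "(p \<sqinter> q) \<sqinter> x" "p \<sqinter> x" y] le_trans[of "(p \<sqinter> q) \<sqinter> x" "q \<sqinter> x" z] p q pq x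
      by (intro meet_le) simp_all
    then show "y \<sqinter> z \<in> ?G"
      using meet[OF p(1) q(1)] p(3) q(3) by (intro CollectI conjI bexI[of _ "p \<sqinter> q"]) simp_all
  qed
qed

text \<open>A filter that is maximal among those disjoint from the ideal is prime: if it contained neither
  \<open>x\<close> nor \<open>y\<close>, then adding either would meet the ideal, and by distributivity so would adding
  \<open>x \<squnion> y\<close>.\<close>

theorem prime_filter_separation:
  assumes F: "lattice_filter L F" and I: "lattice_ideal L I" and disj: "F \<inter> I = {}"
  obtains P where "prime_filter L P" "F \<subseteq> P" "P \<inter> I = {}"
proof -
  let ?A = "{G. lattice_filter L G \<and> F \<subseteq> G \<and> G \<inter> I = {}}"
  have "\<exists>P\<in>?A. \<forall>G\<in>?A. P \<subseteq> G \<longrightarrow> G = P"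
  proof (rule subset_Zorn_nonempty)
    show "?A \<noteq> {}" using F disj by blast
    fix C assume C: "C \<noteq> {}" "subset.chain ?A C"
    then have "lattice_filter L (\<Union>C)"
      by (intro lattice_filter_Union_chain) (auto simp: subset_chain_def)
    then show "\<Union>C \<in> ?A" using C unfolding subset_chain_def by blast
  qed
  then obtain P where P: "lattice_filter L P" "F \<subseteq> P" "P \<inter> I = {}"
    and max: "\<And>G. lattice_filter L G \<Longrightarrow> G \<inter> I = {} \<Longrightarrow> P \<subseteq> G \<Longrightarrow> G = P"
    by (auto intro: order_trans)
  have P_sub: "p \<in> carrier L" if "p \<in> P" for p using P(1) that unfolding lattice_filter_def by blast
  have P_meet: "p \<sqinter> q \<in> P" if "p \<in> P" "q \<in> P" for p q
    using P(1) that unfolding lattice_filter_def by simp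
  have I_sub: "i \<in> carrier L" if "i \<in> I" for i using I that unfolding lattice_ideal_def by blast
  have I_join: "i \<squnion> j \<in> I" if "i \<in> I" "j \<in> I" for i j
    using I that unfolding lattice_ideal_def by simp
  have I_down: "j \<in> I" if "i \<in> I" "j \<in> carrier L" "j \<sqsubseteq> i" for i j
    using I that unfolding lattice_ideal_def by simp
  have hit: "\<exists>p\<in>P. p \<sqinter> x \<in> I" if "x \<in> carrier L" "x \<notin> P" for x
  proof -
    have "{z \<in> carrier L. \<exists>p\<in>P. p \<sqinter> x \<sqsubseteq> z} \<inter> I \<noteq> {}"
      using max[OF lattice_filter_extend(1)[OF P(1) that(1)]]
        lattice_filter_extend(2,3)[OF P(1) that(1)] that(2) by blast
    then obtain p i where p: "p \<in> P" "i \<in> I" "p \<sqinter> x \<sqsubseteq> i" by blast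
    then have "p \<sqinter> x \<in> I" using that(1) by (intro I_down[OF p(2) _ p(3)]) (simp add: P_sub)
    then show ?thesis using p(1) by blast
  qed
  have "x \<in> P \<or> y \<in> P" if xy: "x \<in> carrier L" "y \<in> carrier L" "x \<squnion> y \<in> P" for x y
  proof (rule ccontr)
    assume "\<not> (x \<in> P \<or> y \<in> P)"
    then obtain p q where p: "p \<in> P" "p \<sqinter> x \<in> I" and q: "q \<in> P" "q \<sqinter> y \<in> I"
      using hit[OF xy(1)] hit[OF xy(2)] by blast
    have pq: "p \<in> carrier L" "q \<in> carrier L" using p q P_sub by simp_all
    have "(p \<sqinter> q) \<sqinter> x \<in> I" using pq xy
      by (intro I_down[OF p(2)]) (simp_all add: meet_mono meet_left)
    moreover have "(p \<sqinter> q) \<sqinter> y \<in> I" using pq xy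
      by (intro I_down[OF q(2)]) (simp_all add: meet_mono meet_right)
    ultimately have "(p \<sqinter> q) \<sqinter> (x \<squnion> y) \<in> I" using pq xy by (simp add: meet_join_distrib I_join)
    moreover have "(p \<sqinter> q) \<sqinter> (x \<squnion> y) \<in> P" using p q xy by (simp add: P_meet)
    ultimately show False using P(3) by blast
  qed
  moreover have "\<bottom> \<notin> P" using P(3) I unfolding lattice_ideal_def by blast
  ultimately have "prime_filter L P" unfolding prime_filter_def using P(1) by simp
  then show ?thesis using that P(2,3) by blast
qed

text \<open>Separate the principal filter of \<open>a\<close> from the principal ideal of \<open>b\<close>.\<close>

lemma prime_filter_not_le:
  assumes "a \<in> carrier L" "b \<in> carrier L" "\<not> a \<sqsubseteq> b"
  obtains P where "prime_filter L P" "a \<in> P" "b \<notin> P"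
proof -
  have "lattice_filter L {z \<in> carrier L. a \<sqsubseteq> z}"
    unfolding lattice_filter_def
  proof (intro conjI ballI impI)
    fix x y assume "x \<in> {z \<in> carrier L. a \<sqsubseteq> z}" "y \<in> carrier L" "x \<sqsubseteq> y"
    then show "y \<in> {z \<in> carrier L. a \<sqsubseteq> z}" using assms(1) le_trans[of a x y] by simp
  qed (use assms(1) meet_le in simp_all)
  moreover have "lattice_ideal L {z \<in> carrier L. z \<sqsubseteq> b}"
    unfolding lattice_ideal_def
  proof (intro conjI ballI impI)
    fix x y assume "x \<in> {z \<in> carrier L. z \<sqsubseteq> b}" "y \<in> carrier L" "y \<sqsubseteq> x"
    then show "y \<in> {z \<in> carrier L. z \<sqsubseteq> b}" using assms(2) le_trans[of y x b] by simp
  qed (use assms(2) join_le in simp_all)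
  moreover have "{z \<in> carrier L. a \<sqsubseteq> z} \<inter> {z \<in> carrier L. z \<sqsubseteq> b} = {}"
  proof (rule equals0I)
    fix x assume "x \<in> {z \<in> carrier L. a \<sqsubseteq> z} \<inter> {z \<in> carrier L. z \<sqsubseteq> b}"
    then show False using le_trans[of a x b] assms by simp
  qed
  ultimately obtain P where P: "prime_filter L P" "{z \<in> carrier L. a \<sqsubseteq> z} \<subseteq> P"
    "P \<inter> {z \<in> carrier L. z \<sqsubseteq> b} = {}" by (rule prime_filter_separation)
  have "a \<in> P" using P(2) assms(1) by (simp add: subset_iff)
  moreover have "b \<notin> P"
  proof
    assume "b \<in> P"
    with assms(2) have "b \<in> P \<inter> {z \<in> carrier L. z \<sqsubseteq> b}" by simp
    with P(3) show False by simp
  qed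
  ultimately show ?thesis using that P(1) by blast
qed

end

section \<open>Priestley spaces\<close>

lemma ClopUp_subset: "U \<in> ClopUp X \<Longrightarrow> U \<subseteq> points X"
  unfolding ClopUp_def clopen_in_def points_def using openin_subset by blast

lemma ClopUp_clopen:
  "U \<in> ClopUp X \<Longrightarrow> openin (topol X) U" "U \<in> ClopUp X \<Longrightarrow> closedin (topol X) U"
  unfolding ClopUp_def clopen_in_def by simp_all

lemma ClopUp_upset: "U \<in> ClopUp X \<Longrightarrow> x \<in> U \<Longrightarrow> (x, y) \<in> leq X \<Longrightarrow> y \<in> U"
  unfolding ClopUp_def by blast

lemma ClopUp_Int: "U \<in> ClopUp X \<Longrightarrow> V \<in> ClopUp X \<Longrightarrow> U \<inter> V \<in> ClopUp X"
  unfolding ClopUp_def clopen_in_def by auto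

lemma ClopUp_Un: "U \<in> ClopUp X \<Longrightarrow> V \<in> ClopUp X \<Longrightarrow> U \<union> V \<in> ClopUp X"
  unfolding ClopUp_def clopen_in_def by auto

lemma ClopUp_empty: "{} \<in> ClopUp X"
  unfolding ClopUp_def clopen_in_def by simp

context
  fixes X :: "'a ordered_space"
  assumes X: "priestley_space X"
begin

lemma priestley_compact: "compact_space (topol X)"
  using X unfolding priestley_space_def by blast

lemma priestley_leq_points: "(x, y) \<in> leq X \<Longrightarrow> x \<in> points X \<and> y \<in> points X"
  using X unfolding priestley_space_def partial_order_on_def preorder_on_def by blast

lemma priestley_refl: "x \<in> points X \<Longrightarrow> (x, x) \<in> leq X"
  using X unfolding priestley_space_def partial_order_on_def preorder_on_def refl_on_def by blast

lemma priestley_antisym: "(x, y) \<in> leq X \<Longrightarrow> (y, x) \<in> leq X \<Longrightarrow> x = y"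
  using X unfolding priestley_space_def partial_order_on_def antisym_def by blast

lemma priestley_separation:
  "\<lbrakk>x \<in> points X; y \<in> points X; (x, y) \<notin> leq X\<rbrakk> \<Longrightarrow> \<exists>U\<in>ClopUp X. x \<in> U \<and> y \<notin> U"
  using X unfolding priestley_space_def by blast

lemma priestley_leq_iff:
  assumes "x \<in> points X" "y \<in> points X"
  shows "(x, y) \<in> leq X \<longleftrightarrow> (\<forall>U\<in>ClopUp X. x \<in> U \<longrightarrow> y \<in> U)"
  using assms priestley_separation ClopUp_upset by metis

lemma ClopUp_points: "points X \<in> ClopUp X"
  unfolding ClopUp_def clopen_in_def using priestley_leq_points by (auto simp: points_def)

lemma ClopDown_iff: "U \<in> ClopDown X \<longleftrightarrow> U \<subseteq> points X \<and> points X - U \<in> ClopUp X"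
proof -
  have "clopen_in X U \<longleftrightarrow> U \<subseteq> points X \<and> clopen_in X (points X - U)"
    unfolding clopen_in_def points_def closedin_def
    by (metis Diff_subset double_diff openin_subset subset_refl)
  then show ?thesis unfolding ClopDown_def ClopUp_def using priestley_leq_points by blast
qed

end

lemma finite_Inter_closed:
  assumes "finite \<F>" "\<F> \<subseteq> \<S>" "T \<in> \<S>" "\<And>U V. U \<in> \<S> \<Longrightarrow> V \<in> \<S> \<Longrightarrow> U \<inter> V \<in> \<S>"
  shows "T \<inter> \<Inter>\<F> \<in> \<S>"
  using assms(1,2)
proof (induction \<F>)
  case (insert U \<F>)
  then have "U \<inter> (T \<inter> \<Inter>\<F>) \<in> \<S>" using assms(4) by simp
  then show ?case by (simp add: Int_left_commute)
qed (use assms(3) in simp)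

lemma finite_Union_closed:
  assumes "finite \<F>" "\<F> \<subseteq> \<S>" "{} \<in> \<S>" "\<And>U V. U \<in> \<S> \<Longrightarrow> V \<in> \<S> \<Longrightarrow> U \<union> V \<in> \<S>"
  shows "\<Union>\<F> \<in> \<S>"
  using assms by (induction \<F>) simp_all

text \<open>Otherwise the sets of \<open>\<W>\<close> and the complements of those of \<open>\<V>\<close> cover the space, and a finite
  subcover yields \<open>V \<subseteq> W\<close>.\<close>

lemma compact_filter_ideal_point:
  assumes "compact_space T"
    and \<V>: "\<And>V. V \<in> \<V> \<Longrightarrow> closedin T V" "topspace T \<in> \<V>" "\<And>U V. U \<in> \<V> \<Longrightarrow> V \<in> \<V> \<Longrightarrow> U \<inter> V \<in> \<V>"
    and \<W>: "\<And>W. W \<in> \<W> \<Longrightarrow> openin T W" "{} \<in> \<W>" "\<And>U V. U \<in> \<W> \<Longrightarrow> V \<in> \<W> \<Longrightarrow> U \<union> V \<in> \<W>"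
    and not_le: "\<And>V W. V \<in> \<V> \<Longrightarrow> W \<in> \<W> \<Longrightarrow> \<not> V \<subseteq> W"
  shows "\<exists>y\<in>topspace T. (\<forall>V\<in>\<V>. y \<in> V) \<and> (\<forall>W\<in>\<W>. y \<notin> W)"
proof (rule ccontr)
  assume none: "\<not> (\<exists>y\<in>topspace T. (\<forall>V\<in>\<V>. y \<in> V) \<and> (\<forall>W\<in>\<W>. y \<notin> W))"
  let ?N = "(\<lambda>V. topspace T - V) ` \<V>"
  have "topspace T \<subseteq> \<Union>(?N \<union> \<W>)" using none by blast
  moreover have "openin T U" if "U \<in> ?N \<union> \<W>" for U using that \<V>(1) \<W>(1) by blast
  ultimately obtain \<F> where \<F>: "finite \<F>" "\<F> \<subseteq> ?N \<union> \<W>" "topspace T \<subseteq> \<Union>\<F>"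
    using assms(1) unfolding compact_space_alt by meson
  obtain \<V>0 where \<V>0: "\<V>0 \<subseteq> \<V>" "finite \<V>0" "\<F> \<inter> ?N = (\<lambda>V. topspace T - V) ` \<V>0"
    using finite_subset_image[of "\<F> \<inter> ?N" "\<lambda>V. topspace T - V" \<V>] \<F>(1) by blast
  have "topspace T \<inter> \<Inter>\<V>0 \<in> \<V>" using \<V>0(2,1) \<V>(2,3) by (rule finite_Inter_closed)
  moreover have "\<Union>(\<F> \<inter> \<W>) \<in> \<W>" using \<F>(1) \<W>(2,3) by (intro finite_Union_closed) auto
  moreover have "topspace T \<inter> \<Inter>\<V>0 \<subseteq> \<Union>(\<F> \<inter> \<W>)"
  proof
    fix x assume x: "x \<in> topspace T \<inter> \<Inter>\<V>0"
    then obtain U where U: "U \<in> \<F>" "x \<in> U" using \<F>(3) by blast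
    have "U \<notin> ?N"
    proof
      assume "U \<in> ?N"
      with U(1) have "U \<in> \<F> \<inter> ?N" by (rule IntI)
      then obtain V where "V \<in> \<V>0" "U = topspace T - V" unfolding \<V>0(3) by (rule imageE)
      with x U(2) show False by simp
    qed
    then show "x \<in> \<Union>(\<F> \<inter> \<W>)" using U \<F>(2) by blast
  qed
  ultimately show False using not_le by blast
qed

text \<open>Finitely many members of \<open>\<S>\<close> that miss \<open>y\<close> cover \<open>C\<close>; take their union.\<close>

lemma compact_point_separation:
  assumes T: "compact_space T" and C: "closedin T C"
    and \<S>: "\<And>V. V \<in> \<S> \<Longrightarrow> openin T V" "{} \<in> \<S>" "\<And>U V. U \<in> \<S> \<Longrightarrow> V \<in> \<S> \<Longrightarrow> U \<union> V \<in> \<S>"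
    and sep: "\<And>x. x \<in> C \<Longrightarrow> \<exists>V\<in>\<S>. x \<in> V \<and> y \<notin> V"
  shows "\<exists>V\<in>\<S>. C \<subseteq> V \<and> y \<notin> V"
proof -
  have "compactin T C" using T C by (rule closedin_compact_space)
  moreover have "C \<subseteq> \<Union>{V \<in> \<S>. y \<notin> V}" using sep by blast
  ultimately obtain \<F> where \<F>: "finite \<F>" "\<F> \<subseteq> {V \<in> \<S>. y \<notin> V}" "C \<subseteq> \<Union>\<F>"
    using compactinD[of T C "{V \<in> \<S>. y \<notin> V}"] \<S>(1) by blast
  then have "\<Union>\<F> \<in> {V \<in> \<S>. y \<notin> V}"
    using \<S>(2,3) by (intro finite_Union_closed) simp_all
  then show ?thesis using \<F>(3) by blast
qed

text \<open>Now the complements of the members of \<open>\<S>\<close> that contain \<open>C\<close> cover \<open>E\<close>; take the intersection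
  of the members that belong to a finite subcover.\<close>

lemma compact_separation:
  assumes T: "compact_space T" and C: "closedin T C" and E: "closedin T E"
    and \<S>: "\<And>V. V \<in> \<S> \<Longrightarrow> openin T V \<and> closedin T V" "{} \<in> \<S>" "topspace T \<in> \<S>"
    and Int: "\<And>U V. U \<in> \<S> \<Longrightarrow> V \<in> \<S> \<Longrightarrow> U \<inter> V \<in> \<S>"
    and Un: "\<And>U V. U \<in> \<S> \<Longrightarrow> V \<in> \<S> \<Longrightarrow> U \<union> V \<in> \<S>"
    and sep: "\<And>x y. x \<in> C \<Longrightarrow> y \<in> E \<Longrightarrow> \<exists>V\<in>\<S>. x \<in> V \<and> y \<notin> V"
  shows "\<exists>V\<in>\<S>. C \<subseteq> V \<and> V \<inter> E = {}"
proof -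
  have point: "\<exists>V\<in>\<S>. C \<subseteq> V \<and> y \<notin> V" if "y \<in> E" for y
    using T C \<S>(1,2) Un sep[OF _ that] by (intro compact_point_separation[of T]) simp_all
  let ?N = "(\<lambda>V. topspace T - V) ` {V \<in> \<S>. C \<subseteq> V}"
  have "E \<subseteq> topspace T" "C \<subseteq> topspace T" using C E closedin_subset by blast+
  have "E \<subseteq> \<Union>?N"
  proof
    fix y assume y: "y \<in> E"
    then obtain V where V: "V \<in> {V \<in> \<S>. C \<subseteq> V}" "y \<notin> V" using point by blast
    with y \<open>E \<subseteq> topspace T\<close> have "y \<in> topspace T - V" by blast
    then show "y \<in> \<Union>?N" by (rule UnionI[OF imageI[OF V(1)]])
  qed
  moreover have "compactin T E" using T E by (rule closedin_compact_space)
  moreover have "openin T U" if "U \<in> ?N" for U using that \<S>(1) by blast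
  ultimately obtain \<F> where \<F>: "finite \<F>" "\<F> \<subseteq> ?N" "E \<subseteq> \<Union>\<F>"
    using compactinD[of T E ?N] by blast
  obtain \<G> where \<G>: "\<G> \<subseteq> {V \<in> \<S>. C \<subseteq> V}" "finite \<G>" "\<F> = (\<lambda>V. topspace T - V) ` \<G>"
    using finite_subset_image[OF \<F>(1,2)] by blast
  have "topspace T \<inter> \<Inter>\<G> \<in> {V \<in> \<S>. C \<subseteq> V}"
    using \<G>(2,1) \<S>(3) Int \<open>C \<subseteq> topspace T\<close> by (intro finite_Inter_closed) simp_all
  moreover have "topspace T \<inter> \<Inter>\<G> \<inter> E = {}"
  proof (rule equals0I)
    fix y assume y: "y \<in> topspace T \<inter> \<Inter>\<G> \<inter> E"
    then obtain U where U: "U \<in> \<F>" "y \<in> U" using \<F>(3) by blast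
    then obtain V where "V \<in> \<G>" "U = topspace T - V" unfolding \<G>(3) by (elim imageE)
    with y U(2) show False by simp
  qed
  ultimately show ?thesis by blast
qed

section \<open>The Priestley space of prime filters\<close>

text \<open>The points of a space and the elements of a lattice have the same type in the categories, so
  prime filters cannot serve as points themselves; they are coded by \<open>k\<close>.\<close>

locale prime_filter_space = bounded_distrib_lattice L for L :: "('a, 'b) gorder_scheme" (structure) +
  fixes P :: "'v set" and k :: "'v \<Rightarrow> 'a set"
  assumes k: "bij_betw k P {F. prime_filter L F}"
begin

definition \<phi> :: "'a \<Rightarrow> 'v set" where
  "\<phi> a = {p \<in> P. a \<in> k p}"

definition spectrum :: "'v ordered_space" where
  "spectrum = \<lparr>topol = topology (arbitrary union_of (finite intersection_of
       (\<lambda>U. U \<in> \<phi> ` carrier L \<union> (\<lambda>a. P - \<phi> a) ` carrier L) relative_to P)),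
     leq = {(p, q). p \<in> P \<and> q \<in> P \<and> k p \<subseteq> k q}\<rparr>"

lemma k_prime: "p \<in> P \<Longrightarrow> prime_filter L (k p)"
  using bij_betw_apply[OF k] by simp

lemma k_surj:
  assumes "prime_filter L F"
  obtains p where "p \<in> P" "k p = F"
proof -
  have "F \<in> k ` P" using bij_betw_imp_surj_on[OF k] assms by simp
  then show ?thesis using that by (elim imageE) simp
qed

lemma topspace_spectrum: "topspace (topol spectrum) = P"
  unfolding spectrum_def by (simp only: ordered_space.simps topspace_subbase)

lemma points_spectrum: "points spectrum = P"
  unfolding points_def by (rule topspace_spectrum)

lemma \<phi>_subset: "\<phi> a \<subseteq> P"
  unfolding \<phi>_def by blast

lemma \<phi>_top: "\<phi> \<top> = P"
proof -
  have "\<top> \<in> k p" if "p \<in> P" for p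
    using k_prime[OF that] unfolding prime_filter_def lattice_filter_def by simp
  then show ?thesis unfolding \<phi>_def by (simp add: set_eq_iff cong: conj_cong)
qed

lemma \<phi>_bottom: "\<phi> \<bottom> = {}"
  using k_prime unfolding \<phi>_def prime_filter_def by simp

lemma mem_iff:
  assumes "p \<in> P" "a \<in> carrier L" "b \<in> carrier L"
  shows "a \<sqinter> b \<in> k p \<longleftrightarrow> a \<in> k p \<and> b \<in> k p" "a \<squnion> b \<in> k p \<longleftrightarrow> a \<in> k p \<or> b \<in> k p"
    and "a \<in> k p \<Longrightarrow> a \<sqsubseteq> b \<Longrightarrow> b \<in> k p"
proof -
  have up: "\<And>x y. x \<in> k p \<Longrightarrow> y \<in> carrier L \<Longrightarrow> x \<sqsubseteq> y \<Longrightarrow> y \<in> k p"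
    and meet: "\<And>x y. x \<in> k p \<Longrightarrow> y \<in> k p \<Longrightarrow> x \<sqinter> y \<in> k p"
    and prime: "\<And>x y. x \<in> carrier L \<Longrightarrow> y \<in> carrier L \<Longrightarrow> x \<squnion> y \<in> k p \<Longrightarrow> x \<in> k p \<or> y \<in> k p"
    using k_prime[OF assms(1)] unfolding prime_filter_def lattice_filter_def by simp_all
  show "a \<in> k p \<Longrightarrow> a \<sqsubseteq> b \<Longrightarrow> b \<in> k p" by (rule up[OF _ assms(3)])
  show "a \<sqinter> b \<in> k p \<longleftrightarrow> a \<in> k p \<and> b \<in> k p"
    using up[of "a \<sqinter> b" a] up[of "a \<sqinter> b" b] meet[of a b] assms(2,3) meet_left[of a b] meet_right[of a b]
    by metis
  show "a \<squnion> b \<in> k p \<longleftrightarrow> a \<in> k p \<or> b \<in> k p"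
    using up[of a "a \<squnion> b"] up[of b "a \<squnion> b"] prime[of a b] assms(2,3) join_left[of a b] join_right[of a b]
      join_closed[of a b] by metis
qed

lemma \<phi>_meet: "a \<in> carrier L \<Longrightarrow> b \<in> carrier L \<Longrightarrow> \<phi> (a \<sqinter> b) = \<phi> a \<inter> \<phi> b"
  unfolding \<phi>_def set_eq_iff using mem_iff(1)[of _ a b] by simp metis

lemma \<phi>_join: "a \<in> carrier L \<Longrightarrow> b \<in> carrier L \<Longrightarrow> \<phi> (a \<squnion> b) = \<phi> a \<union> \<phi> b"
  unfolding \<phi>_def set_eq_iff using mem_iff(2)[of _ a b] by simp metis

lemma \<phi>_le_iff:
  assumes "a \<in> carrier L" "b \<in> carrier L"
  shows "\<phi> a \<subseteq> \<phi> b \<longleftrightarrow> a \<sqsubseteq> b"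
proof
  assume le: "\<phi> a \<subseteq> \<phi> b"
  show "a \<sqsubseteq> b"
  proof (rule ccontr)
    assume "\<not> a \<sqsubseteq> b"
    with assms obtain F where F: "prime_filter L F" "a \<in> F" "b \<notin> F" by (rule prime_filter_not_le)
    obtain p where p: "p \<in> P" "k p = F" using k_surj[OF F(1)] .
    then have "p \<in> \<phi> a" "p \<notin> \<phi> b" using F(2,3) unfolding \<phi>_def by simp_all
    with le show False by (simp add: subset_iff)
  qed
next
  assume "a \<sqsubseteq> b"
  then show "\<phi> a \<subseteq> \<phi> b" unfolding \<phi>_def using mem_iff(3)[OF _ assms] by (simp add: subset_iff)
qed

lemma clopen_\<phi>:
  assumes "a \<in> carrier L"
  shows "openin (topol spectrum) (\<phi> a)" "closedin (topol spectrum) (\<phi> a)"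
proof -
  have "openin (topol spectrum) U"
    if "U \<in> \<phi> ` carrier L \<union> (\<lambda>a. P - \<phi> a) ` carrier L" "U \<subseteq> P" for U
    using that unfolding spectrum_def
    by (simp add: openin_subbase arbitrary_union_of_inc finite_intersection_of_inc
        relative_to_subset_inc del: Un_iff)
  then have "openin (topol spectrum) (\<phi> a)" "openin (topol spectrum) (P - \<phi> a)"
    using assms \<phi>_subset by blast+
  then show "openin (topol spectrum) (\<phi> a)" "closedin (topol spectrum) (\<phi> a)"
    unfolding closedin_def topspace_spectrum using \<phi>_subset by simp_all
qed

text \<open>By Alexander's lemma, consider a cover by sets \<open>\<phi> a\<close> (\<open>a \<in> A\<close>) and \<open>P - \<phi> b\<close> (\<open>b \<in> B\<close>).  If
  finitely many never suffice, then the filter generated by \<open>B\<close> is disjoint from the ideal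
  generated by \<open>A\<close>, and a prime filter separating them is a point outside the cover.  Both are
  expressed by means of \<open>\<phi>\<close>, which embeds the lattice into the subsets of \<open>P\<close>.\<close>

lemma compact_spectrum: "compact_space (topol spectrum)"
proof (rule Alexander_subbase_alt)
  show "P \<subseteq> \<Union>(\<phi> ` carrier L \<union> (\<lambda>a. P - \<phi> a) ` carrier L)" using \<phi>_top top_closed by blast
  show "topology (arbitrary union_of (finite intersection_of
      (\<lambda>U. U \<in> \<phi> ` carrier L \<union> (\<lambda>a. P - \<phi> a) ` carrier L) relative_to P)) = topol spectrum"
    unfolding spectrum_def by simp
next
  fix C assume C: "C \<subseteq> \<phi> ` carrier L \<union> (\<lambda>a. P - \<phi> a) ` carrier L" "P \<subseteq> \<Union>C"
  define A where "A = {a \<in> carrier L. \<phi> a \<in> C}"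
  define B where "B = {b \<in> carrier L. P - \<phi> b \<in> C}"
  define I where "I = {a \<in> carrier L. \<exists>A'\<subseteq>A. finite A' \<and> \<phi> a \<subseteq> \<Union>(\<phi> ` A')}"
  define F where "F = {b \<in> carrier L. \<exists>B'\<subseteq>B. finite B' \<and> P \<inter> \<Inter>(\<phi> ` B') \<subseteq> \<phi> b}"
  have I: "lattice_ideal L I"
    unfolding lattice_ideal_def
  proof (intro conjI ballI impI)
    show "I \<subseteq> carrier L" unfolding I_def by blast
    show "\<bottom> \<in> I" unfolding I_def using bottom_closed \<phi>_bottom by blast
  next
    fix x y assume "x \<in> I" "y \<in> carrier L" "y \<sqsubseteq> x"
    moreover from this have "\<phi> y \<subseteq> \<phi> x" by (simp add: \<phi>_le_iff I_def)
    ultimately show "y \<in> I" unfolding I_def by blast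
  next
    fix x y assume xy: "x \<in> I" "y \<in> I"
    then obtain A1 A2 where "A1 \<subseteq> A" "finite A1" "\<phi> x \<subseteq> \<Union>(\<phi> ` A1)"
      "A2 \<subseteq> A" "finite A2" "\<phi> y \<subseteq> \<Union>(\<phi> ` A2)" unfolding I_def by blast
    then have "A1 \<union> A2 \<subseteq> A" "finite (A1 \<union> A2)" "\<phi> x \<union> \<phi> y \<subseteq> \<Union>(\<phi> ` (A1 \<union> A2))" by auto
    then show "x \<squnion> y \<in> I"
      using xy unfolding I_def by (intro CollectI conjI exI[of _ "A1 \<union> A2"]) (simp_all add: \<phi>_join)
  qed
  have F: "lattice_filter L F"
    unfolding lattice_filter_def
  proof (intro conjI ballI impI)
    show "F \<subseteq> carrier L" unfolding F_def by blast
    show "\<top> \<in> F" unfolding F_def using top_closed \<phi>_top by blast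
  next
    fix x y assume "x \<in> F" "y \<in> carrier L" "x \<sqsubseteq> y"
    moreover from this have "\<phi> x \<subseteq> \<phi> y" by (simp add: \<phi>_le_iff F_def)
    ultimately show "y \<in> F" unfolding F_def by blast
  next
    fix x y assume xy: "x \<in> F" "y \<in> F"
    then obtain B1 B2 where "B1 \<subseteq> B" "finite B1" "P \<inter> \<Inter>(\<phi> ` B1) \<subseteq> \<phi> x"
      "B2 \<subseteq> B" "finite B2" "P \<inter> \<Inter>(\<phi> ` B2) \<subseteq> \<phi> y" unfolding F_def by blast
    then have "B1 \<union> B2 \<subseteq> B" "finite (B1 \<union> B2)" "P \<inter> \<Inter>(\<phi> ` (B1 \<union> B2)) \<subseteq> \<phi> x \<inter> \<phi> y" by auto
    then show "x \<sqinter> y \<in> F"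
      using xy unfolding F_def
      by (intro CollectI conjI exI[of _ "B1 \<union> B2"]) (simp_all add: \<phi>_meet del: Int_subset_iff)
  qed
  have "F \<inter> I \<noteq> {}"
  proof
    assume "F \<inter> I = {}"
    with F I obtain G where G: "prime_filter L G" "F \<subseteq> G" "G \<inter> I = {}"
      by (rule prime_filter_separation)
    obtain p where p: "p \<in> P" "k p = G" using k_surj[OF G(1)] .
    have AI: "A \<subseteq> I" unfolding A_def I_def
    proof
      fix a assume a: "a \<in> {a \<in> carrier L. \<phi> a \<in> C}"
      then show "a \<in> {a \<in> carrier L. \<exists>A'\<subseteq>{a \<in> carrier L. \<phi> a \<in> C}. finite A' \<and> \<phi> a \<subseteq> \<Union>(\<phi> ` A')}"
        by (intro CollectI conjI exI[of _ "{a}"]) simp_all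
    qed
    have BF: "B \<subseteq> F" unfolding B_def F_def
    proof
      fix b assume b: "b \<in> {b \<in> carrier L. P - \<phi> b \<in> C}"
      then show "b \<in> {b \<in> carrier L. \<exists>B'\<subseteq>{b \<in> carrier L. P - \<phi> b \<in> C}. finite B' \<and> P \<inter> \<Inter>(\<phi> ` B') \<subseteq> \<phi> b}"
        by (intro CollectI conjI exI[of _ "{b}"]) simp_all
    qed
    obtain U where U: "U \<in> C" "p \<in> U" using C(2) p(1) by blast
    from U C(1) consider a where "a \<in> A" "U = \<phi> a" | b where "b \<in> B" "U = P - \<phi> b"
      unfolding A_def B_def by blast
    then show False
    proof cases
      case 1
      then have "a \<in> G" using U(2) p by (simp add: \<phi>_def)
      moreover have "a \<in> I" using AI 1(1) by (rule subsetD)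
      ultimately have "a \<in> G \<inter> I" by (rule IntI)
      with G(3) show False by simp
    next
      case 2
      then have "b \<notin> G" using U(2) p by (simp add: \<phi>_def)
      moreover have "b \<in> G" using G(2) BF 2(1) by (simp add: subset_iff)
      ultimately show False ..
    qed
  qed
  then obtain x A' B' where "A' \<subseteq> A" "finite A'" "\<phi> x \<subseteq> \<Union>(\<phi> ` A')"
    "B' \<subseteq> B" "finite B'" "P \<inter> \<Inter>(\<phi> ` B') \<subseteq> \<phi> x" unfolding F_def I_def by blast
  then have fin: "finite (\<phi> ` A' \<union> (\<lambda>b. P - \<phi> b) ` B')"
    and sub: "\<phi> ` A' \<union> (\<lambda>b. P - \<phi> b) ` B' \<subseteq> C"
    and le: "P \<inter> \<Inter>(\<phi> ` B') \<subseteq> \<Union>(\<phi> ` A')"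
    unfolding A_def B_def by (simp, fast, fast)
  from le have "P \<subseteq> \<Union>(\<phi> ` A' \<union> (\<lambda>b. P - \<phi> b) ` B')" by auto
  with fin sub show "\<exists>C'. finite C' \<and> C' \<subseteq> C \<and> P \<subseteq> \<Union>C'" by metis
qed

lemma \<phi>_ClopUp: "a \<in> carrier L \<Longrightarrow> \<phi> a \<in> ClopUp spectrum"
  unfolding ClopUp_def clopen_in_def using clopen_\<phi> by (simp add: spectrum_def \<phi>_def subset_iff)

lemma spectrum_separation:
  assumes "p \<in> P" "q \<in> P" "(p, q) \<notin> leq spectrum"
  shows "\<exists>V\<in>\<phi> ` carrier L. p \<in> V \<and> q \<notin> V"
proof -
  obtain a where a: "a \<in> k p" "a \<notin> k q" using assms unfolding spectrum_def by auto
  then have "a \<in> carrier L"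
    using k_prime[OF assms(1)] unfolding prime_filter_def lattice_filter_def by blast
  then have "\<phi> a \<in> \<phi> ` carrier L" by (rule imageI)
  moreover have "p \<in> \<phi> a" "q \<notin> \<phi> a" using a assms(1) by (simp_all add: \<phi>_def)
  ultimately show ?thesis by (intro bexI[of _ "\<phi> a"] conjI)
qed

lemma priestley_spectrum: "priestley_space spectrum"
proof -
  have "antisym (leq spectrum)"
    using bij_betw_imp_inj_on[OF k] unfolding antisym_def spectrum_def by (auto dest: inj_onD)
  then have "partial_order_on P (leq spectrum)"
    unfolding partial_order_on_def preorder_on_def refl_on_def trans_def
    by (simp add: spectrum_def subset_iff)
  then show ?thesis
    unfolding priestley_space_def points_spectrum
    using compact_spectrum spectrum_separation \<phi>_ClopUp by (metis imageE)
qed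

text \<open>The sets \<open>\<phi> a\<close> form a bounded lattice that separates each clopen upset from its complement
  pointwise, hence by compactness globally.\<close>

lemma ClopUp_spectrum: "ClopUp spectrum = \<phi> ` carrier L"
proof
  show "\<phi> ` carrier L \<subseteq> ClopUp spectrum" using \<phi>_ClopUp by (simp add: image_subset_iff)
  show "ClopUp spectrum \<subseteq> \<phi> ` carrier L"
  proof
    fix U assume U: "U \<in> ClopUp spectrum"
    then have "U \<subseteq> P" using ClopUp_subset[OF U] points_spectrum by simp
    have "\<exists>V\<in>\<phi> ` carrier L. U \<subseteq> V \<and> V \<inter> (P - U) = {}"
    proof (rule compact_separation[OF compact_spectrum])
      show "closedin (topol spectrum) U" using U by (rule ClopUp_clopen)
      show "closedin (topol spectrum) (P - U)"
        using ClopUp_clopen(1)[OF U] topspace_spectrum by (metis closedin_diff closedin_topspace)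
      show "openin (topol spectrum) V \<and> closedin (topol spectrum) V" if "V \<in> \<phi> ` carrier L" for V
        using that clopen_\<phi> by (elim imageE) simp
      show "{} \<in> \<phi> ` carrier L" by (rule image_eqI[of _ _ \<bottom>]) (simp_all add: \<phi>_bottom)
      show "topspace (topol spectrum) \<in> \<phi> ` carrier L"
        by (rule image_eqI[of _ _ \<top>]) (simp_all add: \<phi>_top topspace_spectrum)
    next
      fix V W assume "V \<in> \<phi> ` carrier L" "W \<in> \<phi> ` carrier L"
      then obtain a b where ab: "a \<in> carrier L" "b \<in> carrier L" "V = \<phi> a" "W = \<phi> b"
        by (elim imageE)
      show "V \<inter> W \<in> \<phi> ` carrier L" by (rule image_eqI[of _ _ "a \<sqinter> b"]) (use ab in \<open>simp_all add: \<phi>_meet\<close>)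
      show "V \<union> W \<in> \<phi> ` carrier L" by (rule image_eqI[of _ _ "a \<squnion> b"]) (use ab in \<open>simp_all add: \<phi>_join\<close>)
    next
      fix x y assume "x \<in> U" "y \<in> P - U"
      then show "\<exists>V\<in>\<phi> ` carrier L. x \<in> V \<and> y \<notin> V"
        using ClopUp_upset[OF U, of x y] \<open>U \<subseteq> P\<close> by (intro spectrum_separation) auto
    qed
    then obtain V where V: "V \<in> \<phi> ` carrier L" "U \<subseteq> V" "V \<inter> (P - U) = {}" by blast
    then have "V \<subseteq> P" using \<phi>_subset by (elim imageE) simp
    with V(2,3) have "V = U" by blast
    with V(1) show "U \<in> \<phi> ` carrier L" by simp
  qed
qed

end

theorem priestley_representation:
  fixes D :: "('a, 'b) gorder_scheme"
  assumes "bounded_distrib_lattice D" and "Pow (carrier D) \<lesssim> (UNIV :: 'v set)"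
  obtains X :: "'v ordered_space" and \<phi> where "priestley_space X"
    "bij_betw \<phi> (carrier D) (ClopUp X)"
    "\<And>a b. \<lbrakk>a \<in> carrier D; b \<in> carrier D\<rbrakk> \<Longrightarrow> \<phi> a \<subseteq> \<phi> b \<longleftrightarrow> a \<sqsubseteq>\<^bsub>D\<^esub> b"
proof -
  interpret D: bounded_distrib_lattice D by fact
  obtain j :: "'a set \<Rightarrow> 'v" where j: "inj_on j (Pow (carrier D))"
    using assms(2) unfolding lepoll_def by blast
  have "{F. prime_filter D F} \<subseteq> Pow (carrier D)"
    unfolding prime_filter_def lattice_filter_def by (simp add: subset_iff)
  with j have "inj_on j {F. prime_filter D F}" by (rule inj_on_subset)
  then have "bij_betw (inv_into {F. prime_filter D F} j) (j ` {F. prime_filter D F}) {F. prime_filter D F}"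
    by (intro bij_betw_inv_into inj_on_imp_bij_betw)
  then interpret S: prime_filter_space D "j ` {F. prime_filter D F}" "inv_into {F. prime_filter D F} j"
    by unfold_locales
  have "inj_on S.\<phi> (carrier D)"
  proof (rule inj_onI)
    fix a b assume ab: "a \<in> carrier D" "b \<in> carrier D" "S.\<phi> a = S.\<phi> b"
    with S.\<phi>_le_iff[of a b] S.\<phi>_le_iff[of b a] show "a = b" by (simp add: D.le_antisym)
  qed
  then have "bij_betw S.\<phi> (carrier D) (ClopUp S.spectrum)"
    unfolding bij_betw_def by (simp add: S.ClopUp_spectrum)
  with S.priestley_spectrum show ?thesis using S.\<phi>_le_iff by (rule that)
qed

section \<open>The lattice of clopen upsets\<close>

text \<open>Lattices consist of elements of \<open>'v\<close>, so the clopen upsets have to be coded by such elements.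
  The code is an arbitrary map unless the clopen upsets embed into \<open>'v\<close>, which
  \<open>coded_priestley_space\<close> demands.\<close>

definition enc :: "'v ordered_space \<Rightarrow> 'v set \<Rightarrow> 'v" where
  "enc X = (SOME e. inj_on e (ClopUp X))"

definition dec :: "'v ordered_space \<Rightarrow> 'v \<Rightarrow> 'v set" where
  "dec X = inv_into (ClopUp X) (enc X)"

definition clopup_lattice :: "'v ordered_space \<Rightarrow> 'v gorder" where
  "clopup_lattice X = \<lparr>carrier = enc X ` ClopUp X, eq = (=), le = (\<lambda>a b. dec X a \<subseteq> dec X b)\<rparr>"

lemma clopup_lattice_simps [simp]:
  "carrier (clopup_lattice X) = enc X ` ClopUp X" "a \<sqsubseteq>\<^bsub>clopup_lattice X\<^esub> b \<longleftrightarrow> dec X a \<subseteq> dec X b"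
  unfolding clopup_lattice_def by simp_all

definition clopup_map :: "'v ordered_space \<Rightarrow> 'v ordered_space \<Rightarrow> ('v set \<Rightarrow> 'v set) \<Rightarrow> 'v \<Rightarrow> 'v" where
  "clopup_map X Y T = (\<lambda>a\<in>enc Y ` ClopUp Y. enc X (T (dec Y a)))"

text \<open>Modulo the coding, these maps are the arrows of \<open>DL_M\<close> from the lattice of \<open>Y\<close> to that
  of \<open>X\<close>, and the maps below those of \<open>DL_L\<close>; working with maps of sets keeps the coding out of the topological arguments.\<close>

definition meet_hom :: "'v ordered_space \<Rightarrow> 'v ordered_space \<Rightarrow> ('v set \<Rightarrow> 'v set) \<Rightarrow> bool" where
  "meet_hom X Y T \<longleftrightarrow> (\<forall>U\<in>ClopUp Y. T U \<in> ClopUp X) \<and> T (points Y) = points X \<and>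
     (\<forall>U\<in>ClopUp Y. \<forall>V\<in>ClopUp Y. T (U \<inter> V) = T U \<inter> T V)"

definition lattice_hom :: "'v ordered_space \<Rightarrow> 'v ordered_space \<Rightarrow> ('v set \<Rightarrow> 'v set) \<Rightarrow> bool" where
  "lattice_hom X Y T \<longleftrightarrow> meet_hom X Y T \<and>
     (\<forall>U\<in>ClopUp Y. \<forall>V\<in>ClopUp Y. T (U \<union> V) = T U \<union> T V)"

lemma meet_hom_mono:
  assumes "meet_hom X Y T" "U \<in> ClopUp Y" "V \<in> ClopUp Y" "U \<subseteq> V"
  shows "T U \<subseteq> T V"
proof -
  have "T U = T (U \<inter> V)" using assms(4) by (simp add: Int_absorb2)
  also have "\<dots> = T U \<inter> T V" using assms(1-3) unfolding meet_hom_def by blast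
  finally show ?thesis by blast
qed

locale coded_priestley_space =
  fixes X :: "'v ordered_space"
  assumes priestley: "priestley_space X" and lepoll: "ClopUp X \<lesssim> (UNIV :: 'v set)"
begin

lemma inj_enc: "inj_on (enc X) (ClopUp X)"
  using lepoll unfolding lepoll_def enc_def by (metis someI_ex)

lemma dec_enc [simp]: "U \<in> ClopUp X \<Longrightarrow> dec X (enc X U) = U"
  unfolding dec_def using inj_enc by (rule inv_into_f_f)

lemma enc_eq_iff [simp]: "U \<in> ClopUp X \<Longrightarrow> V \<in> ClopUp X \<Longrightarrow> enc X U = enc X V \<longleftrightarrow> U = V"
  using inj_enc by (auto dest: inj_onD)

lemma partial_order_clopup_lattice: "partial_order (clopup_lattice X)"
  unfolding clopup_lattice_def by (rule partial_order_record) auto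

lemma bounded_distrib_lattice_clopup_lattice: "bounded_distrib_lattice (clopup_lattice X)"
proof (rule partial_order.bounded_distrib_latticeI[OF partial_order_clopup_lattice,
      where m = "\<lambda>a b. enc X (dec X a \<inter> dec X b)" and j = "\<lambda>a b. enc X (dec X a \<union> dec X b)"
        and t = "enc X (points X)" and b = "enc X {}"])
qed (auto simp: ClopUp_Int ClopUp_Un ClopUp_points[OF priestley] ClopUp_empty Int_Un_distrib
    intro: ClopUp_subset[THEN subsetD])

lemma meet_clopup_lattice:
  "U \<in> ClopUp X \<Longrightarrow> V \<in> ClopUp X \<Longrightarrow> enc X U \<sqinter>\<^bsub>clopup_lattice X\<^esub> enc X V = enc X (U \<inter> V)"
  by (rule partial_order.meet_eqI[OF partial_order_clopup_lattice]) (auto simp: ClopUp_Int)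

lemma join_clopup_lattice:
  "U \<in> ClopUp X \<Longrightarrow> V \<in> ClopUp X \<Longrightarrow> enc X U \<squnion>\<^bsub>clopup_lattice X\<^esub> enc X V = enc X (U \<union> V)"
  by (rule partial_order.join_eqI[OF partial_order_clopup_lattice]) (auto simp: ClopUp_Un)

lemma top_clopup_lattice: "\<top>\<^bsub>clopup_lattice X\<^esub> = enc X (points X)"
  by (rule partial_order.top_eqI[OF partial_order_clopup_lattice])
    (auto simp: ClopUp_points[OF priestley] intro: ClopUp_subset[THEN subsetD])

lemma order_iso_clopup_lattice:
  assumes "bij_betw \<phi> (carrier D) (ClopUp X)"
    and "\<And>a b. \<lbrakk>a \<in> carrier D; b \<in> carrier D\<rbrakk> \<Longrightarrow> \<phi> a \<subseteq> \<phi> b \<longleftrightarrow> a \<sqsubseteq>\<^bsub>D\<^esub> b"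
  shows "order_iso D (clopup_lattice X) (enc X \<circ> \<phi>)"
proof -
  have "\<phi> a \<in> ClopUp X" if "a \<in> carrier D" for a using assms(1) that by (rule bij_betw_apply)
  moreover have "bij_betw (enc X \<circ> \<phi>) (carrier D) (enc X ` ClopUp X)"
    using assms(1) inj_enc by (blast intro: bij_betw_trans inj_on_imp_bij_betw)
  ultimately show ?thesis unfolding order_iso_def using assms(2) by simp
qed

end

locale coded_priestley_pair = X: coded_priestley_space X + Y: coded_priestley_space Y
  for X Y :: "'v ordered_space"
begin

lemma clopup_map_enc [simp]: "U \<in> ClopUp Y \<Longrightarrow> clopup_map X Y T (enc Y U) = enc X (T U)"
  unfolding clopup_map_def by simp

lemma clopup_map_eq_iff:
  assumes "\<And>U. U \<in> ClopUp Y \<Longrightarrow> S U \<in> ClopUp X" "\<And>U. U \<in> ClopUp Y \<Longrightarrow> T U \<in> ClopUp X"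
  shows "clopup_map X Y S = clopup_map X Y T \<longleftrightarrow> (\<forall>U\<in>ClopUp Y. S U = T U)"
proof
  assume eq: "clopup_map X Y S = clopup_map X Y T"
  show "\<forall>U\<in>ClopUp Y. S U = T U"
  proof
    fix U assume "U \<in> ClopUp Y"
    then show "S U = T U" using fun_cong[OF eq, of "enc Y U"] assms by simp
  qed
next
  assume "\<forall>U\<in>ClopUp Y. S U = T U"
  then show "clopup_map X Y S = clopup_map X Y T" unfolding clopup_map_def by (auto intro!: restrict_ext)
qed

lemma clopup_map_Hom_M:
  assumes "meet_hom X Y T"
  shows "clopup_map X Y T \<in> Hom_M (clopup_lattice Y) (clopup_lattice X)"
proof -
  have T: "\<And>U. U \<in> ClopUp Y \<Longrightarrow> T U \<in> ClopUp X" using assms unfolding meet_hom_def by blast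
  have "clopup_map X Y T \<in> enc Y ` ClopUp Y \<rightarrow>\<^sub>E enc X ` ClopUp X"
    unfolding clopup_map_def using T by auto
  then show ?thesis
    using assms T unfolding meet_hom_def
      Hom_M_iff[OF Y.bounded_distrib_lattice_clopup_lattice X.bounded_distrib_lattice_clopup_lattice]
    by (simp add: X.top_clopup_lattice Y.top_clopup_lattice ClopUp_points[OF Y.priestley]
        X.meet_clopup_lattice Y.meet_clopup_lattice ClopUp_Int)
qed

lemma Hom_M_clopup_map:
  assumes h: "h \<in> Hom_M (clopup_lattice Y) (clopup_lattice X)"
  obtains T where "meet_hom X Y T" "h = clopup_map X Y T"
proof -
  define T where "T U = dec X (h (enc Y U))" for U
  have h_PiE: "h \<in> enc Y ` ClopUp Y \<rightarrow>\<^sub>E enc X ` ClopUp X"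
    and h_top: "h (enc Y (points Y)) = enc X (points X)"
    and h_meet: "\<And>U V. U \<in> ClopUp Y \<Longrightarrow> V \<in> ClopUp Y \<Longrightarrow>
      h (enc Y (U \<inter> V)) = h (enc Y U) \<sqinter>\<^bsub>clopup_lattice X\<^esub> h (enc Y V)"
    using h unfolding
      Hom_M_iff[OF Y.bounded_distrib_lattice_clopup_lattice X.bounded_distrib_lattice_clopup_lattice]
    by (simp_all add: X.top_clopup_lattice Y.top_clopup_lattice Y.meet_clopup_lattice)
  have T: "T U \<in> ClopUp X \<and> enc X (T U) = h (enc Y U)" if U: "U \<in> ClopUp Y" for U
  proof -
    have "h (enc Y U) \<in> enc X ` ClopUp X" using h_PiE imageI[OF U] by (rule PiE_mem)
    then show ?thesis unfolding T_def by auto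
  qed
  have "T (U \<inter> V) = T U \<inter> T V" if "U \<in> ClopUp Y" "V \<in> ClopUp Y" for U V
  proof -
    have "enc X (T (U \<inter> V)) = enc X (T U) \<sqinter>\<^bsub>clopup_lattice X\<^esub> enc X (T V)"
      using that T h_meet by (simp add: ClopUp_Int)
    moreover have "T U \<in> ClopUp X" "T V \<in> ClopUp X" "T (U \<inter> V) \<in> ClopUp X"
      using that T ClopUp_Int by blast+
    ultimately show ?thesis by (simp add: X.meet_clopup_lattice ClopUp_Int)
  qed
  moreover have "T (points Y) = points X"
    unfolding T_def h_top by (simp add: ClopUp_points[OF X.priestley])
  ultimately have "meet_hom X Y T" unfolding meet_hom_def using T by simp
  moreover have "h = clopup_map X Y T"
  proof (rule extensionalityI)
    show "h \<in> extensional (enc Y ` ClopUp Y)" using h_PiE unfolding PiE_def by simp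
    show "clopup_map X Y T \<in> extensional (enc Y ` ClopUp Y)" unfolding clopup_map_def by simp
    fix a assume "a \<in> enc Y ` ClopUp Y"
    then show "h a = clopup_map X Y T a" using T by auto
  qed
  ultimately show ?thesis using that by blast
qed

lemma clopup_map_Hom_L_iff:
  assumes "meet_hom X Y T"
  shows "clopup_map X Y T \<in> Hom_L (clopup_lattice Y) (clopup_lattice X) \<longleftrightarrow> lattice_hom X Y T"
proof -
  have T: "\<And>U. U \<in> ClopUp Y \<Longrightarrow> T U \<in> ClopUp X" using assms unfolding meet_hom_def by blast
  show ?thesis
    unfolding lattice_hom_def
      Hom_L_iff[OF Y.bounded_distrib_lattice_clopup_lattice X.bounded_distrib_lattice_clopup_lattice]
    using clopup_map_Hom_M[OF assms] assms T
    by (simp add: X.join_clopup_lattice Y.join_clopup_lattice ClopUp_Un)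
qed

text \<open>The filter of all \<open>V\<close> with \<open>x \<in> T V\<close> does not contain \<open>U\<close>, so by compactness some point lies in
  all its members but not in \<open>U\<close>.\<close>

lemma meet_hom_point:
  assumes T: "meet_hom X Y T" and U: "U \<in> ClopUp Y" and x: "x \<in> points X" "x \<notin> T U"
  obtains y where "y \<in> points Y" "y \<notin> U" "\<And>V. V \<in> ClopUp Y \<Longrightarrow> x \<in> T V \<Longrightarrow> y \<in> V"
proof -
  let ?V = "{V \<in> ClopUp Y. x \<in> T V}" and ?W = "{W \<in> ClopUp Y. W \<subseteq> U}"
  have "\<exists>y\<in>topspace (topol Y). (\<forall>V\<in>?V. y \<in> V) \<and> (\<forall>W\<in>?W. y \<notin> W)"
  proof (rule compact_filter_ideal_point[OF priestley_compact[OF Y.priestley], of ?V ?W])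
    show "topspace (topol Y) \<in> ?V"
      using T x(1) ClopUp_points[OF Y.priestley] unfolding meet_hom_def points_def by simp
    show "\<And>U V. U \<in> ?V \<Longrightarrow> V \<in> ?V \<Longrightarrow> U \<inter> V \<in> ?V"
      using T unfolding meet_hom_def by (simp add: ClopUp_Int)
    show "\<not> V \<subseteq> W" if "V \<in> ?V" "W \<in> ?W" for V W
      using meet_hom_mono[OF T, of V U] U x(2) that by blast
  qed (simp_all add: ClopUp_clopen ClopUp_Un ClopUp_empty)
  then show ?thesis using that U unfolding points_def by blast
qed

text \<open>If joins are preserved as well, then the filter is prime, and compactness provides a point that lies
  in its members and in no other clopen upset.\<close>

lemma lattice_hom_point:
  assumes T: "lattice_hom X Y T" and x: "x \<in> points X" "x \<notin> T {}"
  obtains y where "y \<in> points Y" "\<And>V. V \<in> ClopUp Y \<Longrightarrow> y \<in> V \<longleftrightarrow> x \<in> T V"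
proof -
  have M: "meet_hom X Y T" using T unfolding lattice_hom_def by blast
  let ?V = "{V \<in> ClopUp Y. x \<in> T V}" and ?W = "{W \<in> ClopUp Y. x \<notin> T W}"
  have "\<exists>y\<in>topspace (topol Y). (\<forall>V\<in>?V. y \<in> V) \<and> (\<forall>W\<in>?W. y \<notin> W)"
  proof (rule compact_filter_ideal_point[OF priestley_compact[OF Y.priestley], of ?V ?W])
    show "topspace (topol Y) \<in> ?V"
      using M x(1) ClopUp_points[OF Y.priestley] unfolding meet_hom_def points_def by simp
    show "\<And>U V. U \<in> ?V \<Longrightarrow> V \<in> ?V \<Longrightarrow> U \<inter> V \<in> ?V"
      using M unfolding meet_hom_def by (simp add: ClopUp_Int)
    show "\<And>U V. U \<in> ?W \<Longrightarrow> V \<in> ?W \<Longrightarrow> U \<union> V \<in> ?W"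
      using T unfolding lattice_hom_def by (simp add: ClopUp_Un)
    show "\<not> V \<subseteq> W" if "V \<in> ?V" "W \<in> ?W" for V W
      using meet_hom_mono[OF M, of V W] that by blast
  qed (use x(2) in \<open>simp_all add: ClopUp_clopen ClopUp_empty\<close>)
  then show ?thesis using that unfolding points_def by blast
qed

end

section \<open>Generalized Priestley morphisms\<close>

text \<open>The relation with a prescribed box operator \<open>T\<close>: the separation condition on a generalized
  Priestley morphism forces \<open>x R y\<close> to hold unless some \<open>U\<close> with \<open>x \<in> T U\<close> excludes \<open>y\<close>.\<close>

definition rel_of :: "'v ordered_space \<Rightarrow> 'v ordered_space \<Rightarrow> ('v set \<Rightarrow> 'v set) \<Rightarrow> ('v \<times> 'v) set" where
  "rel_of X Y T = {(x, y) \<in> points X \<times> points Y. \<forall>U\<in>ClopUp Y. x \<in> T U \<longrightarrow> y \<in> U}"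

text \<open>Composition is thus designed so that box operators compose, which makes \<open>box\<close> functorial and
  yields associativity.\<close>

lemma star_comp_rel_of: "star_comp X Y Z S R = rel_of X Z (\<lambda>U. box X R (box Y S U))"
  unfolding star_comp_def rel_of_def ..

lemma rel_of_cong: "(\<And>U. U \<in> ClopUp Y \<Longrightarrow> S U = T U) \<Longrightarrow> rel_of X Y S = rel_of X Y T"
  unfolding rel_of_def by auto

lemma rel_of_box:
  assumes "R \<in> Hom_R X Y"
  shows "rel_of X Y (box X R) = R"
  using assms unfolding Hom_R_def rel_of_def box_def by blast

lemma meet_hom_box:
  assumes R: "R \<in> Hom_R X Y"
  shows "meet_hom X Y (box X R)"
proof -
  have "R `` {x} \<subseteq> points Y" for x using R unfolding Hom_R_def by blast
  then have "box X R (points Y) = points X" unfolding box_def by auto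
  moreover have "box X R (U \<inter> V) = box X R U \<inter> box X R V" for U V unfolding box_def by blast
  ultimately show ?thesis using R unfolding meet_hom_def Hom_R_def by blast
qed

text \<open>Preservation of meets is what makes \<open>T\<close> a box operator: if \<open>x \<notin> T U\<close>, then \<open>x\<close> is related to
  the point outside \<open>U\<close> provided by \<open>meet_hom_point\<close>.\<close>

lemma (in coded_priestley_pair) box_rel_of:
  assumes T: "meet_hom X Y T" and U: "U \<in> ClopUp Y"
  shows "box X (rel_of X Y T) U = T U"
proof
  have "T U \<subseteq> points X" using T U ClopUp_subset unfolding meet_hom_def by blast
  then show "T U \<subseteq> box X (rel_of X Y T) U" using U unfolding box_def rel_of_def by auto
  show "box X (rel_of X Y T) U \<subseteq> T U"
  proof (rule subsetI, rule ccontr)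
    fix x assume x: "x \<in> box X (rel_of X Y T) U" "x \<notin> T U"
    then have xX: "x \<in> points X" unfolding box_def by blast
    obtain y where "y \<in> points Y" "y \<notin> U" "\<And>V. V \<in> ClopUp Y \<Longrightarrow> x \<in> T V \<Longrightarrow> y \<in> V"
      using meet_hom_point[OF T U xX x(2)] by blast
    with x(1) xX show False unfolding box_def rel_of_def by auto
  qed
qed

lemma (in coded_priestley_pair) rel_of_Hom_R:
  assumes T: "meet_hom X Y T"
  shows "rel_of X Y T \<in> Hom_R X Y"
proof -
  have "\<exists>U\<in>ClopUp Y. rel_of X Y T `` {x} \<subseteq> U \<and> y \<notin> U"
    if xy: "x \<in> points X" "y \<in> points Y" "(x, y) \<notin> rel_of X Y T" for x y
  proof -
    obtain U where U: "U \<in> ClopUp Y" "x \<in> T U" "y \<notin> U" using xy unfolding rel_of_def by auto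
    then have "rel_of X Y T `` {x} \<subseteq> U" unfolding rel_of_def by auto
    with U show ?thesis by blast
  qed
  moreover have "box X (rel_of X Y T) U \<in> ClopUp X" if "U \<in> ClopUp Y" for U
    using box_rel_of[OF T that] T that unfolding meet_hom_def by simp
  moreover have "rel_of X Y T \<subseteq> points X \<times> points Y" unfolding rel_of_def by blast
  ultimately show ?thesis unfolding Hom_R_def by blast
qed

lemma (in coded_priestley_pair) bij_betw_box:
  "bij_betw (\<lambda>R. clopup_map X Y (box X R)) (Hom_R X Y) (Hom_M (clopup_lattice Y) (clopup_lattice X))"
proof (rule bij_betw_imageI)
  show "inj_on (\<lambda>R. clopup_map X Y (box X R)) (Hom_R X Y)"
  proof (rule inj_onI)
    fix R S assume R: "R \<in> Hom_R X Y" and S: "S \<in> Hom_R X Y"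
      and eq: "clopup_map X Y (box X R) = clopup_map X Y (box X S)"
    have "\<And>U. U \<in> ClopUp Y \<Longrightarrow> box X R U \<in> ClopUp X" "\<And>U. U \<in> ClopUp Y \<Longrightarrow> box X S U \<in> ClopUp X"
      using R S unfolding Hom_R_def by blast+
    then have "\<forall>U\<in>ClopUp Y. box X R U = box X S U" using eq by (simp add: clopup_map_eq_iff)
    then have "rel_of X Y (box X R) = rel_of X Y (box X S)" by (intro rel_of_cong) simp
    then show "R = S" using rel_of_box R S by metis
  qed
  show "(\<lambda>R. clopup_map X Y (box X R)) ` Hom_R X Y = Hom_M (clopup_lattice Y) (clopup_lattice X)"
  proof
    show "(\<lambda>R. clopup_map X Y (box X R)) ` Hom_R X Y \<subseteq> Hom_M (clopup_lattice Y) (clopup_lattice X)"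
      using meet_hom_box clopup_map_Hom_M by blast
    show "Hom_M (clopup_lattice Y) (clopup_lattice X) \<subseteq> (\<lambda>R. clopup_map X Y (box X R)) ` Hom_R X Y"
    proof
      fix h assume "h \<in> Hom_M (clopup_lattice Y) (clopup_lattice X)"
      then obtain T where T: "meet_hom X Y T" "h = clopup_map X Y T" by (rule Hom_M_clopup_map)
      have "h = clopup_map X Y (box X (rel_of X Y T))"
        unfolding T(2) clopup_map_def using box_rel_of[OF T(1)] by (auto intro!: restrict_ext)
      then show "h \<in> (\<lambda>R. clopup_map X Y (box X R)) ` Hom_R X Y"
        using rel_of_Hom_R[OF T(1)] by (rule image_eqI)
    qed
  qed
qed

lemma meet_hom_comp:
  assumes "meet_hom X Y S" "meet_hom Y Z T"
  shows "meet_hom X Z (\<lambda>U. S (T U))"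
  using assms unfolding meet_hom_def by simp

lemma leq_Hom_R:
  assumes "priestley_space X"
  shows "leq X \<in> Hom_R X X" "\<And>U. U \<in> ClopUp X \<Longrightarrow> box X (leq X) U = U"
proof -
  show box: "box X (leq X) U = U" if U: "U \<in> ClopUp X" for U
    unfolding box_def using ClopUp_subset[OF U] ClopUp_upset[OF U] priestley_refl[OF assms] by blast
  have "leq X `` {x} \<subseteq> U" if "U \<in> ClopUp X" "x \<in> U" for x U
    using ClopUp_upset[OF that] by auto
  then have "\<exists>U\<in>ClopUp X. leq X `` {x} \<subseteq> U \<and> y \<notin> U"
    if "x \<in> points X" "y \<in> points X" "(x, y) \<notin> leq X" for x y
    using priestley_separation[OF assms that] by metis
  moreover have "leq X \<subseteq> points X \<times> points X" using priestley_leq_points[OF assms] by auto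
  ultimately show "leq X \<in> Hom_R X X" unfolding Hom_R_def using box by simp
qed

section \<open>Partial strong Priestley morphisms\<close>

text \<open>The box operator of a partial function.  It sends \<open>{}\<close> to the complement of the domain, which is
  why morphisms of \<open>DL_L\<close> need not preserve \<open>0\<close>.\<close>

definition pbox :: "'v ordered_space \<Rightarrow> 'v ordered_space \<Rightarrow> ('v \<rightharpoonup> 'v) \<Rightarrow> 'v set \<Rightarrow> 'v set" where
  "pbox X Y f U = points X - {x. \<exists>y\<in>points Y - U. f x = Some y}"

lemma pbox_iff:
  assumes "ran f \<subseteq> points Y"
  shows "x \<in> pbox X Y f U \<longleftrightarrow> x \<in> points X \<and> (\<forall>y. f x = Some y \<longrightarrow> y \<in> U)"
  using assms unfolding pbox_def ran_def by auto

lemma Hom_PS_iff: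
  "f \<in> Hom_PS X Y \<longleftrightarrow> dom f \<in> ClopDown X \<and> ran f \<subseteq> points Y \<and> (\<forall>U\<in>ClopUp Y. pbox X Y f U \<in> ClopUp X)"
  unfolding Hom_PS_def pbox_def by simp

lemma Hom_PS_dom: "f \<in> Hom_PS X Y \<Longrightarrow> f x = Some y \<Longrightarrow> x \<in> points X \<and> y \<in> points Y"
  unfolding Hom_PS_def ClopDown_def clopen_in_def points_def ran_def using openin_subset by blast

lemma lattice_hom_pbox:
  assumes f: "f \<in> Hom_PS X Y"
  shows "lattice_hom X Y (pbox X Y f)"
proof -
  have ran: "ran f \<subseteq> points Y" and T: "\<And>U. U \<in> ClopUp Y \<Longrightarrow> pbox X Y f U \<in> ClopUp X"
    using f unfolding Hom_PS_iff by blast+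
  have "pbox X Y f (U \<inter> V) = pbox X Y f U \<inter> pbox X Y f V"
    "pbox X Y f (U \<union> V) = pbox X Y f U \<union> pbox X Y f V" for U V
    unfolding set_eq_iff Int_iff Un_iff pbox_iff[OF ran] by auto
  moreover have "pbox X Y f (points Y) = points X" unfolding pbox_def by auto
  ultimately show ?thesis using T unfolding lattice_hom_def meet_hom_def by blast
qed

text \<open>The partial function with box operator \<open>T\<close>: the value at \<open>x\<close> is the point whose clopen upset
  neighbourhoods are the \<open>V\<close> with \<open>x \<in> T V\<close>; it is unique because clopen upsets separate points.\<close>

definition pfun_of :: "'v ordered_space \<Rightarrow> 'v ordered_space \<Rightarrow> ('v set \<Rightarrow> 'v set) \<Rightarrow> 'v \<rightharpoonup> 'v" where
  "pfun_of X Y T x = (if x \<in> points X - T {}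
     then Some (SOME y. y \<in> points Y \<and> (\<forall>V\<in>ClopUp Y. y \<in> V \<longleftrightarrow> x \<in> T V)) else None)"

lemma (in coded_priestley_pair) pfun_of_Hom_PS:
  assumes T: "lattice_hom X Y T"
  shows "pfun_of X Y T \<in> Hom_PS X Y" "\<And>U. U \<in> ClopUp Y \<Longrightarrow> pbox X Y (pfun_of X Y T) U = T U"
proof -
  let ?f = "pfun_of X Y T"
  have M: "meet_hom X Y T" using T unfolding lattice_hom_def by blast
  have T_ClopUp: "T U \<in> ClopUp X" if "U \<in> ClopUp Y" for U
    using T that unfolding lattice_hom_def meet_hom_def by blast
  have val: "y \<in> points Y \<and> (\<forall>V\<in>ClopUp Y. y \<in> V \<longleftrightarrow> x \<in> T V)" if "?f x = Some y" for x y
  proof -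
    have x: "x \<in> points X" "x \<notin> T {}"
      and y: "y = (SOME y. y \<in> points Y \<and> (\<forall>V\<in>ClopUp Y. y \<in> V \<longleftrightarrow> x \<in> T V))"
      using that unfolding pfun_of_def by (auto split: if_splits)
    obtain z where "z \<in> points Y" "\<And>V. V \<in> ClopUp Y \<Longrightarrow> z \<in> V \<longleftrightarrow> x \<in> T V"
      using lattice_hom_point[OF T x] by blast
    then have "\<exists>z. z \<in> points Y \<and> (\<forall>V\<in>ClopUp Y. z \<in> V \<longleftrightarrow> x \<in> T V)"
      by (intro exI[of _ z]) simp
    then show ?thesis unfolding y by (rule someI_ex)
  qed
  have dom: "dom ?f = points X - T {}"
    unfolding pfun_of_def by (auto split: if_splits)
  have ran: "ran ?f \<subseteq> points Y" using val unfolding ran_def by blast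
  show box: "pbox X Y ?f U = T U" if U: "U \<in> ClopUp Y" for U
  proof (rule Set.set_eqI)
    fix x
    have sub: "T U \<subseteq> points X" using T_ClopUp[OF U] by (rule ClopUp_subset)
    show "x \<in> pbox X Y ?f U \<longleftrightarrow> x \<in> T U"
    proof (cases "?f x")
      case None
      then have "x \<notin> points X \<or> x \<in> T {}" using dom by (auto simp: domIff)
      moreover have "T {} \<subseteq> T U"
        using meet_hom_mono[OF M ClopUp_empty U] by simp
      ultimately show ?thesis using None sub by (auto simp: pbox_iff[OF ran])
    next
      case (Some y)
      then have "x \<in> points X" using dom by (auto simp: dom_def)
      with Some val[OF Some] U show ?thesis by (simp add: pbox_iff[OF ran])
    qed
  qed
  have "T {} \<in> ClopUp X" using T_ClopUp ClopUp_empty by blast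
  then have "dom ?f \<in> ClopDown X"
    unfolding dom ClopDown_iff[OF X.priestley] using ClopUp_subset[of "T {}" X]
    by (simp add: double_diff)
  with ran box T_ClopUp show "?f \<in> Hom_PS X Y" unfolding Hom_PS_iff by simp
qed

text \<open>Points of a Priestley space are determined by the clopen upsets that contain them, and
  membership of the value at \<open>x\<close> in \<open>U\<close> can be read off the box operator.\<close>

lemma (in coded_priestley_pair) Hom_PS_eqI:
  assumes f: "f \<in> Hom_PS X Y" and g: "g \<in> Hom_PS X Y"
    and eq: "\<And>U. U \<in> ClopUp Y \<Longrightarrow> pbox X Y f U = pbox X Y g U"
  shows "f = g"
proof
  have rf: "ran f \<subseteq> points Y" and rg: "ran g \<subseteq> points Y" using f g unfolding Hom_PS_iff by blast+
  have iff: "(\<forall>y. f x = Some y \<longrightarrow> y \<in> U) \<longleftrightarrow> (\<forall>y. g x = Some y \<longrightarrow> y \<in> U)"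
    if "U \<in> ClopUp Y" "x \<in> points X" for U x
    using eq[OF that(1)] that(2) pbox_iff[OF rf] pbox_iff[OF rg] by blast
  fix x
  show "f x = g x"
  proof (cases "x \<in> points X")
    case False
    then show ?thesis using Hom_PS_dom[OF f] Hom_PS_dom[OF g] by (metis option.exhaust)
  next
    case x: True
    show ?thesis
    proof (cases "f x")
      case None
      then show ?thesis using iff[OF ClopUp_empty x] by (cases "g x") auto
    next
      case fx: (Some y)
      then obtain z where gx: "g x = Some z" using iff[OF ClopUp_empty x] by (cases "g x") auto
      have yz: "y \<in> points Y" "z \<in> points Y" using Hom_PS_dom f g fx gx by metis+
      have "y \<in> U \<longleftrightarrow> z \<in> U" if "U \<in> ClopUp Y" for U using iff[OF that x] fx gx by simp
      then have "(y, z) \<in> leq Y" "(z, y) \<in> leq Y"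
        using yz by (simp_all add: priestley_leq_iff[OF Y.priestley])
      then show ?thesis using fx gx priestley_antisym[OF Y.priestley] by simp
    qed
  qed
qed

lemma (in coded_priestley_pair) bij_betw_pbox:
  "bij_betw (\<lambda>f. clopup_map X Y (pbox X Y f)) (Hom_PS X Y) (Hom_L (clopup_lattice Y) (clopup_lattice X))"
proof (rule bij_betw_imageI)
  show "inj_on (\<lambda>f. clopup_map X Y (pbox X Y f)) (Hom_PS X Y)"
  proof (rule inj_onI)
    fix f g assume f: "f \<in> Hom_PS X Y" and g: "g \<in> Hom_PS X Y"
      and eq: "clopup_map X Y (pbox X Y f) = clopup_map X Y (pbox X Y g)"
    have "\<And>U. U \<in> ClopUp Y \<Longrightarrow> pbox X Y f U \<in> ClopUp X" "\<And>U. U \<in> ClopUp Y \<Longrightarrow> pbox X Y g U \<in> ClopUp X"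
      using f g unfolding Hom_PS_iff by blast+
    then have "\<forall>U\<in>ClopUp Y. pbox X Y f U = pbox X Y g U" using eq by (simp add: clopup_map_eq_iff)
    with f g show "f = g" by (intro Hom_PS_eqI) simp_all
  qed
  show "(\<lambda>f. clopup_map X Y (pbox X Y f)) ` Hom_PS X Y = Hom_L (clopup_lattice Y) (clopup_lattice X)"
  proof
    have "clopup_map X Y (pbox X Y f) \<in> Hom_L (clopup_lattice Y) (clopup_lattice X)"
      if "f \<in> Hom_PS X Y" for f
      using lattice_hom_pbox[OF that] by (simp add: clopup_map_Hom_L_iff lattice_hom_def)
    then show "(\<lambda>f. clopup_map X Y (pbox X Y f)) ` Hom_PS X Y \<subseteq> Hom_L (clopup_lattice Y) (clopup_lattice X)"
      by blast
    show "Hom_L (clopup_lattice Y) (clopup_lattice X) \<subseteq> (\<lambda>f. clopup_map X Y (pbox X Y f)) ` Hom_PS X Y"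
    proof
      fix h assume h: "h \<in> Hom_L (clopup_lattice Y) (clopup_lattice X)"
      then have "h \<in> Hom_M (clopup_lattice Y) (clopup_lattice X)" unfolding Hom_L_def by blast
      then obtain T where T: "meet_hom X Y T" "h = clopup_map X Y T" by (rule Hom_M_clopup_map)
      then have L: "lattice_hom X Y T" using h clopup_map_Hom_L_iff by simp
      have "h = clopup_map X Y (pbox X Y (pfun_of X Y T))"
        unfolding T(2) clopup_map_def using pfun_of_Hom_PS(2)[OF L] by (auto intro!: restrict_ext)
      then show "h \<in> (\<lambda>f. clopup_map X Y (pbox X Y f)) ` Hom_PS X Y"
        using pfun_of_Hom_PS(1)[OF L] by (rule image_eqI)
    qed
  qed
qed

lemma pbox_comp:
  assumes f: "f \<in> Hom_PS X Y" and g: "g \<in> Hom_PS Y Z"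
  shows "pbox X Z (g \<circ>\<^sub>m f) U = pbox X Y f (pbox Y Z g U)"
  using Hom_PS_dom[OF f] Hom_PS_dom[OF g] unfolding pbox_def map_comp_def
  by (auto split: option.splits)

lemma comp_Hom_PS:
  assumes X: "priestley_space X" and f: "f \<in> Hom_PS X Y" and g: "g \<in> Hom_PS Y Z"
  shows "g \<circ>\<^sub>m f \<in> Hom_PS X Z"
proof -
  have box: "pbox X Z (g \<circ>\<^sub>m f) U \<in> ClopUp X" if "U \<in> ClopUp Z" for U
    using f g that unfolding pbox_comp[OF f g] Hom_PS_iff by blast
  have ran: "ran (g \<circ>\<^sub>m f) \<subseteq> points Z"
    using Hom_PS_dom[OF g] unfolding ran_def map_comp_def by (auto split: option.splits)
  have sub: "dom (g \<circ>\<^sub>m f) \<subseteq> points X"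
    using Hom_PS_dom[OF f] by (auto simp: map_comp_def split: option.splits)
  have "points X - dom (g \<circ>\<^sub>m f) = pbox X Z (g \<circ>\<^sub>m f) {}"
    unfolding set_eq_iff pbox_iff[OF ran] by auto
  then have "dom (g \<circ>\<^sub>m f) \<in> ClopDown X"
    unfolding ClopDown_iff[OF X] using sub box[OF ClopUp_empty] by simp
  with ran box show ?thesis unfolding Hom_PS_iff by blast
qed

lemma id_Hom_PS:
  assumes "priestley_space X"
  shows "Some |` points X \<in> Hom_PS X X" "\<And>U. U \<in> ClopUp X \<Longrightarrow> pbox X X (Some |` points X) U = U"
proof -
  show box: "pbox X X (Some |` points X) U = U" if "U \<in> ClopUp X" for U
    using ClopUp_subset[OF that] unfolding pbox_def restrict_map_def by (auto split: if_splits)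
  have "points X \<in> ClopDown X"
    unfolding ClopDown_iff[OF assms] by (simp add: ClopUp_empty)
  moreover have "dom (Some |` points X) = points X" unfolding dom_restrict by auto
  moreover have "ran (Some |` points X) \<subseteq> points X"
    unfolding ran_def restrict_map_def by (auto split: if_splits)
  ultimately show "Some |` points X \<in> Hom_PS X X" unfolding Hom_PS_iff using box by simp
qed

section \<open>The coherent frame of open downsets\<close>

text \<open>The open downsets of the Priestley space of a lattice correspond to its filters, and inclusion
  of open downsets to inclusion of filters.  In this form joins are unions and binary meets are
  intersections, so the frame law is immediate.\<close>

definition open_downsets :: "'a ordered_space \<Rightarrow> 'a set set" where
  "open_downsets X = {W. openin (topol X) W \<and> (\<forall>x\<in>W. \<forall>y. (y, x) \<in> leq X \<longrightarrow> y \<in> W)}"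

lemma ClopDown_open_downsets: "ClopDown X \<subseteq> open_downsets X"
  unfolding ClopDown_def clopen_in_def open_downsets_def by blast

lemma open_downsets_subset: "W \<in> open_downsets X \<Longrightarrow> W \<subseteq> points X"
  unfolding open_downsets_def points_def using openin_subset by blast

lemma open_downsets_Union: "\<W> \<subseteq> open_downsets X \<Longrightarrow> \<Union>\<W> \<in> open_downsets X"
  unfolding open_downsets_def by (auto; metis)

lemma open_downsets_Int: "U \<in> open_downsets X \<Longrightarrow> W \<in> open_downsets X \<Longrightarrow> U \<inter> W \<in> open_downsets X"
  unfolding open_downsets_def by auto

lemma ClopDown_Int: "U \<in> ClopDown X \<Longrightarrow> V \<in> ClopDown X \<Longrightarrow> U \<inter> V \<in> ClopDown X"
  unfolding ClopDown_def clopen_in_def by auto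

lemma ClopDown_Un: "U \<in> ClopDown X \<Longrightarrow> V \<in> ClopDown X \<Longrightarrow> U \<union> V \<in> ClopDown X"
  unfolding ClopDown_def clopen_in_def by auto

lemma ClopDown_empty: "{} \<in> ClopDown X"
  unfolding ClopDown_def clopen_in_def by simp

text \<open>A point \<open>x\<close> of an open downset \<open>W\<close> is not above any point of the closed set of points outside
  \<open>W\<close>, so a clopen upset contains that set but not \<open>x\<close>.\<close>

lemma open_downset_Union_ClopDown:
  assumes X: "priestley_space X" and W: "W \<in> open_downsets X"
  shows "\<Union>{V \<in> ClopDown X. V \<subseteq> W} = W"
proof
  show "W \<subseteq> \<Union>{V \<in> ClopDown X. V \<subseteq> W}"
  proof
    fix x assume x: "x \<in> W"
    have sub: "W \<subseteq> points X" using W by (rule open_downsets_subset)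
    have W_open: "openin (topol X) W" using W unfolding open_downsets_def by blast
    have "\<exists>U\<in>ClopUp X. points X - W \<subseteq> U \<and> x \<notin> U"
    proof (rule compact_point_separation)
      show "compact_space (topol X)" using X by (rule priestley_compact)
      show "closedin (topol X) (points X - W)" using W_open unfolding points_def by blast
      fix z assume z: "z \<in> points X - W"
      then have "(z, x) \<notin> leq X" using x W unfolding open_downsets_def by auto
      then show "\<exists>U\<in>ClopUp X. z \<in> U \<and> x \<notin> U" using z x sub priestley_separation[OF X] by blast
    qed (simp_all add: ClopUp_clopen ClopUp_empty ClopUp_Un)
    then obtain U where U: "U \<in> ClopUp X" "points X - W \<subseteq> U" "x \<notin> U" by blast
    have "points X - U \<in> ClopDown X"
      unfolding ClopDown_iff[OF X] using U(1) ClopUp_subset[OF U(1)] by (simp add: double_diff)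
    then show "x \<in> \<Union>{V \<in> ClopDown X. V \<subseteq> W}" using U x sub by blast
  qed
qed blast

text \<open>An open downset is determined by the clopen downsets inside it.\<close>

lemma open_downsets_lepoll:
  assumes "priestley_space X"
  shows "open_downsets X \<lesssim> Pow (ClopUp X)"
proof -
  let ?f = "\<lambda>W. (\<lambda>V. points X - V) ` {V \<in> ClopDown X. V \<subseteq> W}"
  have sub: "W \<subseteq> W'" if W: "W \<in> open_downsets X" and eq: "?f W = ?f W'" for W W'
  proof
    fix x assume "x \<in> W"
    then obtain V where V: "V \<in> ClopDown X" "V \<subseteq> W" "x \<in> V"
      using open_downset_Union_ClopDown[OF assms W] by blast
    then have "points X - V \<in> ?f W" by blast
    then have "points X - V \<in> ?f W'" unfolding eq .
    then obtain V' where "V' \<in> ClopDown X" "V' \<subseteq> W'" "points X - V = points X - V'" by blast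
    then have "V' = V" using V(1) ClopDown_iff[OF assms] by (metis double_diff subset_refl)
    with \<open>V' \<subseteq> W'\<close> V(3) show "x \<in> W'" by blast
  qed
  have "inj_on ?f (open_downsets X)"
  proof (rule inj_onI)
    fix W W' assume W: "W \<in> open_downsets X" "W' \<in> open_downsets X" and eq: "?f W = ?f W'"
    show "W = W'" using sub[OF W(1) eq] sub[OF W(2) eq[symmetric]] by (rule subset_antisym)
  qed
  moreover have "?f W \<subseteq> ClopUp X" for W using ClopDown_iff[OF assms] by auto
  then have "?f ` open_downsets X \<subseteq> Pow (ClopUp X)" by auto
  ultimately show ?thesis unfolding lepoll_def by blast
qed

text \<open>As in \<open>prime_filter_space\<close>, the elements of the frame only code the sets that they stand for.\<close>

locale open_downset_frame =
  fixes X :: "'v ordered_space" and A :: "'v set" and k :: "'v \<Rightarrow> 'v set"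
  assumes priestley: "priestley_space X" and k: "bij_betw k A (open_downsets X)"
begin

definition downset_frame :: "'v gorder" where
  "downset_frame = \<lparr>carrier = A, eq = (=), le = (\<lambda>a b. k a \<subseteq> k b)\<rparr>"

definition element :: "'v set \<Rightarrow> 'v" where
  "element = inv_into A k"

lemma downset_frame_simps [simp]:
  "carrier downset_frame = A" "a \<sqsubseteq>\<^bsub>downset_frame\<^esub> b \<longleftrightarrow> k a \<subseteq> k b"
  unfolding downset_frame_def by simp_all

lemma k_open_downset: "a \<in> A \<Longrightarrow> k a \<in> open_downsets X"
  using bij_betw_apply[OF k] .

lemma element_closed [simp]: "W \<in> open_downsets X \<Longrightarrow> element W \<in> A"
  unfolding element_def using bij_betw_apply[OF bij_betw_inv_into[OF k]] .

lemma k_element [simp]: "W \<in> open_downsets X \<Longrightarrow> k (element W) = W"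
  unfolding element_def using k by (simp add: bij_betw_inv_into_right)

lemma k_eqD: "a \<in> A \<Longrightarrow> b \<in> A \<Longrightarrow> k a = k b \<Longrightarrow> a = b"
  using bij_betw_imp_inj_on[OF k] by (auto dest: inj_onD)

lemma partial_order_downset_frame: "partial_order downset_frame"
  unfolding downset_frame_def by (rule partial_order_record) (auto intro: k_eqD)

lemma Union_closed: "S \<subseteq> A \<Longrightarrow> \<Union>(k ` S) \<in> open_downsets X"
  using k_open_downset by (intro open_downsets_Union) blast

lemma sup_downset_frame: "S \<subseteq> A \<Longrightarrow> \<Squnion>\<^bsub>downset_frame\<^esub>S = element (\<Union>(k ` S))"
  by (rule partial_order.sup_eqI[OF partial_order_downset_frame]) (auto simp: Union_closed)

lemma sup_in_A: "S \<subseteq> A \<Longrightarrow> \<Squnion>\<^bsub>downset_frame\<^esub>S \<in> A"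
  by (simp add: sup_downset_frame Union_closed)

lemma k_sup: "S \<subseteq> A \<Longrightarrow> k (\<Squnion>\<^bsub>downset_frame\<^esub>S) = \<Union>(k ` S)"
  by (simp add: sup_downset_frame Union_closed)

lemma complete_lattice_downset_frame: "complete_lattice downset_frame"
proof (rule partial_order.complete_latticeI[OF partial_order_downset_frame])
  fix S assume S: "S \<subseteq> carrier downset_frame"
  have "least downset_frame (element (\<Union>(k ` S))) (Upper downset_frame S)"
    using S unfolding least_def Upper_def by (auto simp: Union_closed)
  then show "\<exists>s. least downset_frame s (Upper downset_frame S)" ..
  let ?W = "\<Union>{W \<in> open_downsets X. \<forall>a\<in>S. W \<subseteq> k a}"
  have W: "?W \<in> open_downsets X" by (rule open_downsets_Union) blast
  have "greatest downset_frame (element ?W) (Lower downset_frame S)"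
    unfolding greatest_def Lower_def
  proof (intro conjI ballI)
    show "element ?W \<in> {l. \<forall>x. x \<in> S \<inter> carrier downset_frame \<longrightarrow> l \<sqsubseteq>\<^bsub>downset_frame\<^esub> x} \<inter> carrier downset_frame"
      using W by auto
    fix b assume "b \<in> {l. \<forall>x. x \<in> S \<inter> carrier downset_frame \<longrightarrow> l \<sqsubseteq>\<^bsub>downset_frame\<^esub> x} \<inter> carrier downset_frame"
    then have "k b \<in> {W \<in> open_downsets X. \<forall>a\<in>S. W \<subseteq> k a}" using S k_open_downset by auto
    then have "k b \<subseteq> ?W" by (rule Union_upper)
    with W show "b \<sqsubseteq>\<^bsub>downset_frame\<^esub> element ?W" by simp
  qed auto
  then show "\<exists>i. greatest downset_frame i (Lower downset_frame S)" ..
qed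

lemma meet_downset_frame: "a \<in> A \<Longrightarrow> b \<in> A \<Longrightarrow> a \<sqinter>\<^bsub>downset_frame\<^esub> b = element (k a \<inter> k b)"
  by (rule partial_order.meet_eqI[OF partial_order_downset_frame])
    (simp_all add: k_open_downset open_downsets_Int)

lemma frame_downset_frame: "frame downset_frame"
proof (intro frame.intro frame_axioms.intro)
  show "complete_lattice downset_frame" by (rule complete_lattice_downset_frame)
  fix a S assume "a \<in> carrier downset_frame" "S \<subseteq> carrier downset_frame"
  then have a: "a \<in> A" and S: "S \<subseteq> A" by simp_all
  have meet: "k (a \<sqinter>\<^bsub>downset_frame\<^esub> s) = k a \<inter> k s" "a \<sqinter>\<^bsub>downset_frame\<^esub> s \<in> A" if "s \<in> A" for s
    using a that by (simp_all add: meet_downset_frame k_open_downset open_downsets_Int)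
  have sub: "(\<lambda>s. a \<sqinter>\<^bsub>downset_frame\<^esub> s) ` S \<subseteq> A" using meet(2) S by blast
  have sup: "\<Squnion>\<^bsub>downset_frame\<^esub>S \<in> A" using S by (rule sup_in_A)
  have "k (\<Squnion>\<^bsub>downset_frame\<^esub>((\<lambda>s. a \<sqinter>\<^bsub>downset_frame\<^esub> s) ` S)) = \<Union>((\<lambda>s. k a \<inter> k s) ` S)"
    unfolding k_sup[OF sub] image_image using S meet(1) by (intro arg_cong[where f = Union] image_cong) auto
  also have "\<dots> = k (a \<sqinter>\<^bsub>downset_frame\<^esub> \<Squnion>\<^bsub>downset_frame\<^esub>S)"
    unfolding meet(1)[OF sup] k_sup[OF S] by simp
  finally show "a \<sqinter>\<^bsub>downset_frame\<^esub> \<Squnion>\<^bsub>downset_frame\<^esub>S =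
      \<Squnion>\<^bsub>downset_frame\<^esub>((\<lambda>s. a \<sqinter>\<^bsub>downset_frame\<^esub> s) ` S)"
    using meet(2)[OF sup] sup_in_A[OF sub] by (intro k_eqD) simp_all
qed

lemma Union_ClopDown_below:
  assumes "a \<in> A"
  shows "element ` {V \<in> ClopDown X. V \<subseteq> k a} \<subseteq> A"
    and "\<Squnion>\<^bsub>downset_frame\<^esub>(element ` {V \<in> ClopDown X. V \<subseteq> k a}) = a"
proof -
  have V: "V \<in> ClopDown X \<Longrightarrow> V \<in> open_downsets X" for V using ClopDown_open_downsets by blast
  then show sub: "element ` {V \<in> ClopDown X. V \<subseteq> k a} \<subseteq> A" by auto
  have "k ` element ` {V \<in> ClopDown X. V \<subseteq> k a} = {V \<in> ClopDown X. V \<subseteq> k a}"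
    unfolding image_image using V by simp
  then have "k (\<Squnion>\<^bsub>downset_frame\<^esub>(element ` {V \<in> ClopDown X. V \<subseteq> k a})) = k a"
    unfolding k_sup[OF sub]
    using open_downset_Union_ClopDown[OF priestley k_open_downset[OF assms]] by simp
  then show "\<Squnion>\<^bsub>downset_frame\<^esub>(element ` {V \<in> ClopDown X. V \<subseteq> k a}) = a"
    using assms sup_in_A[OF sub] by (intro k_eqD) simp_all
qed

text \<open>Clopen sets are topologically compact.  Conversely a compact element, being the union of the
  clopen downsets inside it, is a union of finitely many of them.\<close>

lemma compact_elements_downset_frame: "compact_elements downset_frame = {a \<in> A. k a \<in> ClopDown X}"
proof (intro subset_antisym subsetI)
  fix a assume a: "a \<in> compact_elements downset_frame"
  then have aA: "a \<in> A" unfolding compact_elements_def by simp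
  let ?S = "element ` {V \<in> ClopDown X. V \<subseteq> k a}"
  have "\<exists>F\<subseteq>?S. finite F \<and> a \<sqsubseteq>\<^bsub>downset_frame\<^esub> \<Squnion>\<^bsub>downset_frame\<^esub>F"
  proof -
    have "?S \<subseteq> carrier downset_frame" "a \<sqsubseteq>\<^bsub>downset_frame\<^esub> \<Squnion>\<^bsub>downset_frame\<^esub>?S"
      using Union_ClopDown_below[OF aA] by simp_all
    then show ?thesis using a unfolding compact_elements_def by blast
  qed
  then obtain F where F: "F \<subseteq> ?S" "finite F" "k a \<subseteq> k (\<Squnion>\<^bsub>downset_frame\<^esub>F)" by auto
  have FA: "F \<subseteq> A" using F(1) Union_ClopDown_below(1)[OF aA] by blast
  have kF: "k c \<in> ClopDown X \<and> k c \<subseteq> k a" if c: "c \<in> F" for c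
  proof -
    obtain V where "V \<in> ClopDown X" "V \<subseteq> k a" "c = element V" using F(1) c by blast
    moreover from this have "k c = V" using ClopDown_open_downsets[of X] by (simp add: subset_iff)
    ultimately show ?thesis by simp
  qed
  have "k a = \<Union>(k ` F)" using F(3) kF unfolding k_sup[OF FA] by blast
  moreover have "\<Union>(k ` F) \<in> ClopDown X"
    using F(2) kF by (intro finite_Union_closed) (auto simp: ClopDown_empty ClopDown_Un)
  ultimately show "a \<in> {a \<in> A. k a \<in> ClopDown X}" using aA by simp
next
  fix a assume a: "a \<in> {a \<in> A. k a \<in> ClopDown X}"
  have "\<exists>F\<subseteq>S. finite F \<and> a \<sqsubseteq>\<^bsub>downset_frame\<^esub> \<Squnion>\<^bsub>downset_frame\<^esub>F"
    if S: "S \<subseteq> carrier downset_frame" and le: "a \<sqsubseteq>\<^bsub>downset_frame\<^esub> \<Squnion>\<^bsub>downset_frame\<^esub>S" for S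
  proof -
    have SA: "S \<subseteq> A" using S by simp
    have "closedin (topol X) (k a)" using a unfolding ClopDown_def clopen_in_def by blast
    then have "compactin (topol X) (k a)"
      by (rule closedin_compact_space[OF priestley_compact[OF priestley]])
    moreover have "openin (topol X) U" if "U \<in> k ` S" for U
      using that SA k_open_downset unfolding open_downsets_def by blast
    moreover have "k a \<subseteq> \<Union>(k ` S)" using le by (simp add: k_sup[OF SA])
    ultimately obtain \<F> where "finite \<F>" "\<F> \<subseteq> k ` S" "k a \<subseteq> \<Union>\<F>"
      using compactinD[of "topol X" "k a" "k ` S"] by blast
    then obtain F where F: "F \<subseteq> S" "finite F" "k a \<subseteq> \<Union>(k ` F)" by (metis finite_subset_image)
    then have "F \<subseteq> A" using SA by blast
    with F(3) have "a \<sqsubseteq>\<^bsub>downset_frame\<^esub> \<Squnion>\<^bsub>downset_frame\<^esub>F" by (simp add: k_sup)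
    with F(1,2) show ?thesis by blast
  qed
  then show "a \<in> compact_elements downset_frame" using a unfolding compact_elements_def by simp
qed

lemma coherent_frame_downset_frame: "coherent_frame downset_frame"
proof (intro coherent_frame.intro coherent_frame_axioms.intro)
  show "frame downset_frame" by (rule frame_downset_frame)
next
  fix a assume "a \<in> carrier downset_frame"
  then have a: "a \<in> A" by simp
  let ?S = "element ` {V \<in> ClopDown X. V \<subseteq> k a}"
  have "?S \<subseteq> compact_elements downset_frame"
    unfolding compact_elements_downset_frame
    using ClopDown_open_downsets[of X] by (auto simp: subset_iff)
  moreover have "a = \<Squnion>\<^bsub>downset_frame\<^esub>?S" using Union_ClopDown_below(2)[OF a] by simp
  ultimately show "\<exists>S\<subseteq>compact_elements downset_frame. a = \<Squnion>\<^bsub>downset_frame\<^esub>S" by blast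
next
  fix F assume F: "finite F" "F \<subseteq> compact_elements downset_frame"
  let ?W = "points X \<inter> \<Inter>(k ` F)"
  have FA: "F \<subseteq> A" and kF: "k ` F \<subseteq> ClopDown X"
    using F(2) unfolding compact_elements_downset_frame by blast+
  have "points X \<in> ClopDown X" unfolding ClopDown_iff[OF priestley] by (simp add: ClopUp_empty)
  then have W: "?W \<in> ClopDown X"
    using F(1) kF by (intro finite_Inter_closed) (simp_all add: ClopDown_Int)
  then have W': "?W \<in> open_downsets X" using ClopDown_open_downsets by blast
  have "\<Sqinter>\<^bsub>downset_frame\<^esub>F = element ?W"
  proof (rule partial_order.inf_eqI[OF partial_order_downset_frame])
    show "F \<subseteq> carrier downset_frame" "element ?W \<in> carrier downset_frame" using FA W' by simp_all
    show "element ?W \<sqsubseteq>\<^bsub>downset_frame\<^esub> c" if "c \<in> F" for c using that W' by auto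
    fix w assume "w \<in> carrier downset_frame" "\<And>c. c \<in> F \<Longrightarrow> w \<sqsubseteq>\<^bsub>downset_frame\<^esub> c"
    then show "w \<sqsubseteq>\<^bsub>downset_frame\<^esub> element ?W"
      using W' open_downsets_subset[OF k_open_downset[of w]] by auto
  qed
  then show "\<Sqinter>\<^bsub>downset_frame\<^esub>F \<in> compact_elements downset_frame"
    unfolding compact_elements_downset_frame using W W' by simp
qed

text \<open>Complementation turns clopen upsets into clopen downsets and reverses inclusion, and so does
  \<open>compact_dual\<close> with the order of the frame.\<close>

lemma order_iso_compact_dual:
  assumes \<phi>: "bij_betw \<phi> (carrier D) (ClopUp X)"
    and le: "\<And>a b. \<lbrakk>a \<in> carrier D; b \<in> carrier D\<rbrakk> \<Longrightarrow> \<phi> a \<subseteq> \<phi> b \<longleftrightarrow> a \<sqsubseteq>\<^bsub>D\<^esub> b"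
  shows "order_iso D (compact_dual downset_frame) (\<lambda>d. element (points X - \<phi> d))"
proof -
  have \<phi>_ClopUp: "\<phi> d \<in> ClopUp X" if "d \<in> carrier D" for d using \<phi> that by (rule bij_betw_apply)
  have "bij_betw (\<lambda>d. points X - \<phi> d) (carrier D) (ClopDown X)"
  proof (rule bij_betw_trans[OF \<phi>, of "\<lambda>U. points X - U", unfolded comp_def])
    show "bij_betw (\<lambda>U. points X - U) (ClopUp X) (ClopDown X)"
    proof (rule bij_betw_byWitness[where f' = "\<lambda>V. points X - V"])
      show "\<forall>U\<in>ClopUp X. points X - (points X - U) = U" by (auto dest: ClopUp_subset[THEN subsetD])
      then show "(\<lambda>U. points X - U) ` ClopUp X \<subseteq> ClopDown X"
        by (simp add: image_subset_iff ClopDown_iff[OF priestley])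
      show "\<forall>V\<in>ClopDown X. points X - (points X - V) = V"
        using ClopDown_iff[OF priestley] by auto
      show "(\<lambda>V. points X - V) ` ClopDown X \<subseteq> ClopUp X" using ClopDown_iff[OF priestley] by blast
    qed
  qed
  moreover have "bij_betw element (ClopDown X) {a \<in> A. k a \<in> ClopDown X}"
  proof (rule bij_betw_byWitness[where f' = k])
    show "\<forall>V\<in>ClopDown X. k (element V) = V" "element ` ClopDown X \<subseteq> {a \<in> A. k a \<in> ClopDown X}"
      using ClopDown_open_downsets[of X] by (auto simp: subset_iff)
    show "\<forall>a\<in>{a \<in> A. k a \<in> ClopDown X}. element (k a) = a"
      using k_open_downset by (auto intro!: k_eqD)
    show "k ` {a \<in> A. k a \<in> ClopDown X} \<subseteq> ClopDown X" by blast
  qed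
  ultimately have "bij_betw (element \<circ> (\<lambda>d. points X - \<phi> d)) (carrier D) (compact_elements downset_frame)"
    unfolding compact_elements_downset_frame by (rule bij_betw_trans)
  moreover have "k (element (points X - \<phi> d)) = points X - \<phi> d" if "d \<in> carrier D" for d
  proof -
    have "points X - \<phi> d \<in> ClopDown X"
      unfolding ClopDown_iff[OF priestley] using \<phi>_ClopUp[OF that] ClopUp_subset[of "\<phi> d" X]
      by (simp add: double_diff)
    then show ?thesis using ClopDown_open_downsets[of X] by (simp add: subset_iff)
  qed
  moreover have "points X - \<phi> b \<subseteq> points X - \<phi> a \<longleftrightarrow> a \<sqsubseteq>\<^bsub>D\<^esub> b"
    if "a \<in> carrier D" "b \<in> carrier D" for a b
    using le[OF that] ClopUp_subset[OF \<phi>_ClopUp[OF that(1)]] by blast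
  ultimately show ?thesis unfolding order_iso_def comp_def by simp
qed

end

text \<open>The frame consists of the open downsets of the Priestley space of \<open>D\<close>; its compact elements are
  the complements of the clopen upsets.\<close>

theorem coherent_frame_representation:
  fixes D :: "'v gorder"
  assumes D: "bounded_distrib_lattice D" and "Pow (carrier D) \<lesssim> (UNIV :: 'v set)"
  obtains L :: "'v gorder" and f where "coherent_frame L" "order_iso D (compact_dual L) f"
proof -
  obtain X :: "'v ordered_space" and \<phi> where X: "priestley_space X"
    and \<phi>: "bij_betw \<phi> (carrier D) (ClopUp X)"
    and le: "\<And>a b. \<lbrakk>a \<in> carrier D; b \<in> carrier D\<rbrakk> \<Longrightarrow> \<phi> a \<subseteq> \<phi> b \<longleftrightarrow> a \<sqsubseteq>\<^bsub>D\<^esub> b"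
    using priestley_representation[OF assms] by blast
  have "Pow (ClopUp X) \<lesssim> Pow (carrier D)"
    using bij_betw_inv_into[OF \<phi>] bij_betw_Pow unfolding lepoll_def
    by (metis bij_betw_def order_refl)
  then have "open_downsets X \<lesssim> (UNIV :: 'v set)"
    using open_downsets_lepoll[OF X] assms(2) by (meson lepoll_trans)
  then obtain j :: "'v set \<Rightarrow> 'v" where "inj_on j (open_downsets X)" unfolding lepoll_def by blast
  then have "bij_betw (inv_into (open_downsets X) j) (j ` open_downsets X) (open_downsets X)"
    by (intro bij_betw_inv_into inj_on_imp_bij_betw)
  with X interpret open_downset_frame X "j ` open_downsets X" "inv_into (open_downsets X) j"
    by unfold_locales
  show ?thesis
    using that coherent_frame_downset_frame order_iso_compact_dual[OF \<phi> le] by blast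
qed

section \<open>The equivalences\<close>

text \<open>Prime filters and open downsets are given by subsets of a small set; this makes room for
  them in \<open>'v\<close>.\<close>

lemma size_class_Pow_lepoll:
  fixes \<K> :: "'v set set"
  assumes "size_class \<K>" "small \<K> A"
  shows "Pow A \<lesssim> (UNIV :: 'v set)"
proof -
  obtain B g where B: "B \<in> \<K>" and g: "inj_on g A" "g ` A \<subseteq> B"
    using assms(2) unfolding small_def lepoll_def by blast
  have "(`) g ` Pow A \<subseteq> Pow B" using g(2) by blast
  with inj_on_image_Pow[OF g(1)] have "Pow A \<lesssim> Pow B" unfolding lepoll_def by blast
  moreover have "Pow B \<lesssim> (UNIV :: 'v set)" using assms(1) B unfolding size_class_def by blast
  ultimately show ?thesis by (rule lepoll_trans)
qed

lemma lepoll_Pow: "A \<lesssim> Pow A"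
  unfolding lepoll_def by (intro exI[of _ "\<lambda>x. {x}"]) (auto intro: inj_onI)

lemma small_if_bij_betw: "bij_betw f A B \<Longrightarrow> small \<K> A \<Longrightarrow> small \<K> B"
  using small_mono eqpoll_imp_lepoll eqpoll_sym unfolding eqpoll_def by metis

lemma id_Hom_Sup:
  assumes "coherent_frame L"
  shows "(\<lambda>x\<in>carrier L. x) \<in> Hom_Sup L L"
proof -
  interpret coherent_frame L by fact
  have "(\<lambda>x\<in>carrier L. x) (\<Squnion>\<^bsub>L\<^esub>S) = \<Squnion>\<^bsub>L\<^esub>((\<lambda>x\<in>carrier L. x) ` S)" if "S \<subseteq> carrier L" for S
  proof -
    have "(\<lambda>x\<in>carrier L. x) ` S = S" using that by force
    then show ?thesis using that by simp
  qed
  then have "sup_pres L L (\<lambda>x\<in>carrier L. x)"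
    unfolding sup_pres_def using complete_lattice_axioms by presburger
  then show ?thesis unfolding Hom_Sup_def by (simp add: image_subset_iff compact_closed)
qed

lemma compose_Hom_Sup:
  assumes \<alpha>: "\<alpha> \<in> Hom_Sup L M" and \<beta>: "\<beta> \<in> Hom_Sup M N"
  shows "compose (carrier L) \<beta> \<alpha> \<in> Hom_Sup L N"
proof -
  interpret L: complete_lattice L using \<alpha> unfolding Hom_Sup_def sup_pres_def by blast
  have \<alpha>_closed: "\<alpha> x \<in> carrier M" if "x \<in> carrier L" for x
    using \<alpha> that unfolding Hom_Sup_def by blast
  have \<beta>_closed: "\<beta> x \<in> carrier N" if "x \<in> carrier M" for x
    using \<beta> that unfolding Hom_Sup_def by blast
  have "compose (carrier L) \<beta> \<alpha> (\<Squnion>\<^bsub>L\<^esub>S) = \<Squnion>\<^bsub>N\<^esub>(compose (carrier L) \<beta> \<alpha> ` S)"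
    if S: "S \<subseteq> carrier L" for S
  proof -
    have "\<alpha> ` S \<subseteq> carrier M" using S \<alpha>_closed by blast
    then have "\<beta> (\<alpha> (\<Squnion>\<^bsub>L\<^esub>S)) = \<Squnion>\<^bsub>N\<^esub>(\<beta> ` \<alpha> ` S)"
      using \<alpha> \<beta> S unfolding Hom_Sup_def sup_pres_def by simp
    moreover have "compose (carrier L) \<beta> \<alpha> ` S = \<beta> ` \<alpha> ` S"
      unfolding image_image using S by (intro image_cong) (auto simp: compose_eq)
    ultimately show ?thesis using S by (simp add: compose_eq)
  qed
  moreover have "compose (carrier L) \<beta> \<alpha> c \<in> compact_elements N" if "c \<in> compact_elements L" for c
  proof -
    have "c \<in> carrier L" using that unfolding compact_elements_def by blast
    moreover have "\<beta> (\<alpha> c) \<in> compact_elements N" using \<alpha> \<beta> that unfolding Hom_Sup_def by blast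
    ultimately show ?thesis by (simp add: compose_eq)
  qed
  moreover have "compose (carrier L) \<beta> \<alpha> \<in> carrier L \<rightarrow>\<^sub>E carrier N"
    using \<alpha>_closed \<beta>_closed by (simp add: PiE_iff compose_eq)
  ultimately show ?thesis
    using \<alpha> \<beta> unfolding Hom_Sup_def sup_pres_def by (simp add: image_subset_iff)
qed

definition compact_functor :: "('a gorder, 'a \<Rightarrow> 'a, 'a gorder, 'a \<Rightarrow> 'a) func" where
  "compact_functor = \<lparr>on_Ob = compact_dual, on_Hom = (\<lambda>L M \<alpha>. restrict \<alpha> (compact_elements L))\<rparr>"

lemma restrict_compose_compact:
  assumes "\<alpha> \<in> Hom_Sup L M"
  shows "restrict (compose (carrier L) \<beta> \<alpha>) (compact_elements L) =
    compose (compact_elements L) (restrict \<beta> (compact_elements M)) (restrict \<alpha> (compact_elements L))"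
proof
  fix c
  have "c \<in> compact_elements L \<Longrightarrow> c \<in> carrier L" unfolding compact_elements_def by blast
  moreover have "c \<in> compact_elements L \<Longrightarrow> \<alpha> c \<in> compact_elements M"
    using assms unfolding Hom_Sup_def by blast
  ultimately show "restrict (compose (carrier L) \<beta> \<alpha>) (compact_elements L) c =
      compose (compact_elements L) (restrict \<beta> (compact_elements M)) (restrict \<alpha> (compact_elements L)) c"
    by (simp add: compose_def)
qed

lemma carrier_Int_compact: "carrier L \<inter> compact_elements L = compact_elements L"
  unfolding compact_elements_def by auto

lemma compact_functor_surj:
  fixes \<K> :: "'v set set"
  assumes \<K>: "size_class \<K>" and D: "bounded_distrib_lattice D" "small \<K> (carrier D)"
  obtains L :: "'v gorder" where "coherent_frame L" "small \<K> (compact_elements L)"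
    "\<exists>f. is_iso (DL_M \<K>) (compact_dual L) D f" "\<exists>f. is_iso (DL_L \<K>) (compact_dual L) D f"
proof -
  obtain L :: "'v gorder" and f where L: "coherent_frame L" and f: "order_iso D (compact_dual L) f"
    using coherent_frame_representation[OF D(1) size_class_Pow_lepoll[OF \<K> D(2)]] .
  interpret L: coherent_frame L by fact
  have "bij_betw f (carrier D) (compact_elements L)" using f unfolding order_iso_def by simp
  then have small: "small \<K> (compact_elements L)" using D(2) by (rule small_if_bij_betw)
  note iso = is_iso_order_iso[OF L.bounded_distrib_lattice_compact_dual D(1) order_iso_inverse[OF f]]
  show ?thesis by (rule that[OF L small]; rule exI; rule iso)
qed

lemma weak_equivalence_CohFrm_Sup:
  fixes \<K> :: "'v set set"
  assumes \<K>: "size_class \<K>"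
  shows "weak_equivalence (CohFrm_Sup \<K>) (DL_M \<K>) compact_functor"
proof (rule weak_equivalenceI)
  show "category (DL_M \<K>)" by (rule category_DL_M)
  show "is_functor (CohFrm_Sup \<K>) (DL_M \<K>) compact_functor"
    unfolding is_functor_def CohFrm_Sup_def DL_M_def compact_functor_def
    by (simp add: coherent_frame.bounded_distrib_lattice_compact_dual carrier_Int_compact
        restrict_compose_compact coherent_frame_pair.restrict_Hom_Sup coherent_frame_pair_def)
next
  fix L assume "L \<in> Ob (CohFrm_Sup \<K>)"
  then show "Idn (CohFrm_Sup \<K>) L \<in> Hom (CohFrm_Sup \<K>) L L"
    unfolding CohFrm_Sup_def by (simp add: id_Hom_Sup)
next
  fix L M N \<alpha> \<beta> assume "\<alpha> \<in> Hom (CohFrm_Sup \<K>) L M" "\<beta> \<in> Hom (CohFrm_Sup \<K>) M N"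
  then show "Comp (CohFrm_Sup \<K>) L M N \<beta> \<alpha> \<in> Hom (CohFrm_Sup \<K>) L N"
    unfolding CohFrm_Sup_def by (simp add: compose_Hom_Sup)
next
  fix L M assume "L \<in> Ob (CohFrm_Sup \<K>)" "M \<in> Ob (CohFrm_Sup \<K>)"
  then have "coherent_frame_pair L M" unfolding CohFrm_Sup_def coherent_frame_pair_def by simp
  then show "bij_betw (on_Hom compact_functor L M) (Hom (CohFrm_Sup \<K>) L M)
      (Hom (DL_M \<K>) (on_Ob compact_functor L) (on_Ob compact_functor M))"
    using coherent_frame_pair.bij_betw_restrict_compact
    unfolding CohFrm_Sup_def DL_M_def compact_functor_def by simp
next
  fix D assume "D \<in> Ob (DL_M \<K>)"
  then have "bounded_distrib_lattice D" "small \<K> (carrier D)" unfolding DL_M_def by simp_all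
  then obtain L :: "'v gorder" where "coherent_frame L" "small \<K> (compact_elements L)"
    "\<exists>f. is_iso (DL_M \<K>) (compact_dual L) D f" "\<exists>f. is_iso (DL_L \<K>) (compact_dual L) D f"
    by (rule compact_functor_surj[OF \<K>])
  then show "\<exists>L\<in>Ob (CohFrm_Sup \<K>). \<exists>f. is_iso (DL_M \<K>) (on_Ob compact_functor L) D f"
    unfolding CohFrm_Sup_def compact_functor_def by auto
qed

text \<open>The functor of \<open>weak_equivalence_CohFrm_Sup\<close> restricts, because by \<open>Hom_FInf_iff\<close> it maps exactly
  the arrows of \<open>CohFrm_FInf\<close> to those of \<open>DL_L\<close>.\<close>

lemma weak_equivalence_CohFrm_FInf:
  fixes \<K> :: "'v set set"
  assumes \<K>: "size_class \<K>"
  shows "weak_equivalence (CohFrm_FInf \<K>) (DL_L \<K>) compact_functor"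
proof -
  have pair: "coherent_frame_pair L M"
    if "L \<in> Ob (CohFrm_FInf \<K>)" "M \<in> Ob (CohFrm_FInf \<K>)" for L M
    using that unfolding CohFrm_FInf_def coherent_frame_pair_def by simp
  have FInf_iff: "\<alpha> \<in> Hom_FInf L M \<longleftrightarrow> \<alpha> \<in> Hom_Sup L M \<and>
      restrict \<alpha> (compact_elements L) \<in> Hom_L (compact_dual L) (compact_dual M)"
    if "L \<in> Ob (CohFrm_FInf \<K>)" "M \<in> Ob (CohFrm_FInf \<K>)" for L M \<alpha>
    using coherent_frame_pair.Hom_FInf_iff[OF pair[OF that]] unfolding Hom_FInf_def by blast
  have bdl: "bounded_distrib_lattice (compact_dual L)" if "L \<in> Ob (CohFrm_FInf \<K>)" for L
    using that coherent_frame.bounded_distrib_lattice_compact_dual[of L] unfolding CohFrm_FInf_def by simp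
  have compact_dual_Ob: "compact_dual L \<in> Ob (DL_L \<K>)" if "L \<in> Ob (CohFrm_FInf \<K>)" for L
    using that bdl[OF that] unfolding CohFrm_FInf_def DL_L_def by simp
  interpret DL_L: category "DL_L \<K>" by (rule category_DL_L)
  have idn: "Idn (CohFrm_FInf \<K>) L \<in> Hom_FInf L L" if L: "L \<in> Ob (CohFrm_FInf \<K>)" for L
  proof -
    have "(\<lambda>x\<in>carrier L. x) \<in> Hom_Sup L L"
      using L id_Hom_Sup[of L] unfolding CohFrm_FInf_def by simp
    moreover have "(\<lambda>x\<in>compact_elements L. x) \<in> Hom_L (compact_dual L) (compact_dual L)"
      using DL_L.Idn_in_Hom[OF compact_dual_Ob[OF L]] unfolding DL_L_def by simp
    ultimately show ?thesis
      unfolding FInf_iff[OF L L] by (simp add: CohFrm_FInf_def carrier_Int_compact)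
  qed
  have comp: "compose (carrier L) \<beta> \<alpha> \<in> Hom_FInf L N"
    if L: "L \<in> Ob (CohFrm_FInf \<K>)" and M: "M \<in> Ob (CohFrm_FInf \<K>)" and N: "N \<in> Ob (CohFrm_FInf \<K>)"
      and "\<alpha> \<in> Hom_FInf L M" "\<beta> \<in> Hom_FInf M N" for L M N \<alpha> \<beta>
  proof -
    have \<alpha>: "\<alpha> \<in> Hom_Sup L M" "restrict \<alpha> (compact_elements L) \<in> Hom_L (compact_dual L) (compact_dual M)"
      and \<beta>: "\<beta> \<in> Hom_Sup M N" "restrict \<beta> (compact_elements M) \<in> Hom_L (compact_dual M) (compact_dual N)"
      using that FInf_iff[OF L M] FInf_iff[OF M N] by simp_all
    have "compose (compact_elements L) (restrict \<beta> (compact_elements M)) (restrict \<alpha> (compact_elements L))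
        \<in> Hom_L (compact_dual L) (compact_dual N)"
      using DL_L.Comp_in_Hom[OF compact_dual_Ob[OF L] compact_dual_Ob[OF M] compact_dual_Ob[OF N]] \<alpha>(2) \<beta>(2)
      unfolding DL_L_def by simp
    then show ?thesis
      unfolding FInf_iff[OF L N] restrict_compose_compact[OF \<alpha>(1)] using compose_Hom_Sup[OF \<alpha>(1) \<beta>(1)] by simp
  qed
  show ?thesis
  proof (rule weak_equivalenceI)
    show "category (DL_L \<K>)" by (rule category_DL_L)
    show "is_functor (CohFrm_FInf \<K>) (DL_L \<K>) compact_functor"
      unfolding is_functor_def
    proof (intro conjI ballI)
      fix L assume "L \<in> Ob (CohFrm_FInf \<K>)"
      then show "on_Ob compact_functor L \<in> Ob (DL_L \<K>)"
        using compact_dual_Ob unfolding compact_functor_def by simp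
      show "on_Hom compact_functor L L (Idn (CohFrm_FInf \<K>) L) = Idn (DL_L \<K>) (on_Ob compact_functor L)"
        unfolding compact_functor_def CohFrm_FInf_def DL_L_def by (simp add: carrier_Int_compact)
    next
      fix L M \<alpha>
      assume L: "L \<in> Ob (CohFrm_FInf \<K>)" "M \<in> Ob (CohFrm_FInf \<K>)" "\<alpha> \<in> Hom (CohFrm_FInf \<K>) L M"
      then have "\<alpha> \<in> Hom_FInf L M" unfolding CohFrm_FInf_def by simp
      then show "on_Hom compact_functor L M \<alpha> \<in>
          Hom (DL_L \<K>) (on_Ob compact_functor L) (on_Ob compact_functor M)"
        unfolding FInf_iff[OF L(1,2)] by (simp add: compact_functor_def DL_L_def)
      fix N \<beta> assume "\<beta> \<in> Hom (CohFrm_FInf \<K>) M N"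
      have "\<alpha> \<in> Hom_Sup L M" using \<open>\<alpha> \<in> Hom_FInf L M\<close> unfolding Hom_FInf_def by simp
      then show "on_Hom compact_functor L N (Comp (CohFrm_FInf \<K>) L M N \<beta> \<alpha>) =
          Comp (DL_L \<K>) (on_Ob compact_functor L) (on_Ob compact_functor M) (on_Ob compact_functor N)
            (on_Hom compact_functor M N \<beta>) (on_Hom compact_functor L M \<alpha>)"
        unfolding compact_functor_def CohFrm_FInf_def DL_L_def by (simp add: restrict_compose_compact)
    qed
  next
    fix L assume "L \<in> Ob (CohFrm_FInf \<K>)"
    then show "Idn (CohFrm_FInf \<K>) L \<in> Hom (CohFrm_FInf \<K>) L L"
      using idn unfolding CohFrm_FInf_def by simp
  next
    fix L M N \<alpha> \<beta> assume "L \<in> Ob (CohFrm_FInf \<K>)" "M \<in> Ob (CohFrm_FInf \<K>)" "N \<in> Ob (CohFrm_FInf \<K>)"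
      "\<alpha> \<in> Hom (CohFrm_FInf \<K>) L M" "\<beta> \<in> Hom (CohFrm_FInf \<K>) M N"
    then show "Comp (CohFrm_FInf \<K>) L M N \<beta> \<alpha> \<in> Hom (CohFrm_FInf \<K>) L N"
      using comp unfolding CohFrm_FInf_def by simp
  next
    fix L M assume L: "L \<in> Ob (CohFrm_FInf \<K>)" and M: "M \<in> Ob (CohFrm_FInf \<K>)"
    let ?f = "\<lambda>\<alpha>. restrict \<alpha> (compact_elements L)"
    have bij: "bij_betw ?f (Hom_Sup L M) (Hom_M (compact_dual L) (compact_dual M))"
      using pair[OF L M] by (rule coherent_frame_pair.bij_betw_restrict_compact)
    have "?f ` Hom_FInf L M = Hom_L (compact_dual L) (compact_dual M)"
    proof (intro subset_antisym subsetI)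
      fix h assume h: "h \<in> Hom_L (compact_dual L) (compact_dual M)"
      then have "h \<in> ?f ` Hom_Sup L M" using bij_betw_imp_surj_on[OF bij] unfolding Hom_L_def by simp
      then show "h \<in> ?f ` Hom_FInf L M" using h FInf_iff[OF L M] by auto
    qed (use FInf_iff[OF L M] in auto)
    moreover have "inj_on ?f (Hom_FInf L M)"
      using bij_betw_imp_inj_on[OF bij] by (rule inj_on_subset) (auto simp: Hom_FInf_def)
    ultimately show "bij_betw (on_Hom compact_functor L M) (Hom (CohFrm_FInf \<K>) L M)
        (Hom (DL_L \<K>) (on_Ob compact_functor L) (on_Ob compact_functor M))"
      unfolding bij_betw_def CohFrm_FInf_def DL_L_def compact_functor_def by simp
  next
    fix D assume "D \<in> Ob (DL_L \<K>)"
    then have "bounded_distrib_lattice D" "small \<K> (carrier D)" unfolding DL_L_def by simp_all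
    then obtain L :: "'v gorder" where "coherent_frame L" "small \<K> (compact_elements L)"
      "\<exists>f. is_iso (DL_M \<K>) (compact_dual L) D f" "\<exists>f. is_iso (DL_L \<K>) (compact_dual L) D f"
      by (rule compact_functor_surj[OF \<K>])
    then show "\<exists>L\<in>Ob (CohFrm_FInf \<K>). \<exists>f. is_iso (DL_L \<K>) (on_Ob compact_functor L) D f"
      unfolding CohFrm_FInf_def compact_functor_def by auto
  qed
qed

lemma coded_priestley_space_if_small:
  fixes \<K> :: "'v set set" and X :: "'v ordered_space"
  assumes "size_class \<K>" "priestley_space X" "small \<K> (ClopUp X)"
  shows "coded_priestley_space X"
  using assms(2) lepoll_trans[OF lepoll_Pow size_class_Pow_lepoll[OF assms(1,3)]]
  by (rule coded_priestley_space.intro)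

lemma small_clopup_lattice: "small \<K> (ClopUp X) \<Longrightarrow> small \<K> (carrier (clopup_lattice X))"
  using small_mono[OF image_lepoll] by simp

lemma clopup_lattice_surj:
  fixes \<K> :: "'v set set"
  assumes \<K>: "size_class \<K>" and D: "bounded_distrib_lattice D" "small \<K> (carrier D)"
  obtains X where "priestley_space X" "small \<K> (ClopUp X)"
    "\<exists>f. is_iso (DL_M \<K>) D (clopup_lattice X) f" "\<exists>f. is_iso (DL_L \<K>) D (clopup_lattice X) f"
proof -
  obtain X :: "'v ordered_space" and \<phi> where X: "priestley_space X"
    and \<phi>: "bij_betw \<phi> (carrier D) (ClopUp X)"
    and le: "\<And>a b. \<lbrakk>a \<in> carrier D; b \<in> carrier D\<rbrakk> \<Longrightarrow> \<phi> a \<subseteq> \<phi> b \<longleftrightarrow> a \<sqsubseteq>\<^bsub>D\<^esub> b"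
    using priestley_representation[OF D(1) size_class_Pow_lepoll[OF \<K> D(2)]] by blast
  have small: "small \<K> (ClopUp X)" using \<phi> D(2) by (rule small_if_bij_betw)
  interpret X: coded_priestley_space X using \<K> X small by (rule coded_priestley_space_if_small)
  note iso = is_iso_order_iso[OF D(1) X.bounded_distrib_lattice_clopup_lattice
      X.order_iso_clopup_lattice[OF \<phi> le]]
  show ?thesis by (rule that[OF X small]; rule exI; rule iso)
qed

lemma compose_clopup_map:
  assumes "coded_priestley_space X" "coded_priestley_space Y" "coded_priestley_space Z"
    and T: "\<And>U. U \<in> ClopUp Z \<Longrightarrow> T U \<in> ClopUp Y"
  shows "compose (carrier (clopup_lattice Z)) (clopup_map X Y S) (clopup_map Y Z T)
    = clopup_map X Z (\<lambda>U. S (T U))"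
proof -
  interpret Y: coded_priestley_space Y by fact
  interpret Z: coded_priestley_space Z by fact
  show ?thesis
    using T unfolding compose_def clopup_map_def clopup_lattice_simps by (auto intro!: restrict_ext)
qed

lemma clopup_map_cong:
  assumes "coded_priestley_space Y" "\<And>U. U \<in> ClopUp Y \<Longrightarrow> S U = T U"
  shows "clopup_map X Y S = clopup_map X Y T"
proof -
  interpret Y: coded_priestley_space Y by fact
  show ?thesis using assms(2) unfolding clopup_map_def by (auto intro!: restrict_ext)
qed

lemma clopup_map_id:
  assumes "coded_priestley_space X" "\<And>U. U \<in> ClopUp X \<Longrightarrow> T U = U"
  shows "clopup_map X X T = (\<lambda>a\<in>carrier (clopup_lattice X). a)"
proof -
  interpret X: coded_priestley_space X by fact
  show ?thesis
    using assms(2) unfolding clopup_map_def clopup_lattice_simps by (auto intro!: restrict_ext)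
qed

definition box_functor :: "('v ordered_space, ('v \<times> 'v) set, 'v gorder, 'v \<Rightarrow> 'v) func" where
  "box_functor = \<lparr>on_Ob = clopup_lattice, on_Hom = (\<lambda>X Y R. clopup_map X Y (box X R))\<rparr>"

definition pbox_functor :: "('v ordered_space, 'v \<rightharpoonup> 'v, 'v gorder, 'v \<Rightarrow> 'v) func" where
  "pbox_functor = \<lparr>on_Ob = clopup_lattice, on_Hom = (\<lambda>X Y f. clopup_map X Y (pbox X Y f))\<rparr>"

lemma weak_equivalence_PS_R:
  fixes \<K> :: "'v set set"
  assumes \<K>: "size_class \<K>"
  shows "weak_equivalence (PS_R \<K>) (dual_cat (DL_M \<K>)) box_functor"
proof -
  have coded: "coded_priestley_space X" if "X \<in> Ob (PS_R \<K>)" for X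
    using that coded_priestley_space_if_small[OF \<K>] unfolding PS_R_def by simp
  have pair: "coded_priestley_pair X Y" if "X \<in> Ob (PS_R \<K>)" "Y \<in> Ob (PS_R \<K>)" for X Y
    using that coded by (intro coded_priestley_pair.intro)
  have R: "\<And>U. U \<in> ClopUp Y \<Longrightarrow> box X R U \<in> ClopUp X" if "R \<in> Hom_R X Y" for X Y :: "'v ordered_space" and R
    using that unfolding Hom_R_def by blast
  have star: "star_comp X Y Z S R \<in> Hom_R X Z"
    "\<And>U. U \<in> ClopUp Z \<Longrightarrow> box X (star_comp X Y Z S R) U = box X R (box Y S U)"
    if "X \<in> Ob (PS_R \<K>)" "Z \<in> Ob (PS_R \<K>)" "R \<in> Hom_R X Y" "S \<in> Hom_R Y Z" for X Y Z R S
  proof -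
    interpret coded_priestley_pair X Z using pair that by blast
    have "meet_hom X Z (\<lambda>U. box X R (box Y S U))"
      using meet_hom_box[OF that(3)] meet_hom_box[OF that(4)] by (rule meet_hom_comp)
    then show "star_comp X Y Z S R \<in> Hom_R X Z"
      "\<And>U. U \<in> ClopUp Z \<Longrightarrow> box X (star_comp X Y Z S R) U = box X R (box Y S U)"
      unfolding star_comp_rel_of using rel_of_Hom_R box_rel_of by simp_all
  qed
  show ?thesis
  proof (rule weak_equivalenceI)
    show "category (dual_cat (DL_M \<K>))" by (intro category_dual category_DL_M)
    show "is_functor (PS_R \<K>) (dual_cat (DL_M \<K>)) box_functor"
      unfolding is_functor_def
    proof (intro conjI ballI)
      fix X assume X: "X \<in> Ob (PS_R \<K>)"
      then show "on_Ob box_functor X \<in> Ob (dual_cat (DL_M \<K>))"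
        using coded_priestley_space.bounded_distrib_lattice_clopup_lattice[OF coded[OF X]] small_clopup_lattice
        unfolding box_functor_def dual_cat_def DL_M_def PS_R_def by auto
      have "priestley_space X" using X unfolding PS_R_def by simp
      then show "on_Hom box_functor X X (Idn (PS_R \<K>) X) = Idn (dual_cat (DL_M \<K>)) (on_Ob box_functor X)"
        using clopup_map_id[OF coded[OF X] leq_Hom_R(2)]
        unfolding box_functor_def dual_cat_def DL_M_def PS_R_def by simp
    next
      fix X Y R assume XY: "X \<in> Ob (PS_R \<K>)" "Y \<in> Ob (PS_R \<K>)" and "R \<in> Hom (PS_R \<K>) X Y"
      then have R_hom: "R \<in> Hom_R X Y" unfolding PS_R_def by simp
      then show "on_Hom box_functor X Y R \<in> Hom (dual_cat (DL_M \<K>)) (on_Ob box_functor X) (on_Ob box_functor Y)"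
        using coded_priestley_pair.clopup_map_Hom_M[OF pair[OF XY] meet_hom_box]
        unfolding box_functor_def dual_cat_def DL_M_def by simp
      fix Z S assume Z: "Z \<in> Ob (PS_R \<K>)" and "S \<in> Hom (PS_R \<K>) Y Z"
      then have S_hom: "S \<in> Hom_R Y Z" unfolding PS_R_def by simp
      have "clopup_map X Z (box X (star_comp X Y Z S R)) = clopup_map X Z (\<lambda>U. box X R (box Y S U))"
        using star(2)[OF XY(1) Z R_hom S_hom] by (rule clopup_map_cong[OF coded[OF Z]])
      also have "\<dots> = compose (carrier (clopup_lattice Z)) (clopup_map X Y (box X R)) (clopup_map Y Z (box Y S))"
        using compose_clopup_map[OF coded[OF XY(1)] coded[OF XY(2)] coded[OF Z] R[OF S_hom]] by simp
      finally show "on_Hom box_functor X Z (Comp (PS_R \<K>) X Y Z S R) = Comp (dual_cat (DL_M \<K>))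
          (on_Ob box_functor X) (on_Ob box_functor Y) (on_Ob box_functor Z)
          (on_Hom box_functor Y Z S) (on_Hom box_functor X Y R)"
        unfolding box_functor_def dual_cat_def DL_M_def PS_R_def by simp
    qed
  next
    fix X assume "X \<in> Ob (PS_R \<K>)"
    then show "Idn (PS_R \<K>) X \<in> Hom (PS_R \<K>) X X" unfolding PS_R_def by (simp add: leq_Hom_R)
  next
    fix X Y Z R S assume "X \<in> Ob (PS_R \<K>)" "Z \<in> Ob (PS_R \<K>)" "R \<in> Hom (PS_R \<K>) X Y" "S \<in> Hom (PS_R \<K>) Y Z"
    then show "Comp (PS_R \<K>) X Y Z S R \<in> Hom (PS_R \<K>) X Z"
      using star(1) unfolding PS_R_def by simp
  next
    fix X Y assume "X \<in> Ob (PS_R \<K>)" "Y \<in> Ob (PS_R \<K>)"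
    then show "bij_betw (on_Hom box_functor X Y) (Hom (PS_R \<K>) X Y)
        (Hom (dual_cat (DL_M \<K>)) (on_Ob box_functor X) (on_Ob box_functor Y))"
      using coded_priestley_pair.bij_betw_box[OF pair]
      unfolding box_functor_def dual_cat_def DL_M_def PS_R_def by simp
  next
    fix D assume "D \<in> Ob (dual_cat (DL_M \<K>))"
    then have "bounded_distrib_lattice D" "small \<K> (carrier D)" unfolding dual_cat_def DL_M_def by simp_all
    then obtain X where "priestley_space X" "small \<K> (ClopUp X)"
      "\<exists>f. is_iso (DL_M \<K>) D (clopup_lattice X) f" "\<exists>f. is_iso (DL_L \<K>) D (clopup_lattice X) f"
      by (rule clopup_lattice_surj[OF \<K>])
    then show "\<exists>X\<in>Ob (PS_R \<K>). \<exists>f. is_iso (dual_cat (DL_M \<K>)) (on_Ob box_functor X) D f"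
      unfolding PS_R_def box_functor_def is_iso_dual by auto
  qed
qed

lemma weak_equivalence_PS_PS:
  fixes \<K> :: "'v set set"
  assumes \<K>: "size_class \<K>"
  shows "weak_equivalence (PS_PS \<K>) (dual_cat (DL_L \<K>)) pbox_functor"
proof -
  have coded: "coded_priestley_space X" if "X \<in> Ob (PS_PS \<K>)" for X
    using that coded_priestley_space_if_small[OF \<K>] unfolding PS_PS_def by simp
  have pair: "coded_priestley_pair X Y" if "X \<in> Ob (PS_PS \<K>)" "Y \<in> Ob (PS_PS \<K>)" for X Y
    using that coded by (intro coded_priestley_pair.intro)
  have bij: "bij_betw (\<lambda>f. clopup_map X Y (pbox X Y f)) (Hom_PS X Y)
      (Hom_L (clopup_lattice Y) (clopup_lattice X))"
    if "X \<in> Ob (PS_PS \<K>)" "Y \<in> Ob (PS_PS \<K>)" for X Y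
    using pair[OF that] by (rule coded_priestley_pair.bij_betw_pbox)
  show ?thesis
  proof (rule weak_equivalenceI)
    show "category (dual_cat (DL_L \<K>))" by (intro category_dual category_DL_L)
    show "is_functor (PS_PS \<K>) (dual_cat (DL_L \<K>)) pbox_functor"
      unfolding is_functor_def
    proof (intro conjI ballI)
      fix X assume X: "X \<in> Ob (PS_PS \<K>)"
      then show "on_Ob pbox_functor X \<in> Ob (dual_cat (DL_L \<K>))"
        using coded_priestley_space.bounded_distrib_lattice_clopup_lattice[OF coded[OF X]] small_clopup_lattice
        unfolding pbox_functor_def dual_cat_def DL_L_def PS_PS_def by auto
      have "priestley_space X" using X unfolding PS_PS_def by simp
      then show "on_Hom pbox_functor X X (Idn (PS_PS \<K>) X) = Idn (dual_cat (DL_L \<K>)) (on_Ob pbox_functor X)"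
        using clopup_map_id[OF coded[OF X] id_Hom_PS(2)]
        unfolding pbox_functor_def dual_cat_def DL_L_def PS_PS_def by simp
    next
      fix X Y f assume XY: "X \<in> Ob (PS_PS \<K>)" "Y \<in> Ob (PS_PS \<K>)" and "f \<in> Hom (PS_PS \<K>) X Y"
      then have f: "f \<in> Hom_PS X Y" unfolding PS_PS_def by simp
      then show "on_Hom pbox_functor X Y f \<in> Hom (dual_cat (DL_L \<K>)) (on_Ob pbox_functor X) (on_Ob pbox_functor Y)"
        using bij_betw_apply[OF bij[OF XY]] unfolding pbox_functor_def dual_cat_def DL_L_def by simp
      fix Z g assume Z: "Z \<in> Ob (PS_PS \<K>)" and "g \<in> Hom (PS_PS \<K>) Y Z"
      then have g: "g \<in> Hom_PS Y Z" unfolding PS_PS_def by simp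
      then have "\<And>U. U \<in> ClopUp Z \<Longrightarrow> pbox Y Z g U \<in> ClopUp Y" unfolding Hom_PS_iff by blast
      then have "clopup_map X Z (pbox X Z (g \<circ>\<^sub>m f)) =
          compose (carrier (clopup_lattice Z)) (clopup_map X Y (pbox X Y f)) (clopup_map Y Z (pbox Y Z g))"
        unfolding pbox_comp[OF f g, abs_def]
        using compose_clopup_map[OF coded[OF XY(1)] coded[OF XY(2)] coded[OF Z]] by simp
      then show "on_Hom pbox_functor X Z (Comp (PS_PS \<K>) X Y Z g f) = Comp (dual_cat (DL_L \<K>))
          (on_Ob pbox_functor X) (on_Ob pbox_functor Y) (on_Ob pbox_functor Z)
          (on_Hom pbox_functor Y Z g) (on_Hom pbox_functor X Y f)"
        unfolding pbox_functor_def dual_cat_def DL_L_def PS_PS_def by simp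
    qed
  next
    fix X assume "X \<in> Ob (PS_PS \<K>)"
    then show "Idn (PS_PS \<K>) X \<in> Hom (PS_PS \<K>) X X" unfolding PS_PS_def by (simp add: id_Hom_PS)
  next
    fix X Y Z f g assume "X \<in> Ob (PS_PS \<K>)" "f \<in> Hom (PS_PS \<K>) X Y" "g \<in> Hom (PS_PS \<K>) Y Z"
    then show "Comp (PS_PS \<K>) X Y Z g f \<in> Hom (PS_PS \<K>) X Z"
      using comp_Hom_PS[of X f Y g Z] unfolding PS_PS_def by simp
  next
    fix X Y assume "X \<in> Ob (PS_PS \<K>)" "Y \<in> Ob (PS_PS \<K>)"
    then show "bij_betw (on_Hom pbox_functor X Y) (Hom (PS_PS \<K>) X Y)
        (Hom (dual_cat (DL_L \<K>)) (on_Ob pbox_functor X) (on_Ob pbox_functor Y))"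
      using bij unfolding pbox_functor_def dual_cat_def DL_L_def PS_PS_def by simp
  next
    fix D assume "D \<in> Ob (dual_cat (DL_L \<K>))"
    then have "bounded_distrib_lattice D" "small \<K> (carrier D)" unfolding dual_cat_def DL_L_def by simp_all
    then obtain X where "priestley_space X" "small \<K> (ClopUp X)"
      "\<exists>f. is_iso (DL_M \<K>) D (clopup_lattice X) f" "\<exists>f. is_iso (DL_L \<K>) D (clopup_lattice X) f"
      by (rule clopup_lattice_surj[OF \<K>])
    then show "\<exists>X\<in>Ob (PS_PS \<K>). \<exists>f. is_iso (dual_cat (DL_L \<K>)) (on_Ob pbox_functor X) D f"
      unfolding PS_PS_def pbox_functor_def is_iso_dual by auto
  qed
qed

theorem theorem6p19:
  fixes \<K> :: "'v set set"
  assumes "size_class \<K>"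
  shows "(equivalent_cats (CohFrm_Sup \<K>) (DL_M \<K>) \<and>
          dually_equivalent_cats (CohFrm_Sup \<K>) (PS_R \<K>)) \<and>
         (equivalent_cats (CohFrm_FInf \<K>) (DL_L \<K>) \<and>
          dually_equivalent_cats (CohFrm_FInf \<K>) (PS_PS \<K>))"
proof -
  note Sup = weak_equivalence_CohFrm_Sup[OF assms] and FInf = weak_equivalence_CohFrm_FInf[OF assms]
  have "dually_equivalent_cats (CohFrm_Sup \<K>) (PS_R \<K>)"
    unfolding dually_equivalent_cats_def
    using weak_equivalence_dual[OF Sup] weak_equivalence_PS_R[OF assms] by (rule equivalent_cats_if_cospan)
  moreover have "dually_equivalent_cats (CohFrm_FInf \<K>) (PS_PS \<K>)"
    unfolding dually_equivalent_cats_def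
    using weak_equivalence_dual[OF FInf] weak_equivalence_PS_PS[OF assms] by (rule equivalent_cats_if_cospan)
  ultimately show ?thesis
    using Sup FInf by (simp add: equivalent_cats_if_weak_equivalence)
qed

end
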